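(* Let $\kappa$ be an inaccessible cardinal and let $\pi : E\to U$ be a generic small Kan fibration of simplicial sets with $U$ a Kan complex. Let $W = W(\pi)$ be the W-type of $\pi$ in simplicial sets, and let $B\to W\times W$ be the initial algebra of the bisimulation endofunctor $\Phi$ on $\mathbf{sSet}/(W\times W)$. Then $B\to W\times W$ is a pseudo-equivalence relation on $W$ and a Kan fibration, and the quotient $W/B$ is a Kan complex.
   Context: $\mathbf{sSet}$ is the category of simplicial sets. A Kan fibration has small fibres if all its fibres (the sets of simplices lying over a given simplex of the base) have cardinality smaller than $\kappa$. A generic small Kan fibration is a Kan fibration $\pi : E\to U$ with small fibres such that every Kan fibration with small fibres is a pullback of $\pi$. The W-type $W = W(\pi)$ is the initial algebra of the polynomial functor $P_\pi = \Sigma_U\circ\Pi_\pi\circ(-\times E) : \mathbf{sSet}\to\mathbf{sSet}$, where $-\times E : \mathbf{sSet}\to\mathbf{sSet}/E$, $\Pi_\pi : \mathbf{sSet}/E\to\mathbf{sSet}/U$ is right adjoint to pullback along $\pi$, and $\Sigma_U : \mathbf{sSet}/U\to\mathbf{sSet}$ is the forgetful functor. In internal set-theoretic notation $P_\pi(X) = \sum_{u\in U}X^{E_u}$, and every element of $W$ is uniquely of the form $\sup_u(t)$ with $u\in U$ and $t : E_u\to W$. The bisimulation endofunctor $\Phi$ on $\mathbf{sSet}/(W\times W)$ is given, in the internal set-theoretic notation of the locally cartesian closed category $\mathbf{sSet}$, by $$\Phi(X)_{\sup_u(t),\,\sup_{u'}(t')} = \Big(\prod_{e\in E_u}\sum_{e'\in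 E_{u'}}X_{t(e),t'(e')}\Big)\times\Big(\prod_{e'\in E_{u'}}\sum_{e\in E_u}X_{t(e),t'(e')}\Big).$$ Explicitly: let $\bar W = E\times_U W$, where $W\to U$ is $\sup_u(t)\mapsto u$, let $p : \bar W\to W$ be the projection and $q : \bar W\to W$ the map $(e,\sup_u(t))\mapsto t(e)$. Then $\Phi(X)$ is the product in $\mathbf{sSet}/(W\times W)$ of $\Pi_{p\times 1_W}\Sigma_{1_{\bar W}\times p}(q\times q)^*X$ and $\Pi_{1_W\times p}\Sigma_{p\times 1_{\bar W}}(q\times q)^*X$. This is a dependent polynomial functor, and its initial algebra exists. A map $(s,t) : R\to Y\times Y$ is a pseudo-equivalence relation on $Y$ if: (i) there is $\rho : Y\to R$ such that $(s,t)\rho$ is the diagonal; (ii) there is $\sigma : R\to R$ with $s\sigma = t$ and $t\sigma = s$; (iii) if $P$ is the pullback of $t : R\to Y$ and $s : R\to Y$, with projections $p_{12},p_{23} : P\to R$ satisfying $tp_{12} = sp_{23}$, then there is $\tau : P\to R$ with $s\tau = sp_{12}$ and $t\tau = tp_{23}$. The quotient $Y/R$ is the coequalizer of $s,t : R\rightrightarrows Y$. *)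

theory Defs
  imports Main "HOL-Library.FuncSet"
begin

unbundle cardinal_syntax

section \<open>Cardinals and the ambient universe\<close>

definition inaccessible :: "'k rel \<Rightarrow> bool" where
  "inaccessible \<kappa> \<longleftrightarrow> Card_order \<kappa> \<and> natLeq <o \<kappa> \<and> regularCard \<kappa> \<and>
     (\<forall>A. A \<subseteq> Field \<kappa> \<and> |A| <o \<kappa> \<longrightarrow> |Pow A| <o \<kappa>)"

text \<open>HOL cannot quantify over all types inside a formula, so the category of simplicial sets is
  the category of simplicial sets whose simplices are elements of a fixed type, the universe.
  A universe has at least \<open>\<kappa>\<close> elements and is closed under exponentiation by sets of cardinality
  smaller than \<open>\<kappa>\<close>. The polynomial functors below are built from families indexed by such sets,
  so their values on simplicial sets in the universe embed into the universe again. Hence Lambek's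
  lemma holds, and initiality among the algebras in the universe implies initiality among all.\<close>

definition closed_universe :: "'k rel \<Rightarrow> 'v set \<Rightarrow> bool" where
  "closed_universe \<kappa> V \<longleftrightarrow> \<kappa> \<le>o |V| \<and> (\<forall>A. A \<subseteq> V \<and> |A| <o \<kappa> \<longrightarrow> |V| ^c |A| \<le>o |V| )"


section \<open>Simplicial sets\<close>

text \<open>Morphisms \<open>[m] \<rightarrow> [n]\<close> of the simplex category. All functions are extensional (\<open>undefined\<close>
  outside of their domain), so that hom-sets are honest sets.\<close>

definition deltas :: "nat \<Rightarrow> nat \<Rightarrow> (nat \<Rightarrow> nat) set" where
  "deltas m n = {\<theta> \<in> {..m} \<rightarrow>\<^sub>E {..n}. mono_on {..m} \<theta>}"

definition did :: "nat \<Rightarrow> nat \<Rightarrow> nat" where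
  "did n = (\<lambda>i\<in>{..n}. i)"

text \<open>\<open>act X m n \<theta>\<close> is the action \<open>X\<^sub>n \<rightarrow> X\<^sub>m\<close> of \<open>\<theta> : [m] \<rightarrow> [n]\<close>.\<close>

record 'a sset =
  spx :: "nat \<Rightarrow> 'a set"
  act :: "nat \<Rightarrow> nat \<Rightarrow> (nat \<Rightarrow> nat) \<Rightarrow> 'a \<Rightarrow> 'a"

definition sset :: "'a sset \<Rightarrow> bool" where
  "sset X \<longleftrightarrow>
     (\<forall>m n. \<forall>\<theta>\<in>deltas m n. act X m n \<theta> \<in> spx X n \<rightarrow> spx X m) \<and>
     (\<forall>n. \<forall>x\<in>spx X n. act X n n (did n) x = x) \<and>
     (\<forall>k m n. \<forall>\<phi>\<in>deltas k m. \<forall>\<theta>\<in>deltas m n. \<forall>x\<in>spx X n.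
        act X k n (compose {..k} \<theta> \<phi>) x = act X k m \<phi> (act X m n \<theta> x))"

type_synonym ('a, 'b) smap = "nat \<Rightarrow> 'a \<Rightarrow> 'b"

definition smaps :: "'a sset \<Rightarrow> 'b sset \<Rightarrow> ('a, 'b) smap set" where
  "smaps X Y = {f. (\<forall>n. f n \<in> spx X n \<rightarrow>\<^sub>E spx Y n) \<and>
     (\<forall>m n. \<forall>\<theta>\<in>deltas m n. \<forall>x\<in>spx X n. f m (act X m n \<theta> x) = act Y m n \<theta> (f n x))}"

definition sid :: "'a sset \<Rightarrow> ('a, 'a) smap" where
  "sid X = (\<lambda>n. \<lambda>x\<in>spx X n. x)"

definition scomp :: "'a sset \<Rightarrow> ('b, 'c) smap \<Rightarrow> ('a, 'b) smap \<Rightarrow> ('a, 'c) smap" where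
  "scomp X g f = (\<lambda>n. compose (spx X n) (g n) (f n))"

definition std_simplex :: "nat \<Rightarrow> (nat \<Rightarrow> nat) sset" where
  "std_simplex n = \<lparr>spx = (\<lambda>m. deltas m n), act = (\<lambda>k m \<phi> \<theta>. compose {..k} \<theta> \<phi>)\<rparr>"

definition horn :: "nat \<Rightarrow> nat \<Rightarrow> (nat \<Rightarrow> nat) sset" where
  "horn n k = \<lparr>spx = (\<lambda>m. {\<theta> \<in> deltas m n. \<exists>j\<in>{..n} - {k}. j \<notin> \<theta> ` {..m}}),
               act = (\<lambda>l m \<phi> \<theta>. compose {..l} \<theta> \<phi>)\<rparr>"

definition yoneda :: "'a sset \<Rightarrow> nat \<Rightarrow> 'a \<Rightarrow> (nat \<Rightarrow> nat, 'a) smap" where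
  "yoneda X n x = (\<lambda>m. \<lambda>\<theta>\<in>deltas m n. act X m n \<theta> x)"

definition sprod :: "'a sset \<Rightarrow> 'b sset \<Rightarrow> ('a \<times> 'b) sset" where
  "sprod X Y = \<lparr>spx = (\<lambda>n. spx X n \<times> spx Y n),
                act = (\<lambda>m n \<theta> (x, y). (act X m n \<theta> x, act Y m n \<theta> y))\<rparr>"

definition smap_prod :: "'a sset \<Rightarrow> 'b sset \<Rightarrow> ('a, 'c) smap \<Rightarrow> ('b, 'd) smap \<Rightarrow> ('a \<times> 'b, 'c \<times> 'd) smap" where
  "smap_prod X Y f g = (\<lambda>n. \<lambda>(x, y)\<in>spx X n \<times> spx Y n. (f n x, g n y))"

definition pullback :: "'a sset \<Rightarrow> 'b sset \<Rightarrow> ('a, 'c) smap \<Rightarrow> ('b, 'c) smap \<Rightarrow> ('a \<times> 'b) sset" where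
  "pullback X Y f g = \<lparr>spx = (\<lambda>n. {(x, y) \<in> spx X n \<times> spx Y n. f n x = g n y}),
                       act = act (sprod X Y)\<rparr>"

definition sfst :: "('a \<times> 'b) sset \<Rightarrow> ('a \<times> 'b, 'a) smap" where
  "sfst P = (\<lambda>n. restrict fst (spx P n))"

definition ssnd :: "('a \<times> 'b) sset \<Rightarrow> ('a \<times> 'b, 'b) smap" where
  "ssnd P = (\<lambda>n. restrict snd (spx P n))"


section \<open>Kan fibrations\<close>

definition kan_fibration :: "'a sset \<Rightarrow> 'b sset \<Rightarrow> ('a, 'b) smap \<Rightarrow> bool" where
  "kan_fibration X Y f \<longleftrightarrow> sset X \<and> sset Y \<and> f \<in> smaps X Y \<and>
     (\<forall>n k. 1 \<le> n \<and> k \<le> n \<longrightarrow>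
       (\<forall>h\<in>smaps (horn n k) X. \<forall>y\<in>smaps (std_simplex n) Y.
         (\<forall>m. \<forall>\<theta>\<in>spx (horn n k) m. f m (h m \<theta>) = y m \<theta>) \<longrightarrow>
         (\<exists>l\<in>smaps (std_simplex n) X.
            (\<forall>m. \<forall>\<theta>\<in>spx (horn n k) m. l m \<theta> = h m \<theta>) \<and>
            (\<forall>m. \<forall>\<theta>\<in>spx (std_simplex n) m. f m (l m \<theta>) = y m \<theta>))))"

definition kan_complex :: "'a sset \<Rightarrow> bool" where
  "kan_complex X \<longleftrightarrow> sset X \<and>
     (\<forall>n k. 1 \<le> n \<and> k \<le> n \<longrightarrow>
       (\<forall>h\<in>smaps (horn n k) X. \<exists>l\<in>smaps (std_simplex n) X.
          \<forall>m. \<forall>\<theta>\<in>spx (horn n k) m. l m \<theta> = h m \<theta>))"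

definition small_fibres :: "'k rel \<Rightarrow> 'a sset \<Rightarrow> 'b sset \<Rightarrow> ('a, 'b) smap \<Rightarrow> bool" where
  "small_fibres \<kappa> X Y f \<longleftrightarrow> (\<forall>n. \<forall>y\<in>spx Y n. |{x \<in> spx X n. f n x = y}| <o \<kappa>)"

text \<open>\<open>f : Y \<rightarrow> X\<close> is the pullback of \<open>\<pi> : E \<rightarrow> U\<close> along \<open>c : X \<rightarrow> U\<close>, with top map \<open>d : Y \<rightarrow> E\<close>, if the
  comparison map to the canonical pullback is an isomorphism.\<close>

definition is_pullback_of ::
  "'y sset \<Rightarrow> 'x sset \<Rightarrow> ('y, 'x) smap \<Rightarrow> 'e sset \<Rightarrow> ('e, 'u) smap \<Rightarrow> ('x, 'u) smap \<Rightarrow> ('y, 'e) smap \<Rightarrow> bool" where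
  "is_pullback_of Y X f E \<pi> c d \<longleftrightarrow>
     (\<forall>n. bij_betw (\<lambda>y. (f n y, d n y)) (spx Y n) (spx (pullback X E c \<pi>) n))"

definition generic_small_kan_fibration :: "'k rel \<Rightarrow> 'v sset \<Rightarrow> 'v sset \<Rightarrow> ('v, 'v) smap \<Rightarrow> bool" where
  "generic_small_kan_fibration \<kappa> E U \<pi> \<longleftrightarrow>
     kan_fibration E U \<pi> \<and> small_fibres \<kappa> E U \<pi> \<and>
     (\<forall>(Y :: 'v sset) (X :: 'v sset) f. kan_fibration Y X f \<and> small_fibres \<kappa> Y X f \<longrightarrow>
        (\<exists>c\<in>smaps X U. \<exists>d\<in>smaps Y E. is_pullback_of Y X f E \<pi> c d))"


section \<open>Slice categories\<close>

record ('a, 'c) slice =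
  tot :: "'a sset"
  str :: "('a, 'c) smap"

definition slice_over :: "'c sset \<Rightarrow> ('a, 'c) slice \<Rightarrow> bool" where
  "slice_over C X \<longleftrightarrow> sset (tot X) \<and> str X \<in> smaps (tot X) C"

definition slice_maps :: "('a, 'c) slice \<Rightarrow> ('b, 'c) slice \<Rightarrow> ('a, 'b) smap set" where
  "slice_maps X Y = {h \<in> smaps (tot X) (tot Y). scomp (tot X) (str Y) h = str X}"

text \<open>The functor \<open>f\<^sup>*\<close> for a map \<open>f\<close> with domain \<open>A\<close>.\<close>

definition pull :: "'a sset \<Rightarrow> ('a, 'c) smap \<Rightarrow> ('x, 'c) slice \<Rightarrow> ('a \<times> 'x, 'a) slice" where
  "pull A f X = (let P = pullback A (tot X) f (str X) in \<lparr>tot = P, str = sfst P\<rparr>)"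

definition pull_map :: "'a sset \<Rightarrow> ('a, 'c) smap \<Rightarrow> ('x, 'c) slice \<Rightarrow> ('x, 'y) smap \<Rightarrow> ('a \<times> 'x, 'a \<times> 'y) smap" where
  "pull_map A f X h = (\<lambda>n. \<lambda>(a, x)\<in>spx (tot (pull A f X)) n. (a, h n x))"

text \<open>The functor \<open>\<Sigma>\<^sub>g\<close>, which is the identity on maps.\<close>

definition dsum :: "('a, 'c) smap \<Rightarrow> ('x, 'a) slice \<Rightarrow> ('x, 'c) slice" where
  "dsum g X = \<lparr>tot = tot X, str = scomp (tot X) g (str X)\<rparr>"

text \<open>The functor \<open>\<Pi>\<^sub>f\<close> for a map \<open>f : A \<rightarrow> B\<close>. An \<open>n\<close>-simplex of \<open>\<Pi>\<^sub>f Y\<close> over \<open>b \<in> B\<^sub>n\<close> is a map over \<open>A\<close>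
  from the fibre of \<open>f\<close> over \<open>b\<close>, which is the pullback of \<open>f\<close> along \<open>b : \<Delta>[n] \<rightarrow> B\<close>, to \<open>Y\<close>. That \<open>\<Pi>\<^sub>f\<close> is
  right adjoint to \<open>f\<^sup>*\<close> is proved in \<open>dprod_counit\<close> and \<open>dprod_universal\<close> below.\<close>

definition fib :: "'a sset \<Rightarrow> 'b sset \<Rightarrow> ('a, 'b) smap \<Rightarrow> nat \<Rightarrow> 'b \<Rightarrow> ((nat \<Rightarrow> nat) \<times> 'a) sset" where
  "fib A B f n b = pullback (std_simplex n) A (yoneda B n b) f"

definition fib_slice :: "'a sset \<Rightarrow> 'b sset \<Rightarrow> ('a, 'b) smap \<Rightarrow> nat \<Rightarrow> 'b \<Rightarrow> ((nat \<Rightarrow> nat) \<times> 'a, 'a) slice" where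
  "fib_slice A B f n b = \<lparr>tot = fib A B f n b, str = ssnd (fib A B f n b)\<rparr>"

definition dprod_tot :: "'a sset \<Rightarrow> 'b sset \<Rightarrow> ('a, 'b) smap \<Rightarrow> ('y, 'a) slice \<Rightarrow>
    ('b \<times> ((nat \<Rightarrow> nat) \<times> 'a, 'y) smap) sset" where
  "dprod_tot A B f Y =
     \<lparr>spx = (\<lambda>n. {(b, s). b \<in> spx B n \<and> s \<in> slice_maps (fib_slice A B f n b) Y}),
      act = (\<lambda>m n \<phi> (b, s). (act B m n \<phi> b,
               \<lambda>k. \<lambda>(\<theta>, a)\<in>spx (fib A B f m (act B m n \<phi> b)) k. s k (compose {..k} \<phi> \<theta>, a)))\<rparr>"

definition dprod :: "'a sset \<Rightarrow> 'b sset \<Rightarrow> ('a, 'b) smap \<Rightarrow> ('y, 'a) slice \<Rightarrow>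
    ('b \<times> ((nat \<Rightarrow> nat) \<times> 'a, 'y) smap, 'b) slice" where
  "dprod A B f Y = \<lparr>tot = dprod_tot A B f Y, str = sfst (dprod_tot A B f Y)\<rparr>"

definition dprod_map :: "'a sset \<Rightarrow> 'b sset \<Rightarrow> ('a, 'b) smap \<Rightarrow> ('y, 'a) slice \<Rightarrow> ('y, 'z) smap \<Rightarrow>
    ('b \<times> ((nat \<Rightarrow> nat) \<times> 'a, 'y) smap, 'b \<times> ((nat \<Rightarrow> nat) \<times> 'a, 'z) smap) smap" where
  "dprod_map A B f Y h =
     (\<lambda>n. \<lambda>(b, s)\<in>spx (dprod_tot A B f Y) n. (b, scomp (fib A B f n b) h s))"

definition dprod_eval :: "'a sset \<Rightarrow> 'b sset \<Rightarrow> ('a, 'b) smap \<Rightarrow> ('y, 'a) slice \<Rightarrow>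
    ('a \<times> 'b \<times> ((nat \<Rightarrow> nat) \<times> 'a, 'y) smap, 'y) smap" where
  "dprod_eval A B f Y =
     (\<lambda>n. \<lambda>(a, b, s)\<in>spx (tot (pull A f (dprod A B f Y))) n. s n (did n, a))"

definition slice_prod :: "('x, 'c) slice \<Rightarrow> ('y, 'c) slice \<Rightarrow> ('x \<times> 'y, 'c) slice" where
  "slice_prod X Y = (let P = pullback (tot X) (tot Y) (str X) (str Y)
                     in \<lparr>tot = P, str = scomp P (str X) (sfst P)\<rparr>)"

definition slice_prod_map :: "('x, 'c) slice \<Rightarrow> ('y, 'c) slice \<Rightarrow> ('x, 'a) smap \<Rightarrow> ('y, 'b) smap \<Rightarrow>
    ('x \<times> 'y, 'a \<times> 'b) smap" where
  "slice_prod_map X Y f g = (\<lambda>n. \<lambda>(x, y)\<in>spx (tot (slice_prod X Y)) n. (f n x, g n y))"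


section \<open>Initial algebras\<close>

text \<open>\<open>F\<close> is the action of the functor on objects and \<open>Fm X\<close> its action on maps with domain \<open>X\<close>.\<close>

definition initial_algebra :: "('v sset \<Rightarrow> 'f sset) \<Rightarrow> ('v sset \<Rightarrow> ('v, 'v) smap \<Rightarrow> ('f, 'f) smap) \<Rightarrow>
    'v sset \<Rightarrow> ('f, 'v) smap \<Rightarrow> bool" where
  "initial_algebra F Fm W \<alpha> \<longleftrightarrow> sset W \<and> \<alpha> \<in> smaps (F W) W \<and>
     (\<forall>(X :: 'v sset) \<beta>. sset X \<and> \<beta> \<in> smaps (F X) X \<longrightarrow>
        (\<exists>!h. h \<in> smaps W X \<and> scomp (F W) h \<alpha> = scomp (F W) \<beta> (Fm W h)))"

definition initial_slice_algebra :: "'c sset \<Rightarrow> (('v, 'c) slice \<Rightarrow> ('f, 'c) slice) \<Rightarrow>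
    (('v, 'c) slice \<Rightarrow> ('v, 'v) smap \<Rightarrow> ('f, 'f) smap) \<Rightarrow> ('v, 'c) slice \<Rightarrow> ('f, 'v) smap \<Rightarrow> bool" where
  "initial_slice_algebra C F Fm B \<alpha> \<longleftrightarrow> slice_over C B \<and> \<alpha> \<in> slice_maps (F B) B \<and>
     (\<forall>(X :: ('v, 'c) slice) \<beta>. slice_over C X \<and> \<beta> \<in> slice_maps (F X) X \<longrightarrow>
        (\<exists>!h. h \<in> slice_maps B X \<and> scomp (tot (F B)) h \<alpha> = scomp (tot (F B)) \<beta> (Fm B h)))"


section \<open>The polynomial functor and the W-type\<close>

definition times_slice :: "'e sset \<Rightarrow> 'x sset \<Rightarrow> ('x \<times> 'e, 'e) slice" where
  "times_slice E X = \<lparr>tot = sprod X E, str = ssnd (sprod X E)\<rparr>"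

type_synonym ('u, 'e, 'x) poly = "'u \<times> ((nat \<Rightarrow> nat) \<times> 'e, 'x \<times> 'e) smap"

definition poly :: "'e sset \<Rightarrow> 'u sset \<Rightarrow> ('e, 'u) smap \<Rightarrow> 'x sset \<Rightarrow> ('u, 'e, 'x) poly sset" where
  "poly E U \<pi> X = tot (dprod E U \<pi> (times_slice E X))"

definition poly_map :: "'e sset \<Rightarrow> 'u sset \<Rightarrow> ('e, 'u) smap \<Rightarrow> 'x sset \<Rightarrow> ('x, 'y) smap \<Rightarrow>
    (('u, 'e, 'x) poly, ('u, 'e, 'y) poly) smap" where
  "poly_map E U \<pi> X h = dprod_map E U \<pi> (times_slice E X) (smap_prod X E h (sid E))"

definition is_W_type :: "'v sset \<Rightarrow> 'v sset \<Rightarrow> ('v, 'v) smap \<Rightarrow> 'v sset \<Rightarrow> (('v, 'v, 'v) poly, 'v) smap \<Rightarrow> bool" where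
  "is_W_type E U \<pi> W \<alpha> \<longleftrightarrow> initial_algebra (poly E U \<pi>) (poly_map E U \<pi>) W \<alpha>"


section \<open>The bisimulation endofunctor\<close>

text \<open>The structure map \<open>\<alpha> : P\<^sub>\<pi>(W) \<rightarrow> W\<close>, \<open>(u, t) \<mapsto> sup\<^sub>u(t)\<close>, of the W-type is bijective by Lambek's lemma.
  The following is its inverse.\<close>

definition unsup :: "'e sset \<Rightarrow> 'u sset \<Rightarrow> ('e, 'u) smap \<Rightarrow> 'w sset \<Rightarrow> (('u, 'e, 'w) poly, 'w) smap \<Rightarrow>
    ('w, ('u, 'e, 'w) poly) smap" where
  "unsup E U \<pi> W \<alpha> = (\<lambda>n. \<lambda>w\<in>spx W n. inv_into (spx (poly E U \<pi> W) n) (\<alpha> n) w)"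

definition root :: "'e sset \<Rightarrow> 'u sset \<Rightarrow> ('e, 'u) smap \<Rightarrow> 'w sset \<Rightarrow> (('u, 'e, 'w) poly, 'w) smap \<Rightarrow>
    ('w, 'u) smap" where
  "root E U \<pi> W \<alpha> = (\<lambda>n. \<lambda>w\<in>spx W n. fst (unsup E U \<pi> W \<alpha> n w))"

definition Wbar :: "'e sset \<Rightarrow> 'u sset \<Rightarrow> ('e, 'u) smap \<Rightarrow> 'w sset \<Rightarrow> (('u, 'e, 'w) poly, 'w) smap \<Rightarrow>
    ('e \<times> 'w) sset" where
  "Wbar E U \<pi> W \<alpha> = pullback E W \<pi> (root E U \<pi> W \<alpha>)"

text \<open>The map \<open>(e, sup\<^sub>u(t)) \<mapsto> t(e)\<close>. An \<open>n\<close>-simplex \<open>e\<close> of \<open>E\<close> over \<open>u\<close> is the \<open>n\<close>-simplex \<open>(id, e)\<close> of the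
  fibre over \<open>u\<close>, and \<open>t\<close> takes values in \<open>W \<times> E\<close>.\<close>

definition subtree :: "'e sset \<Rightarrow> 'u sset \<Rightarrow> ('e, 'u) smap \<Rightarrow> 'w sset \<Rightarrow> (('u, 'e, 'w) poly, 'w) smap \<Rightarrow>
    ('e \<times> 'w, 'w) smap" where
  "subtree E U \<pi> W \<alpha> = (\<lambda>n. \<lambda>(e, w)\<in>spx (Wbar E U \<pi> W \<alpha>) n.
     fst (snd (unsup E U \<pi> W \<alpha> n w) n (did n, e)))"

text \<open>The functor \<open>\<Phi>\<close>, for arbitrary maps \<open>p, q : V \<rightarrow> W\<close> in place of the projection and the subtree map.\<close>

definition bisim_pull :: "'v sset \<Rightarrow> ('v, 'w) smap \<Rightarrow> ('x, 'w \<times> 'w) slice \<Rightarrow>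
    (('v \<times> 'v) \<times> 'x, 'v \<times> 'v) slice" where
  "bisim_pull V q X = pull (sprod V V) (smap_prod V V q q) X"

definition bisim_pull_map :: "'v sset \<Rightarrow> ('v, 'w) smap \<Rightarrow> ('x, 'w \<times> 'w) slice \<Rightarrow> ('x, 'y) smap \<Rightarrow>
    (('v \<times> 'v) \<times> 'x, ('v \<times> 'v) \<times> 'y) smap" where
  "bisim_pull_map V q X h = pull_map (sprod V V) (smap_prod V V q q) X h"

type_synonym ('w, 'v, 'x) bisim =
  "(('w \<times> 'w) \<times> ((nat \<Rightarrow> nat) \<times> 'v \<times> 'w, ('v \<times> 'v) \<times> 'x) smap) \<times>
   (('w \<times> 'w) \<times> ((nat \<Rightarrow> nat) \<times> 'w \<times> 'v, ('v \<times> 'v) \<times> 'x) smap)"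

definition bisim_left :: "'w sset \<Rightarrow> 'v sset \<Rightarrow> ('v, 'w) smap \<Rightarrow> ('v, 'w) smap \<Rightarrow> ('x, 'w \<times> 'w) slice \<Rightarrow>
    (('w \<times> 'w) \<times> ((nat \<Rightarrow> nat) \<times> 'v \<times> 'w, ('v \<times> 'v) \<times> 'x) smap, 'w \<times> 'w) slice" where
  "bisim_left W V p q X =
     dprod (sprod V W) (sprod W W) (smap_prod V W p (sid W))
       (dsum (smap_prod V V (sid V) p) (bisim_pull V q X))"

definition bisim_left_map :: "'w sset \<Rightarrow> 'v sset \<Rightarrow> ('v, 'w) smap \<Rightarrow> ('v, 'w) smap \<Rightarrow> ('x, 'w \<times> 'w) slice \<Rightarrow>
    ('x, 'y) smap \<Rightarrow>
    (('w \<times> 'w) \<times> ((nat \<Rightarrow> nat) \<times> 'v \<times> 'w, ('v \<times> 'v) \<times> 'x) smap,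
     ('w \<times> 'w) \<times> ((nat \<Rightarrow> nat) \<times> 'v \<times> 'w, ('v \<times> 'v) \<times> 'y) smap) smap" where
  "bisim_left_map W V p q X h =
     dprod_map (sprod V W) (sprod W W) (smap_prod V W p (sid W))
       (dsum (smap_prod V V (sid V) p) (bisim_pull V q X)) (bisim_pull_map V q X h)"

definition bisim_right :: "'w sset \<Rightarrow> 'v sset \<Rightarrow> ('v, 'w) smap \<Rightarrow> ('v, 'w) smap \<Rightarrow> ('x, 'w \<times> 'w) slice \<Rightarrow>
    (('w \<times> 'w) \<times> ((nat \<Rightarrow> nat) \<times> 'w \<times> 'v, ('v \<times> 'v) \<times> 'x) smap, 'w \<times> 'w) slice" where
  "bisim_right W V p q X =
     dprod (sprod W V) (sprod W W) (smap_prod W V (sid W) p)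
       (dsum (smap_prod V V p (sid V)) (bisim_pull V q X))"

definition bisim_right_map :: "'w sset \<Rightarrow> 'v sset \<Rightarrow> ('v, 'w) smap \<Rightarrow> ('v, 'w) smap \<Rightarrow> ('x, 'w \<times> 'w) slice \<Rightarrow>
    ('x, 'y) smap \<Rightarrow>
    (('w \<times> 'w) \<times> ((nat \<Rightarrow> nat) \<times> 'w \<times> 'v, ('v \<times> 'v) \<times> 'x) smap,
     ('w \<times> 'w) \<times> ((nat \<Rightarrow> nat) \<times> 'w \<times> 'v, ('v \<times> 'v) \<times> 'y) smap) smap" where
  "bisim_right_map W V p q X h =
     dprod_map (sprod W V) (sprod W W) (smap_prod W V (sid W) p)
       (dsum (smap_prod V V p (sid V)) (bisim_pull V q X)) (bisim_pull_map V q X h)"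

definition bisim :: "'w sset \<Rightarrow> 'v sset \<Rightarrow> ('v, 'w) smap \<Rightarrow> ('v, 'w) smap \<Rightarrow> ('x, 'w \<times> 'w) slice \<Rightarrow>
    (('w, 'v, 'x) bisim, 'w \<times> 'w) slice" where
  "bisim W V p q X = slice_prod (bisim_left W V p q X) (bisim_right W V p q X)"

definition bisim_map :: "'w sset \<Rightarrow> 'v sset \<Rightarrow> ('v, 'w) smap \<Rightarrow> ('v, 'w) smap \<Rightarrow> ('x, 'w \<times> 'w) slice \<Rightarrow>
    ('x, 'y) smap \<Rightarrow> (('w, 'v, 'x) bisim, ('w, 'v, 'y) bisim) smap" where
  "bisim_map W V p q X h =
     slice_prod_map (bisim_left W V p q X) (bisim_right W V p q X)
       (bisim_left_map W V p q X h) (bisim_right_map W V p q X h)"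

definition is_bisimulation :: "'v sset \<Rightarrow> 'v sset \<Rightarrow> ('v, 'v) smap \<Rightarrow> 'v sset \<Rightarrow> (('v, 'v, 'v) poly, 'v) smap \<Rightarrow>
    ('v, 'v \<times> 'v) slice \<Rightarrow> (('v, 'v \<times> 'v, 'v) bisim, 'v) smap \<Rightarrow> bool" where
  "is_bisimulation E U \<pi> W \<alpha> B \<beta> \<longleftrightarrow>
     (let V = Wbar E U \<pi> W \<alpha>; p = ssnd V; q = subtree E U \<pi> W \<alpha>
      in initial_slice_algebra (sprod W W) (bisim W V p q) (bisim_map W V p q) B \<beta>)"


section \<open>Pseudo-equivalence relations and quotients\<close>

definition leg1 :: "('r, 'y \<times> 'y) slice \<Rightarrow> ('r, 'y) smap" where
  "leg1 R = (\<lambda>n. \<lambda>r\<in>spx (tot R) n. fst (str R n r))"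

definition leg2 :: "('r, 'y \<times> 'y) slice \<Rightarrow> ('r, 'y) smap" where
  "leg2 R = (\<lambda>n. \<lambda>r\<in>spx (tot R) n. snd (str R n r))"

definition pseudo_equivalence :: "'y sset \<Rightarrow> ('r, 'y \<times> 'y) slice \<Rightarrow> bool" where
  "pseudo_equivalence Y R \<longleftrightarrow> slice_over (sprod Y Y) R \<and>
     (let X = tot R; s = leg1 R; t = leg2 R; P = pullback X X t s in
      (\<exists>\<rho>\<in>smaps Y X. scomp Y (str R) \<rho> = (\<lambda>n. \<lambda>y\<in>spx Y n. (y, y))) \<and>
      (\<exists>\<sigma>\<in>smaps X X. scomp X s \<sigma> = t \<and> scomp X t \<sigma> = s) \<and>
      (\<exists>\<tau>\<in>smaps P X. scomp P s \<tau> = scomp P s (sfst P) \<and> scomp P t \<tau> = scomp P t (ssnd P)))"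

text \<open>The coequalizer of \<open>s, t : R \<rightarrow> Y\<close> is computed degreewise, as the quotient by the equivalence
  relation generated by \<open>s r \<sim> t r\<close>. Its universal property is \<open>coeq_universal\<close> below.\<close>

definition coeq_rel :: "'r sset \<Rightarrow> 'y sset \<Rightarrow> ('r, 'y) smap \<Rightarrow> ('r, 'y) smap \<Rightarrow> nat \<Rightarrow> 'y rel" where
  "coeq_rel R Y s t n =
     (let G = (\<lambda>r. (s n r, t n r)) ` spx R n in (G \<union> G\<inverse>)\<^sup>* \<inter> spx Y n \<times> spx Y n)"

definition coeq :: "'r sset \<Rightarrow> 'y sset \<Rightarrow> ('r, 'y) smap \<Rightarrow> ('r, 'y) smap \<Rightarrow> 'y set sset" where
  "coeq R Y s t = \<lparr>spx = (\<lambda>n. spx Y n // coeq_rel R Y s t n),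
                   act = (\<lambda>m n \<theta> c. coeq_rel R Y s t m `` (act Y m n \<theta> ` c))\<rparr>"

definition coeq_proj :: "'r sset \<Rightarrow> 'y sset \<Rightarrow> ('r, 'y) smap \<Rightarrow> ('r, 'y) smap \<Rightarrow> ('y, 'y set) smap" where
  "coeq_proj R Y s t = (\<lambda>n. \<lambda>y\<in>spx Y n. coeq_rel R Y s t n `` {y})"

definition quotient_sset :: "'y sset \<Rightarrow> ('r, 'y \<times> 'y) slice \<Rightarrow> 'y set sset" where
  "quotient_sset Y R = coeq (tot R) Y (leg1 R) (leg2 R)"


section \<open>Universal properties of the constructions\<close>

lemma deltas_funcD: "\<theta> \<in> deltas m n \<Longrightarrow> i \<le> m \<Longrightarrow> \<theta> i \<le> n"
  by (auto simp: deltas_def)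

lemma did_deltas [simp]: "did n \<in> deltas n n"
  by (auto simp: deltas_def did_def mono_on_def)

lemma compose_deltas:
  assumes "\<theta> \<in> deltas m n" "\<phi> \<in> deltas k m"
  shows "compose {..k} \<theta> \<phi> \<in> deltas k n"
  using assms by (auto simp: deltas_def compose_def mono_on_def Pi_iff PiE_def)

lemma compose_did_right [simp]: "\<theta> \<in> deltas m n \<Longrightarrow> compose {..m} \<theta> (did m) = \<theta>"
  by (auto simp: deltas_def did_def compose_def restrict_def fun_eq_iff PiE_def extensional_def)

lemma compose_did_left [simp]: "\<theta> \<in> deltas m n \<Longrightarrow> compose {..m} (did n) \<theta> = \<theta>"
  by (auto simp: deltas_def did_def compose_def restrict_def fun_eq_iff PiE_def Pi_def extensional_def)

lemma compose_assoc_deltas: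
  assumes "\<phi> \<in> deltas k m"
  shows "compose {..k} (compose {..m} \<theta> \<psi>) \<phi> = compose {..k} \<theta> (compose {..k} \<psi> \<phi>)"
  using assms by (auto simp: compose_def restrict_def fun_eq_iff dest: deltas_funcD)

lemma sset_act: "sset X \<Longrightarrow> \<theta> \<in> deltas m n \<Longrightarrow> x \<in> spx X n \<Longrightarrow> act X m n \<theta> x \<in> spx X m"
  by (auto simp: sset_def)

lemma sset_id: "sset X \<Longrightarrow> x \<in> spx X n \<Longrightarrow> act X n n (did n) x = x"
  by (auto simp: sset_def)

lemma sset_comp: "sset X \<Longrightarrow> \<phi> \<in> deltas k m \<Longrightarrow> \<theta> \<in> deltas m n \<Longrightarrow> x \<in> spx X n \<Longrightarrow>
    act X k n (compose {..k} \<theta> \<phi>) x = act X k m \<phi> (act X m n \<theta> x)"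
  by (auto simp: sset_def)

lemma smaps_in: "f \<in> smaps X Y \<Longrightarrow> x \<in> spx X n \<Longrightarrow> f n x \<in> spx Y n"
  by (auto simp: smaps_def)

lemma smaps_nat: "f \<in> smaps X Y \<Longrightarrow> \<theta> \<in> deltas m n \<Longrightarrow> x \<in> spx X n \<Longrightarrow>
    f m (act X m n \<theta> x) = act Y m n \<theta> (f n x)"
  by (auto simp: smaps_def)

lemma smaps_eqI:
  assumes "f \<in> smaps X Y" "g \<in> smaps X Z" "\<And>n x. x \<in> spx X n \<Longrightarrow> f n x = g n x"
  shows "f = g"
proof
  fix n show "f n = g n"
    by (rule extensionalityI[of _ "spx X n"]) (use assms in \<open>auto simp: smaps_def PiE_def\<close>)
qed

lemma smapsI:
  assumes "\<And>n x. x \<in> spx X n \<Longrightarrow> f n x \<in> spx Y n"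
    and "\<And>n x. x \<notin> spx X n \<Longrightarrow> f n x = undefined"
    and "\<And>m n \<theta> x. \<theta> \<in> deltas m n \<Longrightarrow> x \<in> spx X n \<Longrightarrow> f m (act X m n \<theta> x) = act Y m n \<theta> (f n x)"
  shows "f \<in> smaps X Y"
  using assms by (auto simp: smaps_def)

lemma sset_std_simplex: "sset (std_simplex n)"
  by (auto simp: sset_def std_simplex_def compose_deltas compose_assoc_deltas)

lemma sset_horn: "sset (horn n k)"
proof -
  have "\<exists>j\<in>{..n} - {k}. j \<notin> compose {..l} \<theta> \<phi> ` {..l}"
    if "\<phi> \<in> deltas l m" "j \<in> {..n} - {k}" "j \<notin> \<theta> ` {..m}" for l m \<phi> \<theta> j
  proof (rule bexI[of _ j])
    show "j \<notin> compose {..l} \<theta> \<phi> ` {..l}"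
      using that deltas_funcD[OF that(1)] by (auto simp: compose_def)
  qed (use that in auto)
  then show ?thesis
    unfolding sset_def horn_def
    by (auto simp: compose_deltas compose_assoc_deltas)
qed

lemma sset_sprod: "sset X \<Longrightarrow> sset Y \<Longrightarrow> sset (sprod X Y)"
  unfolding sset_def[of "sprod X Y"] by (auto simp: sprod_def sset_act sset_id sset_comp)

lemma sset_pullback:
  assumes "sset X" "sset Y" "f \<in> smaps X Z" "g \<in> smaps Y Z"
  shows "sset (pullback X Y f g)"
  unfolding sset_def[of "pullback X Y f g"]
  using assms by (auto simp: sprod_def pullback_def smaps_nat sset_act sset_id sset_comp)

lemma sfst_pullback: "sfst (pullback X Y f g) \<in> smaps (pullback X Y f g) X"
  if "sset X" "sset Y" "f \<in> smaps X Z" "g \<in> smaps Y Z"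
  using that by (intro smapsI) (auto simp: sfst_def pullback_def sprod_def sset_act smaps_nat)

lemma ssnd_pullback: "ssnd (pullback X Y f g) \<in> smaps (pullback X Y f g) Y"
  if "sset X" "sset Y" "f \<in> smaps X Z" "g \<in> smaps Y Z"
  using that by (intro smapsI) (auto simp: ssnd_def pullback_def sprod_def sset_act smaps_nat)

lemma yoneda_smaps: "sset X \<Longrightarrow> x \<in> spx X n \<Longrightarrow> yoneda X n x \<in> smaps (std_simplex n) X"
  by (intro smapsI) (auto simp: yoneda_def std_simplex_def compose_deltas sset_act sset_comp)

lemma spx_fib: "spx (fib A B f n b) m =
    {(\<theta>, a). \<theta> \<in> deltas m n \<and> a \<in> spx A m \<and> f m a = act B m n \<theta> b}"
  by (auto simp: fib_def pullback_def std_simplex_def yoneda_def)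

lemma act_fib: "act (fib A B f n b) k m \<phi> (\<theta>, a) = (compose {..k} \<theta> \<phi>, act A k m \<phi> a)"
  by (auto simp: fib_def pullback_def std_simplex_def sprod_def)

lemma sset_fib: "sset A \<Longrightarrow> sset B \<Longrightarrow> f \<in> smaps A B \<Longrightarrow> b \<in> spx B n \<Longrightarrow> sset (fib A B f n b)"
  unfolding fib_def by (rule sset_pullback[OF sset_std_simplex _ yoneda_smaps])

lemma slice_maps_fib:
  "s \<in> slice_maps (fib_slice A B f n b) Y \<longleftrightarrow> s \<in> smaps (fib A B f n b) (tot Y) \<and>
     (\<forall>m \<theta> a. (\<theta>, a) \<in> spx (fib A B f n b) m \<longrightarrow> str Y m (s m (\<theta>, a)) = a)"
  by (auto simp: slice_maps_def fib_slice_def scomp_def ssnd_def compose_def restrict_def fun_eq_iff)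

lemma slice_mapsD: "h \<in> slice_maps X Y \<Longrightarrow> x \<in> spx (tot X) n \<Longrightarrow> str Y n (h n x) = str X n x"
  by (auto simp: slice_maps_def scomp_def compose_def fun_eq_iff dest!: spec[of _ n] spec[of _ x])

lemma slice_mapsI:
  assumes "h \<in> smaps (tot X) (tot Y)" "str X \<in> smaps (tot X) C"
    and "\<And>n x. x \<in> spx (tot X) n \<Longrightarrow> str Y n (h n x) = str X n x"
  shows "h \<in> slice_maps X Y"
proof -
  have "scomp (tot X) (str Y) h n = str X n" for n
    by (rule extensionalityI[of _ "spx (tot X) n"])
      (use assms in \<open>auto simp: scomp_def compose_def smaps_def PiE_def\<close>)
  with assms(1) show ?thesis by (auto simp: slice_maps_def fun_eq_iff)
qed

lemma fib_shift:
  assumes "sset B" "\<phi> \<in> deltas m n" "b \<in> spx B n" "(\<theta>, a) \<in> spx (fib A B f m (act B m n \<phi> b)) k"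
  shows "(compose {..k} \<phi> \<theta>, a) \<in> spx (fib A B f n b) k"
  using assms by (auto simp: spx_fib compose_deltas sset_comp)

lemma spx_dprod: "spx (dprod_tot A B f Y) n =
    {(b, s). b \<in> spx B n \<and> s \<in> slice_maps (fib_slice A B f n b) Y}"
  by (simp add: dprod_tot_def)

lemma act_dprod: "act (dprod_tot A B f Y) m n \<phi> (b, s) = (act B m n \<phi> b,
    \<lambda>k. \<lambda>(\<theta>, a)\<in>spx (fib A B f m (act B m n \<phi> b)) k. s k (compose {..k} \<phi> \<theta>, a))"
  by (simp add: dprod_tot_def)

lemma dprod_act_in:
  assumes A: "sset A" and B: "sset B" and f: "f \<in> smaps A B"
    and \<phi>: "\<phi> \<in> deltas m n" and x: "x \<in> spx (dprod_tot A B f Y) n"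
  shows "act (dprod_tot A B f Y) m n \<phi> x \<in> spx (dprod_tot A B f Y) m"
proof -
  obtain b s where [simp]: "x = (b, s)" by (cases x)
  from x have b: "b \<in> spx B n" and s: "s \<in> smaps (fib A B f n b) (tot Y)"
    and sY: "\<And>m \<theta> a. (\<theta>, a) \<in> spx (fib A B f n b) m \<Longrightarrow> str Y m (s m (\<theta>, a)) = a"
    by (auto simp: spx_dprod slice_maps_fib)
  let ?b = "act B m n \<phi> b"
  have b': "?b \<in> spx B m" by (rule sset_act[OF B \<phi> b])
  have F: "sset (fib A B f m ?b)" by (rule sset_fib[OF A B f b'])
  note sh = fib_shift[OF B \<phi> b]
  have "(\<lambda>k. \<lambda>(\<theta>, a)\<in>spx (fib A B f m ?b) k. s k (compose {..k} \<phi> \<theta>, a)) \<in> smaps (fib A B f m ?b) (tot Y)"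
  proof (rule smapsI, goal_cases)
    case (1 k z)
    then show ?case using smaps_in[OF s sh] by (cases z) auto
  next
    case (2 k z)
    then show ?case by auto
  next
    case (3 l k \<psi> z)
    obtain \<theta> a where [simp]: "z = (\<theta>, a)" by (cases z)
    have "act (fib A B f m ?b) l k \<psi> (\<theta>, a) \<in> spx (fib A B f m ?b) l"
      using sset_act[OF F] 3 by auto
    moreover have "s l (compose {..l} \<phi> (compose {..l} \<theta> \<psi>), act A l k \<psi> a)
        = act (tot Y) l k \<psi> (s k (compose {..k} \<phi> \<theta>, a))"
      using smaps_nat[OF s 3(1) sh, of \<theta> a] 3
      by (simp add: act_fib compose_assoc_deltas)
    ultimately show ?case using 3 by (simp add: act_fib)
  qed
  then show ?thesis
    using b' sY[OF sh] by (auto simp: act_dprod spx_dprod slice_maps_fib)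
qed

lemma sset_dprod_tot:
  assumes A: "sset A" and B: "sset B" and f: "f \<in> smaps A B"
  shows "sset (dprod_tot A B f Y)"
  unfolding sset_def
proof (intro conjI allI ballI)
  fix m n \<theta> assume "\<theta> \<in> deltas m n"
  then show "act (dprod_tot A B f Y) m n \<theta> \<in> spx (dprod_tot A B f Y) n \<rightarrow> spx (dprod_tot A B f Y) m"
    using dprod_act_in[OF A B f] by blast
next
  fix n x assume x: "x \<in> spx (dprod_tot A B f Y) n"
  obtain b s where [simp]: "x = (b, s)" by (cases x)
  from x have b: "b \<in> spx B n" and s: "s \<in> smaps (fib A B f n b) (tot Y)"
    by (auto simp: spx_dprod slice_maps_fib)
  have "(\<lambda>(\<theta>, a)\<in>spx (fib A B f n b) k. s k (compose {..k} (did n) \<theta>, a)) = s k" for k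
    using s by (intro extensionalityI[of _ "spx (fib A B f n b) k"])
      (auto simp: smaps_def PiE_def spx_fib)
  then show "act (dprod_tot A B f Y) n n (did n) x = x"
    by (simp add: act_dprod sset_id[OF B b])
next
  fix k m n \<phi> \<theta> x
  assume d: "\<phi> \<in> deltas k m" "\<theta> \<in> deltas m n" and x: "x \<in> spx (dprod_tot A B f Y) n"
  obtain b s where [simp]: "x = (b, s)" by (cases x)
  from x have b: "b \<in> spx B n" by (auto simp: spx_dprod)
  have "compose {..l} (compose {..k} \<theta> \<phi>) \<psi> = compose {..l} \<theta> (compose {..l} \<phi> \<psi>)"
    if "(\<psi>, a) \<in> spx (fib A B f k (act B k m \<phi> (act B m n \<theta> b))) l" for l \<psi> a
    using that by (intro compose_assoc_deltas) (auto simp: spx_fib)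
  then show "act (dprod_tot A B f Y) k n (compose {..k} \<theta> \<phi>) x =
      act (dprod_tot A B f Y) k m \<phi> (act (dprod_tot A B f Y) m n \<theta> x)"
    using fib_shift[OF B d(1) sset_act[OF B d(2) b], where A = A and f = f]
    by (auto simp: act_dprod sset_comp[OF B d b] intro!: restrict_ext)
qed

lemma slice_over_dprod:
  assumes "sset A" "sset B" "f \<in> smaps A B"
  shows "slice_over B (dprod A B f Y)"
  using sset_dprod_tot[OF assms, of Y] dprod_act_in[OF assms, of _ _ _ _ Y]
  by (auto simp: slice_over_def dprod_def sfst_def spx_dprod act_dprod intro!: smapsI)

lemma slice_over_pull:
  assumes "sset A" "sset C" "f \<in> smaps A C" "slice_over C X"
  shows "slice_over A (pull A f X)"
  using assms by (auto simp: slice_over_def pull_def Let_def intro: sset_pullback sfst_pullback)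

lemma spx_pull: "spx (tot (pull A f X)) n = {(a, x) \<in> spx A n \<times> spx (tot X) n. f n a = str X n x}"
  by (simp add: pull_def Let_def pullback_def)

lemma act_pull: "act (tot (pull A f X)) m n \<theta> (a, x) = (act A m n \<theta> a, act (tot X) m n \<theta> x)"
  by (simp add: pull_def Let_def pullback_def sprod_def)

lemma str_pull: "z \<in> spx (tot (pull A f X)) n \<Longrightarrow> str (pull A f X) n z = fst z"
  by (simp add: pull_def Let_def sfst_def)

lemma spx_pull_dprod: "spx (tot (pull A f (dprod A B f Y))) n =
    {(a, b, s). a \<in> spx A n \<and> b \<in> spx B n \<and> s \<in> slice_maps (fib_slice A B f n b) Y \<and> f n a = b}"
  by (auto simp: spx_pull dprod_def sfst_def spx_dprod)

text \<open>The counit \<open>f\<^sup>* \<Pi>\<^sub>f Y \<rightarrow> Y\<close> of the adjunction, and its universal property.\<close>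

lemma dprod_counit:
  assumes A: "sset A" and B: "sset B" and f: "f \<in> smaps A B"
  shows "dprod_eval A B f Y \<in> slice_maps (pull A f (dprod A B f Y)) Y"
proof -
  let ?P = "pull A f (dprod A B f Y)"
  have P: "slice_over A ?P" by (rule slice_over_pull[OF A B f slice_over_dprod[OF A B f]])
  have fibd: "(did n, a) \<in> spx (fib A B f n b) n" if "a \<in> spx A n" "b \<in> spx B n" "f n a = b" for n a b
    using that by (simp add: spx_fib sset_id[OF B])
  show ?thesis
  proof (rule slice_mapsI)
    show "str ?P \<in> smaps (tot ?P) A" using P by (simp add: slice_over_def)
  next
    fix n x assume x: "x \<in> spx (tot ?P) n"
    then obtain a b s where [simp]: "x = (a, b, s)" by (cases x)
    show "str Y n (dprod_eval A B f Y n x) = str ?P n x"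
      using x str_pull[OF x] fibd by (auto simp: dprod_eval_def spx_pull_dprod slice_maps_fib)
  next
    show "dprod_eval A B f Y \<in> smaps (tot ?P) (tot Y)"
    proof (rule smapsI, goal_cases)
      case (1 n x)
      obtain a b s where [simp]: "x = (a, b, s)" by (cases x)
      from 1 have "s \<in> smaps (fib A B f n b) (tot Y)" "(did n, a) \<in> spx (fib A B f n b) n"
        using fibd by (auto simp: spx_pull_dprod slice_maps_fib)
      then show ?case using 1 smaps_in[of s] by (simp add: dprod_eval_def)
    next
      case (2 n x)
      then show ?case by (auto simp: dprod_eval_def)
    next
      case (3 m n \<theta> x)
      obtain a b s where [simp]: "x = (a, b, s)" by (cases x)
      from 3 have a: "a \<in> spx A n" and b: "b \<in> spx B n" and ab: "f n a = b"
        and s: "s \<in> smaps (fib A B f n b) (tot Y)"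
        by (auto simp: spx_pull_dprod slice_maps_fib)
      have "act (tot ?P) m n \<theta> x \<in> spx (tot ?P) m"
        using sset_act[of "tot ?P"] P 3 by (auto simp: slice_over_def)
      moreover have "f m (act A m n \<theta> a) = act B m n \<theta> b"
        using smaps_nat[OF f 3(1) a] ab by simp
      then have "(did m, act A m n \<theta> a) \<in> spx (fib A B f m (act B m n \<theta> b)) m"
        using fibd sset_act[OF A 3(1) a] sset_act[OF B 3(1) b] by blast
      moreover have "s m (\<theta>, act A m n \<theta> a) = act (tot Y) m n \<theta> (s n (did n, a))"
        using smaps_nat[OF s 3(1) fibd[OF a b ab]] 3(1) by (simp add: act_fib)
      ultimately show ?case
        using 3 by (simp add: dprod_eval_def act_pull dprod_def act_dprod)
    qed
  qed
qed

lemma dprod_universal: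
  assumes A: "sset A" and B: "sset B" and f: "f \<in> smaps A B" and Z: "slice_over B Z"
    and g: "g \<in> slice_maps (pull A f Z) Y"
  shows "\<exists>!h. h \<in> slice_maps Z (dprod A B f Y) \<and>
           scomp (tot (pull A f Z)) (dprod_eval A B f Y) (pull_map A f Z h) = g"
proof -
  let ?P = "pull A f Z" and ?D = "dprod_tot A B f Y"
  have Zs: "sset (tot Z)" and Zm: "str Z \<in> smaps (tot Z) B" using Z by (auto simp: slice_over_def)
  have gm: "g \<in> smaps (tot ?P) (tot Y)" using g by (simp add: slice_maps_def)
  have eval: "scomp (tot ?P) (dprod_eval A B f Y) (pull_map A f Z h) n (a, z)
      = snd (h n z) n (did n, a)"
    if h: "h \<in> slice_maps Z (dprod A B f Y)" and az: "(a, z) \<in> spx (tot ?P) n" for h n a z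
  proof -
    have z: "a \<in> spx A n" "z \<in> spx (tot Z) n" "f n a = str Z n z" using az by (auto simp: spx_pull)
    have hz: "h n z \<in> spx ?D n"
      using h z smaps_in[of h "tot Z" ?D] by (auto simp: slice_maps_def dprod_def)
    have "fst (h n z) = str Z n z"
      using slice_mapsD[OF h z(2)] hz by (simp add: dprod_def sfst_def)
    then show ?thesis
      using az z hz by (auto simp: scomp_def compose_def pull_map_def dprod_eval_def spx_pull_dprod
          spx_dprod split: prod.splits)
  qed
  have zin: "(a, act (tot Z) m n \<theta> z) \<in> spx (tot ?P) m"
    if "z \<in> spx (tot Z) n" "(\<theta>, a) \<in> spx (fib A B f n (str Z n z)) m" for m n z \<theta> a
    using that by (auto simp: spx_pull spx_fib sset_act[OF Zs] smaps_nat[OF Zm])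
  define h where "h = (\<lambda>n. \<lambda>z\<in>spx (tot Z) n. (str Z n z,
      \<lambda>m. \<lambda>(\<theta>, a)\<in>spx (fib A B f n (str Z n z)) m. g m (a, act (tot Z) m n \<theta> z)))"
  have hin: "h n z \<in> spx ?D n" if z: "z \<in> spx (tot Z) n" for n z
  proof -
    let ?b = "str Z n z"
    have b: "?b \<in> spx B n" by (rule smaps_in[OF Zm z])
    have F: "sset (fib A B f n ?b)" by (rule sset_fib[OF A B f b])
    have "(\<lambda>m. \<lambda>(\<theta>, a)\<in>spx (fib A B f n ?b) m. g m (a, act (tot Z) m n \<theta> z)) \<in> smaps (fib A B f n ?b) (tot Y)"
    proof (rule smapsI, goal_cases)
      case (1 k w)
      then show ?case using smaps_in[OF gm zin[OF z]] by (cases w) auto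
    next
      case (2 k w)
      then show ?case by auto
    next
      case (3 l k \<psi> w)
      obtain \<theta> a where [simp]: "w = (\<theta>, a)" by (cases w)
      have "act (fib A B f n ?b) l k \<psi> (\<theta>, a) \<in> spx (fib A B f n ?b) l"
        using sset_act[OF F] 3 by auto
      moreover have "\<theta> \<in> deltas k n" using 3 by (simp add: spx_fib)
      then have "act (tot Z) l n (compose {..l} \<theta> \<psi>) z = act (tot Z) l k \<psi> (act (tot Z) k n \<theta> z)"
        by (rule sset_comp[OF Zs 3(1) _ z])
      then have "g l (act A l k \<psi> a, act (tot Z) l n (compose {..l} \<theta> \<psi>) z)
          = act (tot Y) l k \<psi> (g k (a, act (tot Z) k n \<theta> z))"
        using smaps_nat[OF gm 3(1) zin[OF z], of \<theta> a] 3 by (simp add: act_pull)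
      ultimately show ?case using 3 by (simp add: act_fib)
    qed
    moreover have "str Y m (g m (a, act (tot Z) m n \<theta> z)) = a"
      if "(\<theta>, a) \<in> spx (fib A B f n ?b) m" for m \<theta> a
      using slice_mapsD[OF g zin[OF z that]] str_pull[OF zin[OF z that]] by simp
    ultimately show ?thesis using z b by (simp add: h_def spx_dprod slice_maps_fib)
  qed
  have hslice: "h \<in> slice_maps Z (dprod A B f Y)"
  proof (rule slice_mapsI[OF _ Zm])
    fix n z assume z: "z \<in> spx (tot Z) n"
    show "str (dprod A B f Y) n (h n z) = str Z n z"
      using hin[OF z] z by (simp add: dprod_def sfst_def) (simp add: h_def)
  next
    show "h \<in> smaps (tot Z) (tot (dprod A B f Y))"
    proof (rule smapsI, goal_cases)
      case (1 n z)
      then show ?case using hin by (simp add: dprod_def)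
    next
      case (2 n z)
      then show ?case by (simp add: h_def)
    next
      case (3 m n \<theta> z)
      let ?b = "str Z n z"
      have b: "?b \<in> spx B n" by (rule smaps_in[OF Zm 3(2)])
      have sb: "str Z m (act (tot Z) m n \<theta> z) = act B m n \<theta> ?b" by (rule smaps_nat[OF Zm 3])
      have "act (tot Z) k m \<psi> (act (tot Z) m n \<theta> z) = act (tot Z) k n (compose {..k} \<theta> \<psi>) z"
        if "(\<psi>, a) \<in> spx (fib A B f m (act B m n \<theta> ?b)) k" for k \<psi> a
        using that 3 by (auto simp: spx_fib sset_comp[OF Zs])
      then have "h m (act (tot Z) m n \<theta> z) = act ?D m n \<theta> (h n z)"
        using 3 fib_shift[OF B 3(1) b, where A = A and f = f] sset_act[OF Zs 3]
        by (auto simp: h_def act_dprod sb intro!: restrict_ext)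
      then show ?case by (simp add: dprod_def)
    qed
  qed
  have scg: "scomp (tot ?P) (dprod_eval A B f Y) (pull_map A f Z h) = g"
  proof
    fix n
    show "scomp (tot ?P) (dprod_eval A B f Y) (pull_map A f Z h) n = g n"
    proof (rule extensionalityI[of _ "spx (tot ?P) n"])
      show "g n \<in> extensional (spx (tot ?P) n)" using gm by (auto simp: smaps_def PiE_def)
      fix x assume x: "x \<in> spx (tot ?P) n"
      obtain a z where [simp]: "x = (a, z)" by (cases x)
      have z: "a \<in> spx A n" "z \<in> spx (tot Z) n" "f n a = str Z n z" using x by (auto simp: spx_pull)
      have "(did n, a) \<in> spx (fib A B f n (str Z n z)) n"
        using z smaps_in[OF Zm z(2)] by (simp add: spx_fib sset_id[OF B])
      then show "scomp (tot ?P) (dprod_eval A B f Y) (pull_map A f Z h) n x = g n x"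
        using eval[OF hslice, of a z n] x z by (simp add: h_def sset_id[OF Zs])
    qed (simp add: scomp_def)
  qed
  show ?thesis
  proof (rule ex1I[of _ h])
    fix h' assume h': "h' \<in> slice_maps Z (dprod A B f Y) \<and>
        scomp (tot ?P) (dprod_eval A B f Y) (pull_map A f Z h') = g"
    then have h'm: "h' \<in> smaps (tot Z) ?D" by (simp add: slice_maps_def dprod_def)
    have hm: "h \<in> smaps (tot Z) ?D" using hslice by (simp add: slice_maps_def dprod_def)
    show "h' = h"
    proof (rule smaps_eqI[OF h'm hm])
      fix n z assume z: "z \<in> spx (tot Z) n"
      let ?b = "str Z n z"
      have b: "?b \<in> spx B n" by (rule smaps_in[OF Zm z])
      obtain c s where hs: "h' n z = (c, s)" by (cases "h' n z")
      have "(c, s) \<in> spx ?D n" using smaps_in[OF h'm z] hs by simp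
      moreover have "c = ?b"
        using slice_mapsD[of h' Z "dprod A B f Y", OF _ z] h' hs calculation by (simp add: dprod_def sfst_def)
      ultimately have hs: "h' n z = (?b, s)" and s: "s \<in> smaps (fib A B f n ?b) (tot Y)"
        using hs by (auto simp: spx_dprod slice_maps_fib)
      have "s m (\<theta>, a) = g m (a, act (tot Z) m n \<theta> z)"
        if F: "(\<theta>, a) \<in> spx (fib A B f n ?b) m" for m \<theta> a
      proof -
        have \<theta>: "\<theta> \<in> deltas m n" and a: "a \<in> spx A m" and fa: "f m a = act B m n \<theta> ?b"
          using F by (auto simp: spx_fib)
        have "(did m, a) \<in> spx (fib A B f m (act B m n \<theta> ?b)) m"
          using a fa sset_act[OF B \<theta> b] by (simp add: spx_fib sset_id[OF B])
        moreover have "h' m (act (tot Z) m n \<theta> z) = act ?D m n \<theta> (?b, s)"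
          using smaps_nat[OF h'm \<theta> z] hs by simp
        ultimately have "snd (h' m (act (tot Z) m n \<theta> z)) m (did m, a) = s m (\<theta>, a)"
          using \<theta> by (simp add: act_dprod)
        then show ?thesis using eval[of h' a _ m, OF _ zin[OF z F]] h' by simp
      qed
      then have "s m = (\<lambda>(\<theta>, a)\<in>spx (fib A B f n ?b) m. g m (a, act (tot Z) m n \<theta> z))" for m
        using s by (intro extensionalityI[of _ "spx (fib A B f n ?b) m"]) (auto simp: smaps_def PiE_def)
      then show "h' n z = h n z" using z by (auto simp: hs h_def)
    qed
  qed (use hslice scg in blast)
qed

lemma equiv_coeq_rel: "equiv (spx Y n) (coeq_rel R Y s t n)"
proof -
  define G where "G = (\<lambda>r. (s n r, t n r)) ` spx R n"
  have "sym ((G \<union> G\<inverse>)\<^sup>*)" by (intro sym_rtrancl) (auto simp: sym_def)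
  then show ?thesis
    unfolding coeq_rel_def Let_def G_def[symmetric]
    by (intro equivI refl_onI symI transI)
      (auto simp: sym_def intro: rtrancl_trans)
qed

lemma coeq_rel_kernel:
  assumes "\<And>r. r \<in> spx R n \<Longrightarrow> k (s n r) = k (t n r)" "(x, y) \<in> coeq_rel R Y s t n"
  shows "k x = k y"
proof -
  have "(x, y) \<in> ((\<lambda>r. (s n r, t n r)) ` spx R n \<union> ((\<lambda>r. (s n r, t n r)) ` spx R n)\<inverse>)\<^sup>*"
    using assms(2) by (simp add: coeq_rel_def Let_def)
  then show ?thesis by induction (use assms(1) in auto)
qed

context
  fixes R :: "'r sset" and Y :: "'y sset" and s t :: "('r, 'y) smap"
  assumes R: "sset R" and Y: "sset Y" and s: "s \<in> smaps R Y" and t: "t \<in> smaps R Y"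
begin

private abbreviation "q \<equiv> coeq_proj R Y s t"
private abbreviation "rel \<equiv> coeq_rel R Y s t"

lemma coeq_rel_act:
  assumes \<theta>: "\<theta> \<in> deltas m n" and xy: "(x, y) \<in> rel n"
  shows "(act Y m n \<theta> x, act Y m n \<theta> y) \<in> rel m"
proof -
  have in_Y: "x \<in> spx Y n" "y \<in> spx Y n" using xy by (auto simp: coeq_rel_def Let_def)
  have "(s m (act R m n \<theta> r), t m (act R m n \<theta> r)) \<in> rel m" if "r \<in> spx R n" for r
    using sset_act[OF R \<theta> that] smaps_in[OF s] smaps_in[OF t] by (auto simp: coeq_rel_def Let_def)
  then have "rel m `` {act Y m n \<theta> (s n r)} = rel m `` {act Y m n \<theta> (t n r)}" if "r \<in> spx R n" for r
    using that smaps_nat[OF s \<theta>] smaps_nat[OF t \<theta>] equiv_class_eq[OF equiv_coeq_rel] by metis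
  from coeq_rel_kernel[of R n "\<lambda>z. rel m `` {act Y m n \<theta> z}", OF this xy]
  show ?thesis
    using eq_equiv_class[OF _ equiv_coeq_rel] sset_act[OF Y \<theta>] in_Y by metis
qed

lemma coeq_proj_in: "y \<in> spx Y n \<Longrightarrow> q n y \<in> spx (coeq R Y s t) n"
  by (simp add: coeq_def coeq_proj_def quotientI)

lemma coeq_cases:
  assumes "c \<in> spx (coeq R Y s t) n"
  obtains y where "y \<in> spx Y n" "c = q n y"
  using assms by (auto simp: coeq_def coeq_proj_def elim!: quotientE)

lemma coeq_act:
  assumes \<theta>: "\<theta> \<in> deltas m n" and y: "y \<in> spx Y n"
  shows "act (coeq R Y s t) m n \<theta> (q n y) = q m (act Y m n \<theta> y)"
proof -
  have "rel m `` (act Y m n \<theta> ` (rel n `` {y})) = rel m `` {act Y m n \<theta> y}"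
  proof (intro set_eqI iffI)
    fix z assume "z \<in> rel m `` (act Y m n \<theta> ` (rel n `` {y}))"
    then obtain x where yx: "(y, x) \<in> rel n" and xz: "(act Y m n \<theta> x, z) \<in> rel m" by auto
    have "trans (rel m)" using equiv_coeq_rel[of Y m R s t] by (simp add: equiv_def)
    then show "z \<in> rel m `` {act Y m n \<theta> y}"
      using transD[OF _ coeq_rel_act[OF \<theta> yx] xz] by simp
  next
    fix z assume "z \<in> rel m `` {act Y m n \<theta> y}"
    then show "z \<in> rel m `` (act Y m n \<theta> ` (rel n `` {y}))"
      using equiv_class_self[OF equiv_coeq_rel y] by blast
  qed
  then show ?thesis using y sset_act[OF Y \<theta> y] by (simp add: coeq_def coeq_proj_def)
qed

lemma sset_coeq: "sset (coeq R Y s t)"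
  unfolding sset_def
proof (intro conjI allI ballI)
  fix m n \<theta> assume \<theta>: "\<theta> \<in> deltas m n"
  show "act (coeq R Y s t) m n \<theta> \<in> spx (coeq R Y s t) n \<rightarrow> spx (coeq R Y s t) m"
  proof
    fix c assume "c \<in> spx (coeq R Y s t) n"
    then obtain y where "y \<in> spx Y n" "c = q n y" by (rule coeq_cases)
    then show "act (coeq R Y s t) m n \<theta> c \<in> spx (coeq R Y s t) m"
      using coeq_act[OF \<theta>] coeq_proj_in sset_act[OF Y \<theta>] by simp
  qed
next
  fix n c assume "c \<in> spx (coeq R Y s t) n"
  then obtain y where "y \<in> spx Y n" "c = q n y" by (rule coeq_cases)
  then show "act (coeq R Y s t) n n (did n) c = c" using coeq_act sset_id[OF Y] by simp
next
  fix k m n \<phi> \<theta> c assume d: "\<phi> \<in> deltas k m" "\<theta> \<in> deltas m n" and "c \<in> spx (coeq R Y s t) n"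
  then obtain y where "y \<in> spx Y n" "c = q n y" by (elim coeq_cases)
  then show "act (coeq R Y s t) k n (compose {..k} \<theta> \<phi>) c
      = act (coeq R Y s t) k m \<phi> (act (coeq R Y s t) m n \<theta> c)"
    using coeq_act d compose_deltas[OF d(2,1)] sset_comp[OF Y d] sset_act[OF Y d(2)] by simp
qed

lemma coeq_proj_smaps: "q \<in> smaps Y (coeq R Y s t)"
  by (rule smapsI) (simp_all add: coeq_proj_in coeq_act, simp add: coeq_proj_def)

lemma coeq_proj_eq: "scomp R q s = scomp R q t"
proof -
  have "q n (s n r) = q n (t n r)" if "r \<in> spx R n" for n r
  proof -
    have st: "s n r \<in> spx Y n" "t n r \<in> spx Y n" using that smaps_in s t by metis+
    then have "(s n r, t n r) \<in> rel n" using that by (auto simp: coeq_rel_def Let_def)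
    then show ?thesis using st equiv_class_eq[OF equiv_coeq_rel] by (simp add: coeq_proj_def)
  qed
  then show ?thesis by (auto simp: scomp_def compose_def fun_eq_iff restrict_def)
qed

lemma coeq_universal:
  assumes k: "k \<in> smaps Y Z" and eq: "scomp R k s = scomp R k t"
  shows "\<exists>!l. l \<in> smaps (coeq R Y s t) Z \<and> scomp Y l q = k"
proof -
  have st: "k n (s n r) = k n (t n r)" if "r \<in> spx R n" for n r
    using fun_cong[OF fun_cong[OF eq, of n], of r] that by (simp add: scomp_def compose_def)
  define l where "l = (\<lambda>n. \<lambda>c\<in>spx (coeq R Y s t) n. k n (SOME y. y \<in> c))"
  have l: "l n (q n y) = k n y" if y: "y \<in> spx Y n" for n y
  proof -
    have "y \<in> q n y" using equiv_class_self[OF equiv_coeq_rel y] y by (simp add: coeq_proj_def)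
    then have "(SOME z. z \<in> q n y) \<in> q n y" by (rule someI)
    then have "(y, SOME z. z \<in> q n y) \<in> rel n" using y by (simp add: coeq_proj_def)
    from coeq_rel_kernel[of R n "k n", OF st this]
    show ?thesis using coeq_proj_in[OF y] by (simp add: l_def)
  qed
  have lm: "l \<in> smaps (coeq R Y s t) Z"
  proof (rule smapsI, goal_cases)
    case (1 n c)
    then obtain y where "y \<in> spx Y n" "c = q n y" by (elim coeq_cases)
    then show ?case using l smaps_in[OF k] by simp
  next
    case (2 n c)
    then show ?case by (simp add: l_def)
  next
    case (3 m n \<theta> c)
    then obtain y where "y \<in> spx Y n" "c = q n y" by (elim coeq_cases)
    then show ?case using 3 l coeq_act sset_act[OF Y] smaps_nat[OF k] by simp
  qed
  have "scomp Y l q n = k n" for n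
    by (rule extensionalityI[of _ "spx Y n"])
      (use k in \<open>auto simp: scomp_def compose_def l smaps_def PiE_def\<close>)
  then have lq: "scomp Y l q = k" by auto
  show ?thesis
  proof (rule ex1I[of _ l])
    fix l' assume l': "l' \<in> smaps (coeq R Y s t) Z \<and> scomp Y l' q = k"
    show "l' = l"
    proof (rule smaps_eqI[OF conjunct1[OF l'] lm])
      fix n c assume "c \<in> spx (coeq R Y s t) n"
      then obtain y where y: "y \<in> spx Y n" "c = q n y" by (elim coeq_cases)
      have "l' n (q n y) = k n y"
        using fun_cong[OF fun_cong[OF conjunct2[OF l'], of n], of y] y by (simp add: scomp_def compose_def)
      then show "l' n c = l n c" using y l by simp
    qed
  qed (use lm lq in blast)
qed

end

end

theory Submission
  imports Defs
begin

text \<open>Kan fibrations have the homotopy extension property: they lift against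
  \<open>S \<times> \<Delta>[1] \<union> X \<times> {\<epsilon>} \<rightarrow> X \<times> \<Delta>[1]\<close> for every subcomplex \<open>S\<close> of \<open>X\<close>. A horn inclusion is a deformation retract
  of a kind that is stable under pullback along Kan fibrations, so \<open>\<Pi>\<close> along a Kan fibration
  preserves Kan fibrations, and hence so do the polynomial functor and \<open>\<Phi>\<close>. An initial algebra is the union of
  the transfinite chain of its subobjects obtained by iterating the functor from the empty one, and a
  horn in the union of a chain factors through a member of the chain; so \<open>W\<close> is a Kan complex and
  \<open>B \<rightarrow> W \<times> W\<close> is a Kan fibration.

  Reflexivity, symmetry and transitivity of \<open>B\<close> are maps to \<open>B\<close> obtained by well-founded recursion. If
  \<open>R \<rightarrow> Y \<times> Y\<close> is a Kan fibration and a pseudo-equivalence relation on a Kan complex \<open>Y\<close>, then \<open>R\<close> is a Kan fibration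
  over its image, and a Kan fibration that is surjective on simplices lifts horns. Therefore
  \<open>Y \<rightarrow> Y/R\<close> is a surjective Kan fibration, and a horn in \<open>Y/R\<close> can be lifted to \<open>Y\<close> and filled there.\<close>

section \<open>Simplicial operators\<close>

text \<open>Kan fibrations are defined by horns alone, while \<Pi> along a map tests fibrations
  against the pullback of a horn inclusion, which is not a horn inclusion. Homotopy extension avoids
  a theory of anodyne extensions: its solutions are built simplex by simplex from horns, and a
  pulled back horn inclusion is handled by a homotopy instead of being decomposed. The same homotopy
  on the horn itself replaces the choice of a compatible family of lifts by the choice of one lift.
  Cardinalities serve one purpose: the functors change the type of simplices, whereas initiality
  speaks of algebras on one type, so Lambek's lemma requires an injection of the simplices of the
  functor's value back into that type. Subobjects are families of sets of simplices, and the
  functors send them to subobjects as literal equations. Hence the iteration takes place in a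
  complete lattice with fixed point induction, and a subcomplex closed under the structure map is
  everything; the well-founded recursions rest on this last principle.\<close>

lemma deltas_monoD: "\<theta> \<in> deltas m n \<Longrightarrow> i \<le> j \<Longrightarrow> j \<le> m \<Longrightarrow> \<theta> i \<le> \<theta> j"
  by (auto simp: deltas_def mono_on_def)

lemma restrict_deltas:
  assumes "\<And>i. i \<le> m \<Longrightarrow> f i \<le> n" "\<And>i j. i \<le> j \<Longrightarrow> j \<le> m \<Longrightarrow> f i \<le> f j"
  shows "restrict f {..m} \<in> deltas m n"
  using assms by (auto simp: deltas_def mono_on_def)

lemma deltas_eqI:
  assumes "\<theta> \<in> deltas m n" "\<theta>' \<in> deltas m n'" "\<And>i. i \<le> m \<Longrightarrow> \<theta> i = \<theta>' i"
  shows "\<theta> = \<theta>'"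
  by (rule extensionalityI[of _ "{..m}"]) (use assms in \<open>auto simp: deltas_def PiE_def\<close>)

lemma compose_atMost [simp]: "i \<le> m \<Longrightarrow> compose {..m} \<theta> \<phi> i = \<theta> (\<phi> i)"
  by (simp add: compose_def)

lemma did_apply [simp]: "i \<le> n \<Longrightarrow> did n i = i"
  by (simp add: did_def)

lemma finite_deltas: "finite (deltas m n)"
  by (rule finite_subset[of _ "{..m} \<rightarrow>\<^sub>E {..n}"]) (auto simp: deltas_def intro: finite_PiE)

text \<open>Any set-theoretic section of a monotone surjection is monotone: an inversion at
  \<open>l \<le> l'\<close> forces \<open>l' \<le> l\<close>. Sections through every prescribed
  point \<open>i\<close> together recover \<theta>; this takes the place of the Eilenberg-Zilber
  lemma below.\<close>

lemma surj_section:
  assumes \<theta>: "\<theta> \<in> deltas m n" and surj: "\<theta> ` {..m} = {..n}" and i: "i \<le> m"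
  shows "\<exists>\<sigma>\<in>deltas n m. compose {..n} \<theta> \<sigma> = did n \<and> \<sigma> (\<theta> i) = i"
proof -
  have "\<forall>l\<in>{..n}. \<exists>p\<le>m. \<theta> p = l" using surj by (force simp: set_eq_iff image_iff)
  then obtain s where s: "\<And>l. l \<le> n \<Longrightarrow> s l \<le> m \<and> \<theta> (s l) = l" by (metis atMost_iff)
  define \<sigma> where "\<sigma> = (\<lambda>l\<in>{..n}. if l = \<theta> i then i else s l)"
  have sec: "\<sigma> l \<le> m \<and> \<theta> (\<sigma> l) = l" if "l \<le> n" for l using s that i by (simp add: \<sigma>_def)
  have "\<sigma> l \<le> \<sigma> l'" if "l \<le> l'" "l' \<le> n" for l l'
  proof (rule ccontr)
    assume "\<not> \<sigma> l \<le> \<sigma> l'"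
    then have "\<theta> (\<sigma> l') \<le> \<theta> (\<sigma> l)" using deltas_monoD[OF \<theta>] sec that by (meson le_trans nat_le_linear)
    then have "l = l'" using sec[of l] sec[of l'] that by simp
    with \<open>\<not> \<sigma> l \<le> \<sigma> l'\<close> show False by simp
  qed
  moreover have "restrict \<sigma> {..n} = \<sigma>" by (simp add: \<sigma>_def)
  ultimately have \<sigma>: "\<sigma> \<in> deltas n m" using restrict_deltas[of n \<sigma> m] sec by auto
  moreover have "compose {..n} \<theta> \<sigma> = did n"
    by (rule deltas_eqI[OF compose_deltas[OF \<theta> \<sigma>] did_deltas]) (simp add: sec)
  moreover have "\<sigma> (\<theta> i) = i" using deltas_funcD[OF \<theta> i] by (simp add: \<sigma>_def)
  ultimately show ?thesis by blast
qed

text \<open>Counting gives both inequalities: a surjective endomap of [n] is injective, so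
  \<open>{..i}\<close> embeds in \<open>{..\<theta> i}\<close> and \<open>{i..n}\<close> in
  \<open>{\<theta> i..n}\<close>.\<close>

lemma surj_deltas_did:
  assumes \<theta>: "\<theta> \<in> deltas n n" and surj: "\<theta> ` {..n} = {..n}"
  shows "\<theta> = did n"
proof (rule deltas_eqI[OF \<theta> did_deltas])
  fix i assume i: "i \<le> n"
  have inj: "inj_on \<theta> {..n}" using surj by (simp add: eq_card_imp_inj_on)
  have "card {..i} \<le> card {..\<theta> i}"
    by (rule card_inj_on_le[of \<theta>]) (use i inj deltas_monoD[OF \<theta>] in \<open>auto intro: inj_on_subset\<close>)
  moreover have "card {i..n} \<le> card {\<theta> i..n}"
    by (rule card_inj_on_le[of \<theta>])
      (use i inj deltas_monoD[OF \<theta>] deltas_funcD[OF \<theta>] in \<open>auto intro: inj_on_subset\<close>)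
  ultimately show "\<theta> i = did n i" using i deltas_funcD[OF \<theta> i] by simp
qed

text \<open>\<open>\<delta>\<close> is the coface that omits \<open>j\<close>, and
  \<open>\<psi>\<close> shifts the values above \<open>j\<close> down by one. A non-surjective
  operator thus passes through a simplex of lower dimension.\<close>

lemma nonsurj_factor:
  assumes \<theta>: "\<theta> \<in> deltas m n" and j: "j \<le> n" "j \<notin> \<theta> ` {..m}"
  shows "\<exists>n' \<delta> \<psi>. n = Suc n' \<and> \<delta> \<in> deltas n' n \<and> \<psi> \<in> deltas m n' \<and> \<theta> = compose {..m} \<delta> \<psi>"
proof -
  have ne: "\<theta> i \<noteq> j" if "i \<le> m" for i using that j(2) by auto
  have "n \<noteq> 0" using ne[of 0] deltas_funcD[OF \<theta>, of 0] j(1) by auto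
  then obtain n' where n: "n = Suc n'" by (cases n) auto
  define \<delta> where "\<delta> = (\<lambda>i\<in>{..n'}. if i < j then i else Suc i)"
  define \<psi> where "\<psi> = (\<lambda>i\<in>{..m}. if \<theta> i < j then \<theta> i else \<theta> i - 1)"
  have \<delta>: "\<delta> \<in> deltas n' n" unfolding \<delta>_def by (rule restrict_deltas) (auto simp: n)
  have \<psi>: "\<psi> \<in> deltas m n'" unfolding \<psi>_def
  proof (rule restrict_deltas)
    fix i assume "i \<le> m"
    then show "(if \<theta> i < j then \<theta> i else \<theta> i - 1) \<le> n'"
      using deltas_funcD[OF \<theta>, of i] j(1) by (auto simp: n)
  next
    fix i i' assume "i \<le> i'" "i' \<le> m"
    then show "(if \<theta> i < j then \<theta> i else \<theta> i - 1) \<le> (if \<theta> i' < j then \<theta> i' else \<theta> i' - 1)"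
      using deltas_monoD[OF \<theta>, of i i'] ne[of i'] by auto
  qed
  have "\<theta> = compose {..m} \<delta> \<psi>"
  proof (rule deltas_eqI[OF \<theta> compose_deltas[OF \<delta> \<psi>]])
    fix i assume i: "i \<le> m"
    then have "\<psi> i \<le> n'" by (rule deltas_funcD[OF \<psi>])
    then show "\<theta> i = compose {..m} \<delta> \<psi> i" using i ne[OF i] by (auto simp: \<delta>_def \<psi>_def)
  qed
  with n \<delta> \<psi> show ?thesis by blast
qed

lemma spx_std_simplex [simp]: "spx (std_simplex n) m = deltas m n"
  by (simp add: std_simplex_def)

lemma act_std_simplex [simp]: "act (std_simplex n) k m \<phi> \<theta> = compose {..k} \<theta> \<phi>"
  by (simp add: std_simplex_def)

lemma spx_horn: "\<theta> \<in> spx (horn n k) m \<longleftrightarrow> \<theta> \<in> deltas m n \<and> (\<exists>j\<le>n. j \<noteq> k \<and> j \<notin> \<theta> ` {..m})"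
  by (auto simp: horn_def)

lemma act_horn [simp]: "act (horn n k) l m \<phi> \<theta> = compose {..l} \<theta> \<phi>"
  by (simp add: horn_def)

lemma horn_deltas: "\<theta> \<in> spx (horn n k) m \<Longrightarrow> \<theta> \<in> deltas m n"
  by (simp add: spx_horn)

lemma spx_sprod [simp]: "spx (sprod X Y) n = spx X n \<times> spx Y n"
  by (simp add: sprod_def)

lemma act_sprod [simp]: "act (sprod X Y) m n \<theta> (x, y) = (act X m n \<theta> x, act Y m n \<theta> y)"
  by (simp add: sprod_def)

text \<open>For \<open>v\<close> equal to 0 or 1, \<open>cst n v\<close> is the unique
  \<open>n\<close>-simplex of \<Delta>[1] in the end \<open>v\<close>; the ends of all cylinders
  below are written this way.\<close>

definition cst :: "nat \<Rightarrow> nat \<Rightarrow> nat \<Rightarrow> nat" where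
  "cst n v = (\<lambda>i\<in>{..n}. v)"

lemma cst_deltas: "v \<le> k \<Longrightarrow> cst n v \<in> deltas n k"
  unfolding cst_def by (rule restrict_deltas) auto

lemma cst_apply [simp]: "i \<le> n \<Longrightarrow> cst n v i = v"
  by (simp add: cst_def)

lemma compose_cst [simp]: "\<theta> \<in> deltas m n \<Longrightarrow> compose {..m} (cst n v) \<theta> = cst m v"
  by (auto simp: cst_def compose_def restrict_def fun_eq_iff dest: deltas_funcD)


section \<open>Lifting against horns, elementwise\<close>

lemma kan_fibrationD:
  assumes "kan_fibration X Y f"
  shows "sset X" "sset Y" "f \<in> smaps X Y"
  using assms by (auto simp: kan_fibration_def)

lemma smaps_horn_nat:
  assumes "h \<in> smaps (horn n k) X" "\<theta> \<in> deltas l m" "\<phi> \<in> spx (horn n k) m"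
  shows "h l (compose {..l} \<phi> \<theta>) = act X l m \<theta> (h m \<phi>)"
  using smaps_nat[OF assms] by simp

lemma smaps_std_simplex_eq:
  assumes "l \<in> smaps (std_simplex n) X" "\<theta> \<in> deltas m n"
  shows "l m \<theta> = act X m n \<theta> (l n (did n))"
  using smaps_nat[OF assms(1,2), of "did n"] assms(2) by simp

text \<open>Yoneda turns a lift defined on \<Delta>[n] into an \<open>n\<close>-simplex. This is the
  form in which lifting problems are solved from here on.\<close>

lemma kan_fibration_fill:
  assumes kan: "kan_fibration X Y f" and nk: "1 \<le> n" "k \<le> n" and h: "h \<in> smaps (horn n k) X"
    and y: "y \<in> spx Y n" and hy: "\<And>m \<theta>. \<theta> \<in> spx (horn n k) m \<Longrightarrow> f m (h m \<theta>) = act Y m n \<theta> y"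
  obtains x where "x \<in> spx X n" "f n x = y" "\<And>m \<theta>. \<theta> \<in> spx (horn n k) m \<Longrightarrow> act X m n \<theta> x = h m \<theta>"
proof -
  note Y = kan_fibrationD(2)[OF kan]
  have yy: "yoneda Y n y m \<theta> = act Y m n \<theta> y" if "\<theta> \<in> deltas m n" for m \<theta>
    using that by (simp add: yoneda_def)
  have "\<forall>m. \<forall>\<theta>\<in>spx (horn n k) m. f m (h m \<theta>) = yoneda Y n y m \<theta>"
    using hy yy horn_deltas by metis
  moreover have "\<forall>h\<in>smaps (horn n k) X. \<forall>y\<in>smaps (std_simplex n) Y.
      (\<forall>m. \<forall>\<theta>\<in>spx (horn n k) m. f m (h m \<theta>) = y m \<theta>) \<longrightarrow>
      (\<exists>l\<in>smaps (std_simplex n) X. (\<forall>m. \<forall>\<theta>\<in>spx (horn n k) m. l m \<theta> = h m \<theta>) \<and>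
        (\<forall>m. \<forall>\<theta>\<in>spx (std_simplex n) m. f m (l m \<theta>) = y m \<theta>))"
    using kan nk unfolding kan_fibration_def by blast
  ultimately have "\<exists>l\<in>smaps (std_simplex n) X. (\<forall>m. \<forall>\<theta>\<in>spx (horn n k) m. l m \<theta> = h m \<theta>) \<and>
      (\<forall>m. \<forall>\<theta>\<in>spx (std_simplex n) m. f m (l m \<theta>) = yoneda Y n y m \<theta>)"
    using h yoneda_smaps[OF Y y] by blast
  then obtain l where l: "l \<in> smaps (std_simplex n) X"
      and l1: "\<forall>m. \<forall>\<theta>\<in>spx (horn n k) m. l m \<theta> = h m \<theta>"
      and l2: "\<forall>m. \<forall>\<theta>\<in>spx (std_simplex n) m. f m (l m \<theta>) = yoneda Y n y m \<theta>"
    by (elim bexE conjE)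
  show thesis
  proof (rule that)
    show "l n (did n) \<in> spx X n" using smaps_in[OF l] by simp
    show "f n (l n (did n)) = y" using l2 yy[of "did n" n] sset_id[OF Y y] by simp
    show "act X m n \<theta> (l n (did n)) = h m \<theta>" if "\<theta> \<in> spx (horn n k) m" for m \<theta>
      using l1 that smaps_std_simplex_eq[OF l horn_deltas[OF that]] by simp
  qed
qed

lemma kan_fibrationI:
  assumes X: "sset X" and Y: "sset Y" and f: "f \<in> smaps X Y"
    and fill: "\<And>n k h y. \<lbrakk>1 \<le> n; k \<le> n; h \<in> smaps (horn n k) X; y \<in> spx Y n;
       \<And>m \<theta>. \<theta> \<in> spx (horn n k) m \<Longrightarrow> f m (h m \<theta>) = act Y m n \<theta> y\<rbrakk> \<Longrightarrow>
       \<exists>x\<in>spx X n. f n x = y \<and> (\<forall>m. \<forall>\<theta>\<in>spx (horn n k) m. act X m n \<theta> x = h m \<theta>)"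
  shows "kan_fibration X Y f"
  unfolding kan_fibration_def
proof (intro conjI allI impI ballI X Y f)
  fix n k h y assume nk: "1 \<le> n \<and> k \<le> n" and h: "h \<in> smaps (horn n k) X"
    and y: "y \<in> smaps (std_simplex n) Y"
    and hy: "\<forall>m. \<forall>\<theta>\<in>spx (horn n k) m. f m (h m \<theta>) = y m \<theta>"
  have yn: "y n (did n) \<in> spx Y n" using smaps_in[OF y] by simp
  have "f m (h m \<theta>) = act Y m n \<theta> (y n (did n))" if "\<theta> \<in> spx (horn n k) m" for m \<theta>
    using hy that smaps_std_simplex_eq[OF y horn_deltas[OF that]] by simp
  then obtain x where x: "x \<in> spx X n" "f n x = y n (did n)"
      "\<And>m \<theta>. \<theta> \<in> spx (horn n k) m \<Longrightarrow> act X m n \<theta> x = h m \<theta>"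
    using fill[OF _ _ h yn] nk by blast
  show "\<exists>l\<in>smaps (std_simplex n) X. (\<forall>m. \<forall>\<theta>\<in>spx (horn n k) m. l m \<theta> = h m \<theta>) \<and>
      (\<forall>m. \<forall>\<theta>\<in>spx (std_simplex n) m. f m (l m \<theta>) = y m \<theta>)"
  proof (intro bexI[of _ "yoneda X n x"] conjI allI ballI)
    show "yoneda X n x \<in> smaps (std_simplex n) X" by (rule yoneda_smaps[OF X x(1)])
    fix m \<theta> assume "\<theta> \<in> spx (horn n k) m"
    then show "yoneda X n x m \<theta> = h m \<theta>" using x(3) by (simp add: yoneda_def horn_deltas)
  next
    fix m \<theta> assume "\<theta> \<in> spx (std_simplex n) m"
    then show "f m (yoneda X n x m \<theta>) = y m \<theta>"
      using x smaps_nat[OF f _ x(1), of \<theta> m] smaps_std_simplex_eq[OF y, of \<theta> m] by (simp add: yoneda_def)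
  qed
qed


section \<open>Partial lifts\<close>

text \<open>A partial lift of \<open>c : X \<rightarrow> A\<close> along \<open>g : Y \<rightarrow> A\<close>, defined on a subcomplex of \<open>X\<close>, is represented
  by its graph, so that the union of a chain of partial lifts is a partial lift.\<close>

definition partial_lift :: "'x sset \<Rightarrow> 'y sset \<Rightarrow> ('y, 'a) smap \<Rightarrow> ('x, 'a) smap \<Rightarrow> (nat \<times> 'x \<times> 'y) set \<Rightarrow> bool" where
  "partial_lift X Y g c G \<longleftrightarrow>
     (\<forall>n x y. (n, x, y) \<in> G \<longrightarrow> x \<in> spx X n \<and> y \<in> spx Y n \<and> g n y = c n x) \<and>
     (\<forall>n x y y'. (n, x, y) \<in> G \<longrightarrow> (n, x, y') \<in> G \<longrightarrow> y = y') \<and>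
     (\<forall>m n \<theta> x y. \<theta> \<in> deltas m n \<longrightarrow> (n, x, y) \<in> G \<longrightarrow> (m, act X m n \<theta> x, act Y m n \<theta> y) \<in> G)"

definition lift_dom :: "(nat \<times> 'x \<times> 'y) set \<Rightarrow> nat \<Rightarrow> 'x set" where
  "lift_dom G n = {x. \<exists>y. (n, x, y) \<in> G}"

lemma partial_liftD:
  assumes "partial_lift X Y g c G"
  shows "(n, x, y) \<in> G \<Longrightarrow> x \<in> spx X n" "(n, x, y) \<in> G \<Longrightarrow> y \<in> spx Y n" "(n, x, y) \<in> G \<Longrightarrow> g n y = c n x"
    "(n, x, y) \<in> G \<Longrightarrow> (n, x, y') \<in> G \<Longrightarrow> y = y'"
    "(n, x, y) \<in> G \<Longrightarrow> \<theta> \<in> deltas m n \<Longrightarrow> (m, act X m n \<theta> x, act Y m n \<theta> y) \<in> G"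
  using assms unfolding partial_lift_def by blast+

lemma lift_dom_act:
  "partial_lift X Y g c G \<Longrightarrow> x \<in> lift_dom G n \<Longrightarrow> \<theta> \<in> deltas m n \<Longrightarrow> act X m n \<theta> x \<in> lift_dom G m"
  unfolding lift_dom_def partial_lift_def by blast

text \<open>\<open>dom\<close> and \<open>free\<close> say that the subcomplex generated by
  \<open>x\<close> arises from the domain of \<open>G\<close> by gluing \<Delta>[n] along the horn:
  the horn is exactly what is already covered, and no two operators are identified outside of it. A
  filler of the horn therefore extends the lift consistently.\<close>

lemma attach_horn:
  assumes kan: "kan_fibration Y A g" and X: "sset X" and c: "c \<in> smaps X A"
    and G: "partial_lift X Y g c G" and x: "x \<in> spx X n" and nk: "1 \<le> n" "k \<le> n"
    and dom: "\<And>m \<theta>. \<theta> \<in> deltas m n \<Longrightarrow> act X m n \<theta> x \<in> lift_dom G m \<longleftrightarrow> \<theta> \<in> spx (horn n k) m"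
    and free: "\<And>m \<theta> \<theta>'. \<lbrakk>\<theta> \<in> deltas m n; \<theta>' \<in> deltas m n; act X m n \<theta> x = act X m n \<theta>' x;
      act X m n \<theta> x \<notin> lift_dom G m\<rbrakk> \<Longrightarrow> \<theta> = \<theta>'"
  obtains G' where "partial_lift X Y g c G'" "G \<subseteq> G'"
    "\<And>m z. z \<in> lift_dom G' m \<longleftrightarrow> z \<in> lift_dom G m \<or> (\<exists>\<theta>\<in>deltas m n. z = act X m n \<theta> x)"
proof -
  note Y = kan_fibrationD(1)[OF kan]
  define h where "h = (\<lambda>m. \<lambda>\<theta>\<in>spx (horn n k) m. THE y. (m, act X m n \<theta> x, y) \<in> G)"
  have hG: "(m, act X m n \<theta> x, h m \<theta>) \<in> G" if \<theta>: "\<theta> \<in> spx (horn n k) m" for m \<theta>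
  proof -
    obtain y where y: "(m, act X m n \<theta> x, y) \<in> G"
      using dom[OF horn_deltas[OF \<theta>]] \<theta> by (auto simp: lift_dom_def)
    then have "(THE y. (m, act X m n \<theta> x, y) \<in> G) = y" using partial_liftD(4)[OF G _ y] by blast
    then show ?thesis using y \<theta> by (simp add: h_def)
  qed
  have h: "h \<in> smaps (horn n k) Y"
  proof (rule smapsI)
    fix m \<theta> assume "\<theta> \<in> spx (horn n k) m"
    then show "h m \<theta> \<in> spx Y m" using partial_liftD(2)[OF G hG] by simp
  next
    fix l m \<phi> \<theta> assume d: "\<phi> \<in> deltas l m" "\<theta> \<in> spx (horn n k) m"
    have "act (horn n k) l m \<phi> \<theta> \<in> spx (horn n k) l" by (rule sset_act[OF sset_horn d])
    then have "(l, act X l n (compose {..l} \<theta> \<phi>) x, h l (act (horn n k) l m \<phi> \<theta>)) \<in> G"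
      using hG by simp
    moreover have "(l, act X l n (compose {..l} \<theta> \<phi>) x, act Y l m \<phi> (h m \<theta>)) \<in> G"
      using partial_liftD(5)[OF G hG[OF d(2)] d(1)] sset_comp[OF X d(1) horn_deltas[OF d(2)] x] by simp
    ultimately show "h l (act (horn n k) l m \<phi> \<theta>) = act Y l m \<phi> (h m \<theta>)"
      by (rule partial_liftD(4)[OF G])
  qed (simp add: h_def)
  have "g m (h m \<theta>) = act A m n \<theta> (c n x)" if "\<theta> \<in> spx (horn n k) m" for m \<theta>
    using partial_liftD(3)[OF G hG[OF that]] smaps_nat[OF c horn_deltas[OF that] x] by simp
  then obtain y where y: "y \<in> spx Y n" "g n y = c n x"
      "\<And>m \<theta>. \<theta> \<in> spx (horn n k) m \<Longrightarrow> act Y m n \<theta> y = h m \<theta>"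
    using kan_fibration_fill[OF kan nk h smaps_in[OF c x]] by blast
  \<comment> \<open>The graph of the filler on the subcomplex generated by \<open>x\<close>. It
    agrees with \<open>G\<close> where both are defined because it fills the horn read off from
    \<open>G\<close>.\<close>
  define N where "N = {(m, act X m n \<theta> x, act Y m n \<theta> y) |m \<theta>. \<theta> \<in> deltas m n}"
  have NG: "y2 = y1" if 1: "(m, z, y1) \<in> G" and 2: "(m, z, y2) \<in> N" for m z y1 y2
  proof -
    obtain \<theta> where \<theta>: "\<theta> \<in> deltas m n" "z = act X m n \<theta> x" "y2 = act Y m n \<theta> y"
      using 2 by (auto simp: N_def)
    then have "\<theta> \<in> spx (horn n k) m" using dom 1 by (auto simp: lift_dom_def)
    then show ?thesis using y(3) \<theta> hG partial_liftD(4)[OF G 1] by metis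
  qed
  have NN: "y2 = y1" if 1: "(m, z, y1) \<in> N" and 2: "(m, z, y2) \<in> N" for m z y1 y2
  proof (cases "z \<in> lift_dom G m")
    case True
    then obtain v where "(m, z, v) \<in> G" by (auto simp: lift_dom_def)
    then show ?thesis using NG 1 2 by metis
  next
    \<comment> \<open>Outside the old domain \<open>free\<close> makes the operator that produces
      \<open>z\<close> unique, so the value is unambiguous.\<close>
    case False
    obtain \<theta> \<theta>' where "\<theta> \<in> deltas m n" "z = act X m n \<theta> x" "y1 = act Y m n \<theta> y"
        "\<theta>' \<in> deltas m n" "z = act X m n \<theta>' x" "y2 = act Y m n \<theta>' y"
      using 1 2 by (auto simp: N_def)
    with False show ?thesis using free by metis
  qed
  show thesis
  proof (rule that)
    show "partial_lift X Y g c (G \<union> N)"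
      unfolding partial_lift_def
    proof (intro conjI allI impI)
      fix m z v assume zv: "(m, z, v) \<in> G \<union> N"
      then have "z \<in> spx X m \<and> v \<in> spx Y m \<and> g m v = c m z"
        using partial_liftD(1-3)[OF G] x y sset_act[OF X] sset_act[OF Y] smaps_nat[OF c _ x]
          smaps_nat[OF kan_fibrationD(3)[OF kan] _ y(1)]
        by (fastforce simp: N_def)
      then show "z \<in> spx X m" "v \<in> spx Y m" "g m v = c m z" by auto
    next
      fix m z v v' assume "(m, z, v) \<in> G \<union> N" "(m, z, v') \<in> G \<union> N"
      then show "v = v'" using partial_liftD(4)[OF G] NG NN by (metis UnE)
    next
      fix l m \<theta> z v assume \<theta>: "\<theta> \<in> deltas l m" and zv: "(m, z, v) \<in> G \<union> N"
      show "(l, act X l m \<theta> z, act Y l m \<theta> v) \<in> G \<union> N"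
      proof (cases "(m, z, v) \<in> G")
        case True
        then show ?thesis using partial_liftD(5)[OF G _ \<theta>] by blast
      next
        case False
        then obtain \<psi> where \<psi>: "\<psi> \<in> deltas m n" "z = act X m n \<psi> x" "v = act Y m n \<psi> y"
          using zv by (auto simp: N_def)
        have "(l, act X l n (compose {..l} \<psi> \<theta>) x, act Y l n (compose {..l} \<psi> \<theta>) y) \<in> N"
          using compose_deltas[OF \<psi>(1) \<theta>] unfolding N_def by blast
        then show ?thesis
          using \<psi> sset_comp[OF X \<theta> \<psi>(1) x] sset_comp[OF Y \<theta> \<psi>(1) y(1)] by simp
      qed
    qed
  qed (auto simp: lift_dom_def N_def)
qed

section \<open>Prisms\<close>

text \<open>The \<open>j\<close>-th nondegenerate \<open>(n+1)\<close>-simplex of the prism \<open>[n] \<times> [1]\<close> is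
  \<open>(0,0) < \<dots> < (j,0) < (j,1) < \<dots> < (n,1)\<close>, with components \<open>prism_deg n j\<close> and \<open>prism_lev n j\<close>.\<close>

definition prism_deg :: "nat \<Rightarrow> nat \<Rightarrow> nat \<Rightarrow> nat" where
  "prism_deg n j = (\<lambda>i\<in>{..Suc n}. if i \<le> j then i else i - 1)"

definition prism_lev :: "nat \<Rightarrow> nat \<Rightarrow> nat \<Rightarrow> nat" where
  "prism_lev n j = (\<lambda>i\<in>{..Suc n}. if i \<le> j then 0 else 1)"

text \<open>The subcomplex of \<Delta>[n] \<times> \<Delta>[1] generated by the \<open>j\<close>-th
  prism simplex, encoded by inequalities on vertices so that no operator has to be exhibited;
  \<open>in_prism_iff\<close> supplies the operator.\<close>

definition in_prism :: "nat \<Rightarrow> nat \<Rightarrow> (nat \<Rightarrow> nat) \<Rightarrow> (nat \<Rightarrow> nat) \<Rightarrow> bool" where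
  "in_prism j m \<psi> \<tau> \<longleftrightarrow> (\<forall>p\<le>m. (\<tau> p = 0 \<longrightarrow> \<psi> p \<le> j) \<and> (\<tau> p \<noteq> 0 \<longrightarrow> j \<le> \<psi> p))"

lemma prism_deg_deltas: "j \<le> n \<Longrightarrow> prism_deg n j \<in> deltas (Suc n) n"
  unfolding prism_deg_def by (rule restrict_deltas) auto

lemma prism_lev_deltas: "prism_lev n j \<in> deltas (Suc n) 1"
  unfolding prism_lev_def by (rule restrict_deltas) auto

lemma prism_deg_apply [simp]: "i \<le> Suc n \<Longrightarrow> prism_deg n j i = (if i \<le> j then i else i - 1)"
  by (simp add: prism_deg_def)

lemma prism_lev_apply [simp]: "i \<le> Suc n \<Longrightarrow> prism_lev n j i = (if i \<le> j then 0 else 1)"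
  by (simp add: prism_lev_def)

lemma in_prism_iff:
  assumes j: "j \<le> n" and \<psi>: "\<psi> \<in> deltas m n" and \<tau>: "\<tau> \<in> deltas m 1"
  shows "in_prism j m \<psi> \<tau> \<longleftrightarrow> (\<exists>\<theta>\<in>deltas m (Suc n).
    compose {..m} (prism_deg n j) \<theta> = \<psi> \<and> compose {..m} (prism_lev n j) \<theta> = \<tau>)"
proof
  assume in_p: "in_prism j m \<psi> \<tau>"
  have \<tau>01: "\<tau> p = 0 \<or> \<tau> p = 1" if "p \<le> m" for p using deltas_funcD[OF \<tau> that] by auto
  \<comment> \<open>In the chain of the \<open>j\<close>-th prism simplex, (i,0) stands at position
    i and (i,1) at position i + 1, so the position of a vertex is degree plus level.\<close>
  define \<theta> where "\<theta> = (\<lambda>p\<in>{..m}. \<psi> p + \<tau> p)"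
  have \<theta>: "\<theta> \<in> deltas m (Suc n)" unfolding \<theta>_def
    by (rule restrict_deltas)
      (use deltas_funcD[OF \<psi>] deltas_funcD[OF \<tau>] deltas_monoD[OF \<psi>] deltas_monoD[OF \<tau>] in
        \<open>fastforce intro: add_mono\<close>)+
  have le: "\<psi> p + \<tau> p \<le> Suc n" if "p \<le> m" for p using deltas_funcD[OF \<theta> that] that by (simp add: \<theta>_def)
  have "compose {..m} (prism_deg n j) \<theta> = \<psi>" "compose {..m} (prism_lev n j) \<theta> = \<tau>"
    by (rule deltas_eqI[OF compose_deltas[OF prism_deg_deltas[OF j] \<theta>] \<psi>]
        deltas_eqI[OF compose_deltas[OF prism_lev_deltas \<theta>] \<tau>],
      use in_p \<tau>01 le in \<open>fastforce simp: \<theta>_def in_prism_def\<close>)+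
  with \<theta> show "\<exists>\<theta>\<in>deltas m (Suc n). compose {..m} (prism_deg n j) \<theta> = \<psi> \<and> compose {..m} (prism_lev n j) \<theta> = \<tau>"
    by blast
next
  assume "\<exists>\<theta>\<in>deltas m (Suc n). compose {..m} (prism_deg n j) \<theta> = \<psi> \<and> compose {..m} (prism_lev n j) \<theta> = \<tau>"
  then obtain \<theta> where \<theta>: "\<theta> \<in> deltas m (Suc n)" and eq: "\<psi> = compose {..m} (prism_deg n j) \<theta>"
      "\<tau> = compose {..m} (prism_lev n j) \<theta>" by auto
  show "in_prism j m \<psi> \<tau>" using deltas_funcD[OF \<theta>] by (auto simp: in_prism_def eq)
qed

text \<open>A chain in [n] \<times> [1] leaves the bottom at some degree: \<open>j\<close> is the
  degree of its last bottom vertex, or 0 if it has none.\<close>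

lemma in_prism_ex:
  assumes \<psi>: "\<psi> \<in> deltas m n" and \<tau>: "\<tau> \<in> deltas m 1"
  shows "\<exists>j\<le>n. in_prism j m \<psi> \<tau>"
proof -
  define P where "P = {p. p \<le> m \<and> \<tau> p = 0}"
  have fin: "finite P" by (auto simp: P_def)
  show ?thesis
  proof (cases "P = {}")
    case True
    then have "in_prism 0 m \<psi> \<tau>" by (auto simp: in_prism_def P_def)
    then show ?thesis by blast
  next
    case False
    have M: "Max P \<in> P" by (rule Max_in[OF fin False])
    have "in_prism (\<psi> (Max P)) m \<psi> \<tau>"
      unfolding in_prism_def
    proof (intro allI impI conjI)
      fix p assume p: "p \<le> m" "\<tau> p = 0"
      then show "\<psi> p \<le> \<psi> (Max P)" using M deltas_monoD[OF \<psi>] Max_ge[OF fin, of p] by (auto simp: P_def)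
    next
      fix p assume p: "p \<le> m" "\<tau> p \<noteq> 0"
      have "Max P \<le> p"
      proof (rule ccontr)
        assume "\<not> Max P \<le> p"
        moreover have "Max P \<le> m" "\<tau> (Max P) = 0" using M unfolding P_def by blast+
        ultimately have "\<tau> p = 0" using deltas_monoD[OF \<tau>, of p "Max P"] by simp
        then have "p \<in> P" using p by (auto simp: P_def)
        then show False using p by (auto simp: P_def)
      qed
      then show "\<psi> (Max P) \<le> \<psi> p" using deltas_monoD[OF \<psi>] p by auto
    qed
    then show ?thesis using deltas_funcD[OF \<psi>] M by (auto simp: P_def)
  qed
qed

text \<open>Position is degree plus level, so the two components determine the operator.\<close>

lemma prism_inj:
  assumes "\<theta> \<in> deltas m (Suc n)" "\<theta>' \<in> deltas m (Suc n)"
    and "compose {..m} (prism_deg n j) \<theta> = compose {..m} (prism_deg n j) \<theta>'"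
    and "compose {..m} (prism_lev n j) \<theta> = compose {..m} (prism_lev n j) \<theta>'"
  shows "\<theta> = \<theta>'"
proof (rule deltas_eqI[OF assms(1,2)])
  fix p assume p: "p \<le> m"
  have "v = prism_deg n j v + prism_lev n j v" if "v \<le> Suc n" for v using that by simp
  then show "\<theta> p = \<theta>' p"
    using fun_cong[OF assms(3), of p] fun_cong[OF assms(4), of p] p
      deltas_funcD[OF assms(1) p] deltas_funcD[OF assms(2) p] by (metis compose_atMost)
qed

text \<open>The faces of the \<open>j\<close>-th prism simplex, other than the two opposite to
  positions \<open>j\<close> and \<open>j + 1\<close>, lie over the boundary of \<Delta>[n]. Of
  these two walls, the one opposite to \<open>Suc j - \<epsilon>\<close> is shared with prism
  simplex j + 1 if \<epsilon> = 0 and j - 1 if \<epsilon> = 1, or lies in the end \<epsilon> if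
  there is no such simplex. Only the wall opposite to \<open>j + \<epsilon>\<close> is new, whence
  the horn.\<close>

lemma prism_horn:
  assumes j: "j \<le> n" and e: "\<epsilon> \<le> 1" and \<theta>: "\<theta> \<in> deltas m (Suc n)"
  defines "\<psi> \<equiv> compose {..m} (prism_deg n j) \<theta>" and "\<tau> \<equiv> compose {..m} (prism_lev n j) \<theta>"
  shows "\<theta> \<in> spx (horn (Suc n) (j + \<epsilon>)) m \<longleftrightarrow> \<psi> ` {..m} \<noteq> {..n} \<or> \<tau> = cst m \<epsilon> \<or>
    (\<exists>i\<le>n. (if \<epsilon> = 0 then j < i else i < j) \<and> in_prism i m \<psi> \<tau>)"
proof -
  have le: "\<theta> p \<le> Suc n" if "p \<le> m" for p by (rule deltas_funcD[OF \<theta> that])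
  have \<psi>: "\<psi> p = (if \<theta> p \<le> j then \<theta> p else \<theta> p - 1)" and \<tau>: "\<tau> p = (if \<theta> p \<le> j then 0 else 1)"
    if "p \<le> m" for p using le that by (simp_all add: \<psi>_def \<tau>_def)
  have \<tau>d: "\<tau> \<in> deltas m 1" unfolding \<tau>_def by (rule compose_deltas[OF prism_lev_deltas \<theta>])
  have \<psi>d: "\<psi> \<in> deltas m n" unfolding \<psi>_def by (rule compose_deltas[OF prism_deg_deltas[OF j] \<theta>])
  have cstI: "\<tau> = cst m \<epsilon>" if "\<And>p. p \<le> m \<Longrightarrow> \<tau> p = \<epsilon>"
    by (rule deltas_eqI[OF \<tau>d cst_deltas[OF e]]) (simp add: that)
  show ?thesis
  proof
    assume "\<theta> \<in> spx (horn (Suc n) (j + \<epsilon>)) m"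
    then obtain v where v: "v \<le> Suc n" "v \<noteq> j + \<epsilon>" "\<And>p. p \<le> m \<Longrightarrow> \<theta> p \<noteq> v"
      by (auto simp: spx_horn)
    consider "v < j" | "v > Suc j" | "v = j" "\<epsilon> = 1" "j = 0" | "v = j" "\<epsilon> = 1" "j > 0"
      | "v = Suc j" "\<epsilon> = 0" "j = n" | "v = Suc j" "\<epsilon> = 0" "j < n"
      using v e j by linarith
    then show "\<psi> ` {..m} \<noteq> {..n} \<or> \<tau> = cst m \<epsilon> \<or>
      (\<exists>i\<le>n. (if \<epsilon> = 0 then j < i else i < j) \<and> in_prism i m \<psi> \<tau>)"
    proof cases
      case 1
      then have "\<psi> p \<noteq> v" if "p \<le> m" for p using \<psi>[OF that] v(3)[OF that] by auto
      then have "v \<notin> \<psi> ` {..m}" by blast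
      moreover have "v \<in> {..n}" using 1 j by simp
      ultimately show ?thesis by blast
    next
      case 2
      then have "\<psi> p \<noteq> v - 1" if "p \<le> m" for p using \<psi>[OF that] v(3)[OF that] by auto
      then have "v - 1 \<notin> \<psi> ` {..m}" by (metis atMost_iff imageE)
      moreover have "v - 1 \<in> {..n}" using v by simp
      ultimately show ?thesis by blast
    next
      case 3
      then have "\<tau> p = \<epsilon>" if "p \<le> m" for p using \<tau>[OF that] v(3)[OF that] by auto
      then show ?thesis using cstI by blast
    next
      case 4
      have "in_prism (j - 1) m \<psi> \<tau>"
        unfolding in_prism_def
      proof (intro allI impI)
        fix p assume p: "p \<le> m"
        show "(\<tau> p = 0 \<longrightarrow> \<psi> p \<le> j - 1) \<and> (\<tau> p \<noteq> 0 \<longrightarrow> j - 1 \<le> \<psi> p)"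
          using v(3)[OF p] 4 by (auto simp: \<psi>[OF p] \<tau>[OF p])
      qed
      moreover have "j - 1 \<le> n" "j - 1 < j" using 4 j by auto
      ultimately show ?thesis using 4 by auto
    next
      case 5
      then have "\<tau> p = \<epsilon>" if "p \<le> m" for p using \<tau>[OF that] v(3)[OF that] le[OF that] by auto
      then show ?thesis using cstI by blast
    next
      case 6
      have "in_prism (Suc j) m \<psi> \<tau>"
        unfolding in_prism_def
      proof (intro allI impI)
        fix p assume p: "p \<le> m"
        show "(\<tau> p = 0 \<longrightarrow> \<psi> p \<le> Suc j) \<and> (\<tau> p \<noteq> 0 \<longrightarrow> Suc j \<le> \<psi> p)"
          using v(3)[OF p] 6 by (auto simp: \<psi>[OF p] \<tau>[OF p])
      qed
      then show ?thesis using 6 by (intro disjI2 exI[of _ "Suc j"]) auto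
    qed
  next
    assume *: "\<psi> ` {..m} \<noteq> {..n} \<or> \<tau> = cst m \<epsilon> \<or>
      (\<exists>i\<le>n. (if \<epsilon> = 0 then j < i else i < j) \<and> in_prism i m \<psi> \<tau>)"
    show "\<theta> \<in> spx (horn (Suc n) (j + \<epsilon>)) m"
    proof (rule ccontr)
      assume "\<theta> \<notin> spx (horn (Suc n) (j + \<epsilon>)) m"
      then have im: "\<exists>p\<le>m. \<theta> p = v" if "v \<le> Suc n" "v \<noteq> j + \<epsilon>" for v
        using that \<theta> by (force simp: spx_horn)
      \<comment> \<open>The vertex at position \<open>Suc j - \<epsilon>\<close> has degree
        \<open>j\<close> and lies on the end opposite to \<epsilon>. It excludes both the end
        \<epsilon> and the earlier prism simplices.\<close>
      have "Suc j - \<epsilon> \<le> Suc n" "Suc j - \<epsilon> \<noteq> j + \<epsilon>" using j e by presburger+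
      then obtain p0 where p0: "p0 \<le> m" "\<theta> p0 = Suc j - \<epsilon>" using im by blast
      have "\<exists>p\<le>m. \<psi> p = l" if l: "l \<le> n" for l
      proof -
        consider "l < j" | "l = j" | "l > j" by linarith
        then show ?thesis
        proof cases
          case 1
          then obtain p where "p \<le> m" "\<theta> p = l" using im[of l] l by auto
          then show ?thesis using 1 \<psi> by auto
        next
          case 2
          then show ?thesis using p0 \<psi>[of p0] e by (intro exI[of _ p0]) auto
        next
          case 3
          then obtain p where "p \<le> m" "\<theta> p = Suc l" using im[of "Suc l"] l e by auto
          then show ?thesis using 3 \<psi> by auto
        qed
      qed
      then have "{..n} \<subseteq> \<psi> ` {..m}" by blast
      then have "\<psi> ` {..m} = {..n}" using deltas_funcD[OF \<psi>d] by auto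
      moreover have "\<tau> p0 \<noteq> \<epsilon>" using \<tau>[OF p0(1)] p0 e by auto
      then have "\<tau> \<noteq> cst m \<epsilon>" using p0(1) by auto
      moreover have "\<not> in_prism i m \<psi> \<tau>" if "if \<epsilon> = 0 then j < i else i < j" for i
      proof
        assume "in_prism i m \<psi> \<tau>"
        then have "\<tau> p0 = 0 \<longrightarrow> \<psi> p0 \<le> i" "\<tau> p0 \<noteq> 0 \<longrightarrow> i \<le> \<psi> p0" using p0(1) by (auto simp: in_prism_def)
        then show False using \<tau>[OF p0(1)] \<psi>[OF p0(1)] p0 e that by (auto split: if_splits)
      qed
      ultimately show False using * by blast
    qed
  qed
qed


section \<open>The homotopy extension property\<close>

definition cyl_dom :: "'x sset \<Rightarrow> (nat \<Rightarrow> 'x set) \<Rightarrow> nat \<Rightarrow> nat \<Rightarrow> ('x \<times> (nat \<Rightarrow> nat)) set" where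
  "cyl_dom X S \<epsilon> n = {(x, \<tau>). x \<in> spx X n \<and> \<tau> \<in> deltas n 1 \<and> (x \<in> S n \<or> \<tau> = cst n \<epsilon>)}"

text \<open>A simplex of least dimension outside \<open>S\<close> is attached freely along the
  boundary of \<Delta>[n]. A section of a surjective operator recovers \<open>x\<close> from its
  image, so that image stays outside \<open>S\<close>; other operators factor through lower
  dimensions. If \<theta> and \<theta>' agree on \<open>x\<close> and \<sigma> is a section of
  \<theta>, the composite of \<theta>' with \<sigma> fixes \<open>x\<close>, hence is onto and equal
  to the identity; \<sigma> may be taken through any given point.\<close>

lemma
  assumes X: "sset X" and S: "\<And>m n \<theta> z. \<theta> \<in> deltas m n \<Longrightarrow> z \<in> S n \<Longrightarrow> act X m n \<theta> z \<in> S m"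
    and x: "x \<in> spx X n" "x \<notin> S n" and lower: "\<And>m. m < n \<Longrightarrow> spx X m \<subseteq> S m"
  shows minimal_simplex_act_in: "\<theta> \<in> deltas m n \<Longrightarrow> act X m n \<theta> x \<in> S m \<longleftrightarrow> \<theta> ` {..m} \<noteq> {..n}"
    and minimal_simplex_act_inj: "\<lbrakk>\<theta> \<in> deltas m n; \<theta>' \<in> deltas m n; act X m n \<theta> x = act X m n \<theta>' x;
      act X m n \<theta> x \<notin> S m\<rbrakk> \<Longrightarrow> \<theta> = \<theta>'"
proof -
  have *: "act X m n \<theta> x \<in> S m \<longleftrightarrow> \<theta> ` {..m} \<noteq> {..n}" if \<theta>: "\<theta> \<in> deltas m n" for m \<theta>
  proof
    assume in_S: "act X m n \<theta> x \<in> S m"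
    show "\<theta> ` {..m} \<noteq> {..n}"
    proof
      assume "\<theta> ` {..m} = {..n}"
      then obtain \<sigma> where \<sigma>: "\<sigma> \<in> deltas n m" "compose {..n} \<theta> \<sigma> = did n"
        using surj_section[OF \<theta>, of 0] by auto
      then have "act X n m \<sigma> (act X m n \<theta> x) = x"
        using sset_comp[OF X \<sigma>(1) \<theta> x(1)] sset_id[OF X x(1)] by simp
      then show False using S[OF \<sigma>(1) in_S] x(2) by simp
    qed
  next
    assume "\<theta> ` {..m} \<noteq> {..n}"
    then obtain j where "j \<le> n" "j \<notin> \<theta> ` {..m}" using deltas_funcD[OF \<theta>] by auto
    then obtain n' \<delta> \<psi> where f: "n = Suc n'" "\<delta> \<in> deltas n' n" "\<psi> \<in> deltas m n'" "\<theta> = compose {..m} \<delta> \<psi>"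
      using nonsurj_factor[OF \<theta>] by blast
    have "act X n' n \<delta> x \<in> S n'" using sset_act[OF X f(2) x(1)] lower f(1) by auto
    then show "act X m n \<theta> x \<in> S m" using S[OF f(3)] sset_comp[OF X f(3,2) x(1)] f(4) by simp
  qed
  then show "act X m n \<theta> x \<in> S m \<longleftrightarrow> \<theta> ` {..m} \<noteq> {..n}" if "\<theta> \<in> deltas m n" using that .
  show "\<theta> = \<theta>'" if \<theta>: "\<theta> \<in> deltas m n" and \<theta>': "\<theta>' \<in> deltas m n"
    and eq: "act X m n \<theta> x = act X m n \<theta>' x" and notin: "act X m n \<theta> x \<notin> S m"
  proof (rule deltas_eqI[OF \<theta> \<theta>'])
    fix p assume p: "p \<le> m"
    obtain \<sigma> where \<sigma>: "\<sigma> \<in> deltas n m" "compose {..n} \<theta> \<sigma> = did n" "\<sigma> (\<theta> p) = p"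
      using surj_section[OF \<theta> _ p] *[OF \<theta>] notin by blast
    have d: "compose {..n} \<theta>' \<sigma> \<in> deltas n n" by (rule compose_deltas[OF \<theta>' \<sigma>(1)])
    have "act X n n (compose {..n} \<theta>' \<sigma>) x = x"
      using sset_comp[OF X \<sigma>(1) \<theta>' x(1)] sset_comp[OF X \<sigma>(1) \<theta> x(1)] eq \<sigma>(2) sset_id[OF X x(1)] by simp
    then have "compose {..n} \<theta>' \<sigma> = did n" using surj_deltas_did[OF d] *[OF d] x(2) by auto
    then have "compose {..n} \<theta>' \<sigma> (\<theta> p) = \<theta> p" using deltas_funcD[OF \<theta> p] by simp
    then show "\<theta> p = \<theta>' p" using \<sigma>(3) deltas_funcD[OF \<theta> p] by simp
  qed
qed

text \<open>The cylinder over the new simplex is added by n + 1 horn fillings, one for each prism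
  simplex; \<open>prism_horn\<close> and the freeness of \<open>x\<close> supply the hypotheses of
  \<open>attach_horn\<close>.\<close>

lemma prism_attach:
  assumes kan: "kan_fibration Y A g" and X: "sset X" and c: "c \<in> smaps (sprod X (std_simplex 1)) A"
    and e: "\<epsilon> \<le> 1"
    and S: "\<And>m n \<theta> z. \<theta> \<in> deltas m n \<Longrightarrow> z \<in> S n \<Longrightarrow> act X m n \<theta> z \<in> S m"
    and x: "x \<in> spx X n" "x \<notin> S n" and lower: "\<And>m. m < n \<Longrightarrow> spx X m \<subseteq> S m"
    and G: "partial_lift (sprod X (std_simplex 1)) Y g c G" and dom: "\<And>m. lift_dom G m = cyl_dom X S \<epsilon> m"
  shows "\<exists>G'. partial_lift (sprod X (std_simplex 1)) Y g c G' \<and> G \<subseteq> G' \<and>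
    (\<forall>m. lift_dom G' m = cyl_dom X (\<lambda>m. S m \<union> {act X m n \<theta> x |\<theta>. \<theta> \<in> deltas m n}) \<epsilon> m)"
proof -
  let ?P = "sprod X (std_simplex 1)"
  have act_in: "act X m n \<theta> x \<in> S m \<longleftrightarrow> \<theta> ` {..m} \<noteq> {..n}" if "\<theta> \<in> deltas m n" for m \<theta>
    by (rule minimal_simplex_act_in[OF X S x lower that])
  have act_inj: "\<theta> = \<theta>'" if "\<theta> \<in> deltas m n" "\<theta>' \<in> deltas m n" "act X m n \<theta> x = act X m n \<theta>' x"
      "act X m n \<theta> x \<notin> S m" for m \<theta> \<theta>'
    by (rule minimal_simplex_act_inj[OF X S x lower that])
  have P: "sset ?P" by (rule sset_sprod[OF X sset_std_simplex])
  \<comment> \<open>The indices of the prism simplices attached after \<open>t\<close> stages: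
    downwards from \<open>n\<close> if \<epsilon> = 0 and upwards from 0 if \<epsilon> = 1, so that
    the wall shared with the previous one is the covered wall in \<open>prism_horn\<close>.
    \<open>D\<close> is the part of the cylinder that they cover.\<close>
  define M where "M t = {i. i \<le> n \<and> (if \<epsilon> = 0 then n < i + t else i < t)}" for t
  define D where "D N m = {(z, \<tau>). \<tau> \<in> deltas m 1 \<and>
      (\<exists>\<psi>\<in>deltas m n. z = act X m n \<psi> x \<and> (\<exists>i\<in>N. in_prism i m \<psi> \<tau>))}" for N m
  have stage: "\<exists>G'. partial_lift ?P Y g c G' \<and> G \<subseteq> G' \<and> (\<forall>m. lift_dom G' m = cyl_dom X S \<epsilon> m \<union> D (M t) m)"
    if "t \<le> Suc n" for t
    using that
  proof (induction t)
    case 0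
    have "M 0 = {}" by (auto simp: M_def)
    then have "D (M 0) m = {}" for m by (auto simp: D_def)
    then show ?case using G dom by auto
  next
    case (Suc t)
    then obtain G1 where G1: "partial_lift ?P Y g c G1" "G \<subseteq> G1"
        and dom1: "\<And>m. lift_dom G1 m = cyl_dom X S \<epsilon> m \<union> D (M t) m"
      by auto
    define j where "j = (if \<epsilon> = 0 then n - t else t)"
    have j: "j \<le> n" using Suc.prems by (auto simp: j_def)
    have M: "M t = {i. i \<le> n \<and> (if \<epsilon> = 0 then j < i else i < j)}"
      using Suc.prems by (auto simp: M_def j_def)
    have M': "M (Suc t) = insert j (M t)"
      using Suc.prems by (auto simp: M_def j_def split: if_splits)
    let ?s = "(act X (Suc n) n (prism_deg n j) x, prism_lev n j)"
    note deg = prism_deg_deltas[OF j] and lev = prism_lev_deltas[of n j]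
    have s: "?s \<in> spx ?P (Suc n)" using sset_act[OF X deg x(1)] lev by simp
    have act_s: "act ?P m (Suc n) \<theta> ?s = (act X m n (compose {..m} (prism_deg n j) \<theta>) x, compose {..m} (prism_lev n j) \<theta>)"
      if "\<theta> \<in> deltas m (Suc n)" for m \<theta>
      using sset_comp[OF X that deg x(1)] by simp
    have in_dom: "act ?P m (Suc n) \<theta> ?s \<in> lift_dom G1 m \<longleftrightarrow>
        \<psi> ` {..m} \<noteq> {..n} \<or> \<tau> = cst m \<epsilon> \<or> (\<exists>i\<le>n. (if \<epsilon> = 0 then j < i else i < j) \<and> in_prism i m \<psi> \<tau>)"
      if \<theta>: "\<theta> \<in> deltas m (Suc n)" and \<psi>: "\<psi> = compose {..m} (prism_deg n j) \<theta>"
        and \<tau>: "\<tau> = compose {..m} (prism_lev n j) \<theta>" for m \<theta> \<psi> \<tau>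
    proof -
      have d: "\<psi> \<in> deltas m n" "\<tau> \<in> deltas m 1"
        unfolding \<psi> \<tau> using compose_deltas[OF deg \<theta>] compose_deltas[OF lev \<theta>] by auto
      have s_eq: "act ?P m (Suc n) \<theta> ?s = (act X m n \<psi> x, \<tau>)" unfolding act_s[OF \<theta>] \<psi> \<tau> ..
      have 1: "act ?P m (Suc n) \<theta> ?s \<in> cyl_dom X S \<epsilon> m \<longleftrightarrow> \<psi> ` {..m} \<noteq> {..n} \<or> \<tau> = cst m \<epsilon>"
        using act_in[OF d(1)] d(2) sset_act[OF X d(1) x(1)] unfolding s_eq cyl_dom_def by simp
      \<comment> \<open>Only a surjective \<psi> is determined by the simplex it produces. For any
        other \<psi> the simplex already lies in \<open>cyl_dom\<close>, and the equivalence is not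
        asked for.\<close>
      have 2: "act ?P m (Suc n) \<theta> ?s \<in> D (M t) m \<longleftrightarrow> (\<exists>i\<in>M t. in_prism i m \<psi> \<tau>)" if surj: "\<psi> ` {..m} = {..n}"
      proof -
        have "\<psi> = \<psi>'" if "\<psi>' \<in> deltas m n" "act X m n \<psi> x = act X m n \<psi>' x" for \<psi>'
          using act_inj[OF d(1) that] act_in[OF d(1)] surj by blast
        then show ?thesis using d unfolding s_eq D_def by auto
      qed
      have 3: "(\<exists>i\<in>M t. in_prism i m \<psi> \<tau>) \<longleftrightarrow>
          (\<exists>i\<le>n. (if \<epsilon> = 0 then j < i else i < j) \<and> in_prism i m \<psi> \<tau>)"
        by (auto simp: M)
      show ?thesis unfolding dom1 Un_iff 1 3[symmetric] using 2 by blast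
    qed
    obtain G2 where G2: "partial_lift ?P Y g c G2" "G1 \<subseteq> G2"
      "\<And>m z. z \<in> lift_dom G2 m \<longleftrightarrow> z \<in> lift_dom G1 m \<or> (\<exists>\<theta>\<in>deltas m (Suc n). z = act ?P m (Suc n) \<theta> ?s)"
    proof (rule attach_horn[OF kan P c G1(1) s])
      show "1 \<le> Suc n" "j + \<epsilon> \<le> Suc n" using j e by auto
      show "act ?P m (Suc n) \<theta> ?s \<in> lift_dom G1 m \<longleftrightarrow> \<theta> \<in> spx (horn (Suc n) (j + \<epsilon>)) m"
        if "\<theta> \<in> deltas m (Suc n)" for m \<theta>
        unfolding prism_horn[OF j e that] in_dom[OF that refl refl] ..
      show "\<theta> = \<theta>'" if \<theta>: "\<theta> \<in> deltas m (Suc n)" "\<theta>' \<in> deltas m (Suc n)"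
        and eq: "act ?P m (Suc n) \<theta> ?s = act ?P m (Suc n) \<theta>' ?s"
        and notin: "act ?P m (Suc n) \<theta> ?s \<notin> lift_dom G1 m" for m \<theta> \<theta>'
      proof (rule prism_inj[OF \<theta>])
        let ?\<psi> = "compose {..m} (prism_deg n j) \<theta>" and ?\<psi>' = "compose {..m} (prism_deg n j) \<theta>'"
        have d: "?\<psi> \<in> deltas m n" "?\<psi>' \<in> deltas m n" using compose_deltas[OF deg] \<theta> by auto
        have "?\<psi> ` {..m} = {..n}" using notin in_dom[OF \<theta>(1) refl refl] by auto
        moreover have "act X m n ?\<psi> x = act X m n ?\<psi>' x" using eq act_s \<theta> by simp
        ultimately show "?\<psi> = ?\<psi>'" using act_inj[OF d] act_in[OF d(1)] by simp
        show "compose {..m} (prism_lev n j) \<theta> = compose {..m} (prism_lev n j) \<theta>'"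
          using eq act_s \<theta> by simp
      qed
    next
      fix G2 assume "partial_lift ?P Y g c G2" "G1 \<subseteq> G2"
        "\<And>m z. z \<in> lift_dom G2 m \<longleftrightarrow> z \<in> lift_dom G1 m \<or> (\<exists>\<theta>\<in>deltas m (Suc n). z = act ?P m (Suc n) \<theta> ?s)"
      then show thesis by (rule that)
    qed
    have "(\<exists>\<theta>\<in>deltas m (Suc n). z = act ?P m (Suc n) \<theta> ?s) \<longleftrightarrow> z \<in> D {j} m" for m z
    proof -
      have "(\<exists>\<theta>\<in>deltas m (Suc n). z = act ?P m (Suc n) \<theta> ?s) \<longleftrightarrow>
          (\<exists>\<theta>\<in>deltas m (Suc n). z = (act X m n (compose {..m} (prism_deg n j) \<theta>) x, compose {..m} (prism_lev n j) \<theta>))"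
        using act_s by auto
      also have "\<dots> \<longleftrightarrow> (\<exists>\<psi>\<in>deltas m n. \<exists>\<tau>\<in>deltas m 1. z = (act X m n \<psi> x, \<tau>) \<and> in_prism j m \<psi> \<tau>)"
        using in_prism_iff[OF j] compose_deltas[OF deg] compose_deltas[OF lev] by metis
      also have "\<dots> \<longleftrightarrow> z \<in> D {j} m" by (auto simp: D_def)
      finally show ?thesis .
    qed
    moreover have "D (M (Suc t)) m = D (M t) m \<union> D {j} m" for m by (auto simp: D_def M')
    ultimately have "lift_dom G2 m = cyl_dom X S \<epsilon> m \<union> D (M (Suc t)) m" for m
      using G2(3) dom1 by auto
    then show ?case using G1 G2 by blast
  qed
  have "cyl_dom X S \<epsilon> m \<union> D (M (Suc n)) m = cyl_dom X (\<lambda>m. S m \<union> {act X m n \<theta> x |\<theta>. \<theta> \<in> deltas m n}) \<epsilon> m" for m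
  proof -
    have "M (Suc n) = {..n}" by (auto simp: M_def)
    then have "D (M (Suc n)) m = {(z, \<tau>). \<tau> \<in> deltas m 1 \<and> (\<exists>\<psi>\<in>deltas m n. z = act X m n \<psi> x)}"
      using in_prism_ex by (fastforce simp: D_def)
    then show ?thesis using sset_act[OF X _ x(1)] by (auto simp: cyl_dom_def)
  qed
  then show ?thesis using stage[of "Suc n"] by auto
qed

text \<open>Zorn's lemma is applied to partial lifts whose domain is again of the form
  \<open>cyl_dom\<close>; this shape keeps \<open>prism_attach\<close> applicable to a maximal
  element. The conditions on \<open>h\<close> concern its values on the domain, so any formula valid
  there may be used.\<close>

lemma homotopy_extension:
  fixes X :: "'x sset" and Y :: "'y sset"
  assumes kan: "kan_fibration Y A g" and X: "sset X" and c: "c \<in> smaps (sprod X (std_simplex 1)) A"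
    and e: "\<epsilon> \<le> 1"
    and S: "\<And>m n \<theta> z. \<theta> \<in> deltas m n \<Longrightarrow> z \<in> S n \<Longrightarrow> act X m n \<theta> z \<in> S m"
    and h: "\<And>n z. z \<in> cyl_dom X S \<epsilon> n \<Longrightarrow> h n z \<in> spx Y n"
    and gh: "\<And>n z. z \<in> cyl_dom X S \<epsilon> n \<Longrightarrow> g n (h n z) = c n z"
    and h_nat: "\<And>m n \<theta> z. \<theta> \<in> deltas m n \<Longrightarrow> z \<in> cyl_dom X S \<epsilon> n \<Longrightarrow>
       h m (act (sprod X (std_simplex 1)) m n \<theta> z) = act Y m n \<theta> (h n z)"
  obtains l where "l \<in> smaps (sprod X (std_simplex 1)) Y"
    "\<And>n z. z \<in> spx (sprod X (std_simplex 1)) n \<Longrightarrow> g n (l n z) = c n z"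
    "\<And>n z. z \<in> cyl_dom X S \<epsilon> n \<Longrightarrow> l n z = h n z"
proof -
  let ?P = "sprod X (std_simplex 1)"
  have P: "sset ?P" by (rule sset_sprod[OF X sset_std_simplex])
  have cyl_act: "act ?P m n \<theta> z \<in> cyl_dom X S \<epsilon> m" if "\<theta> \<in> deltas m n" "z \<in> cyl_dom X S \<epsilon> n" for m n \<theta> z
    using that S sset_act[OF X that(1)] compose_deltas[OF _ that(1)] cst_deltas[OF e, of m] by (auto simp: cyl_dom_def)
  define G0 where "G0 = {(n, z, y). z \<in> cyl_dom X S \<epsilon> n \<and> y = h n z}"
  have G0: "partial_lift ?P Y g c G0"
    unfolding partial_lift_def
  proof (intro conjI allI impI)
    fix n z y assume "(n, z, y) \<in> G0"
    then show "z \<in> spx ?P n" "y \<in> spx Y n" "g n y = c n z"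
      using h gh by (auto simp: G0_def cyl_dom_def)
  next
    fix m n \<theta> z y assume \<theta>: "\<theta> \<in> deltas m n" and "(n, z, y) \<in> G0"
    then show "(m, act ?P m n \<theta> z, act Y m n \<theta> y) \<in> G0" using cyl_act h_nat by (auto simp: G0_def)
  qed (auto simp: G0_def)
  \<comment> \<open>The simplices over which the whole cylinder is covered, read off at the end
    \<open>1 - \<epsilon>\<close>: since the two ends are different, a simplex there lies in
    \<open>cyl_dom\<close> only by virtue of its first component.\<close>
  define S' where "S' G n = {x. (x, cst n (1 - \<epsilon>)) \<in> lift_dom G n}" for G :: "(nat \<times> ('x \<times> (nat \<Rightarrow> nat)) \<times> 'y) set" and n
  have cst_ne: "cst n (1 - \<epsilon>) \<noteq> cst n \<epsilon>" for n
  proof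
    assume "cst n (1 - \<epsilon>) = cst n \<epsilon>"
    then have "1 - \<epsilon> = \<epsilon>" using cst_apply[of 0 n] by (metis le0)
    then show False using e by presburger
  qed
  define \<G> where "\<G> = {G. partial_lift ?P Y g c G \<and> G0 \<subseteq> G \<and> (\<forall>n. lift_dom G n = cyl_dom X (S' G) \<epsilon> n)}"
  have "\<exists>G\<in>\<G>. \<forall>G'\<in>\<G>. G \<subseteq> G' \<longrightarrow> G' = G"
  proof (rule subset_Zorn_nonempty)
    have "lift_dom G0 n = cyl_dom X S \<epsilon> n" for n by (auto simp: lift_dom_def G0_def)
    moreover have "cyl_dom X S \<epsilon> n = cyl_dom X (S' G0) \<epsilon> n" for n
      using cst_ne cst_deltas[of "1 - \<epsilon>" 1 n] unfolding S'_def calculation by (auto simp: cyl_dom_def)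
    ultimately have "G0 \<in> \<G>" using G0 by (auto simp: \<G>_def)
    then show "\<G> \<noteq> {}" by blast
  next
    fix \<C> assume ne: "\<C> \<noteq> {}" and ch: "subset.chain \<G> \<C>"
    have sub: "\<And>G. G \<in> \<C> \<Longrightarrow> G \<in> \<G>" and total: "\<And>G G'. G \<in> \<C> \<Longrightarrow> G' \<in> \<C> \<Longrightarrow> G \<subseteq> G' \<or> G' \<subseteq> G"
      using ch by (auto simp: subset_chain_def)
    have pl: "partial_lift ?P Y g c G" and dom: "lift_dom G n = cyl_dom X (S' G) \<epsilon> n" and "G0 \<subseteq> G"
      if "G \<in> \<C>" for G n using sub[OF that] by (auto simp: \<G>_def)
    have "partial_lift ?P Y g c (\<Union>\<C>)"
      unfolding partial_lift_def
    proof (intro conjI allI impI)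
      fix n z y assume "(n, z, y) \<in> \<Union>\<C>"
      then obtain G where G: "G \<in> \<C>" "(n, z, y) \<in> G" by blast
      note GD = partial_liftD(1-3)[OF pl[OF G(1)] G(2)]
      show "z \<in> spx ?P n" by (rule GD(1))
      show "y \<in> spx Y n" by (rule GD(2))
      show "g n y = c n z" by (rule GD(3))
    next
      fix n z y y' assume "(n, z, y) \<in> \<Union>\<C>" "(n, z, y') \<in> \<Union>\<C>"
      then obtain G1 G2 where G12: "G1 \<in> \<C>" "(n, z, y) \<in> G1" "G2 \<in> \<C>" "(n, z, y') \<in> G2" by blast
      then obtain G where G: "G \<in> \<C>" "(n, z, y) \<in> G" "(n, z, y') \<in> G" using total[OF G12(1,3)] by blast
      show "y = y'" by (rule partial_liftD(4)[OF pl[OF G(1)] G(2,3)])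
    next
      fix m n \<theta> z y assume \<theta>: "\<theta> \<in> deltas m n" and "(n, z, y) \<in> \<Union>\<C>"
      then obtain G where G: "G \<in> \<C>" "(n, z, y) \<in> G" by blast
      show "(m, act ?P m n \<theta> z, act Y m n \<theta> y) \<in> \<Union>\<C>"
        using partial_liftD(5)[OF pl[OF G(1)] G(2) \<theta>] G(1) by blast
    qed
    moreover have "lift_dom (\<Union>\<C>) n = cyl_dom X (S' (\<Union>\<C>)) \<epsilon> n" for n
    proof -
      have U: "lift_dom (\<Union>\<C>) n = (\<Union>G\<in>\<C>. lift_dom G n)" for n by (auto simp: lift_dom_def)
      have "(\<Union>G\<in>\<C>. cyl_dom X (S' G) \<epsilon> n) = cyl_dom X (S' (\<Union>\<C>)) \<epsilon> n"
        using ne unfolding cyl_dom_def S'_def U by auto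
      then show ?thesis unfolding U using dom by simp
    qed
    moreover have "G0 \<subseteq> \<Union>\<C>" using ne \<open>\<And>G. G \<in> \<C> \<Longrightarrow> G0 \<subseteq> G\<close> by blast
    ultimately show "\<Union>\<C> \<in> \<G>" by (simp add: \<G>_def)
  qed
  then obtain G where "G \<in> \<G>" and max: "\<And>G'. G' \<in> \<G> \<Longrightarrow> G \<subseteq> G' \<Longrightarrow> G' = G" by blast
  then have G: "partial_lift ?P Y g c G" and G0G: "G0 \<subseteq> G" and dom: "\<And>n. lift_dom G n = cyl_dom X (S' G) \<epsilon> n"
    by (auto simp: \<G>_def)
  have S'_act: "act X m n \<theta> z \<in> S' G m" if "\<theta> \<in> deltas m n" "z \<in> S' G n" for m n \<theta> z
    using lift_dom_act[OF G _ that(1), of "(z, cst n (1 - \<epsilon>))"] that by (simp add: S'_def)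
  \<comment> \<open>In a counterexample of least dimension all lower simplices are covered, so its
    cylinder could be attached, against maximality.\<close>
  have all: "x \<in> S' G n" if "x \<in> spx X n" for n x
    using that
  proof (induction n arbitrary: x rule: less_induct)
    case (less n)
    show ?case
    proof (rule ccontr)
      assume x: "x \<notin> S' G n"
      have lower: "spx X m \<subseteq> S' G m" if "m < n" for m using less.IH[OF that] by blast
      define T where "T m = {act X m n \<theta> x |\<theta>. \<theta> \<in> deltas m n}" for m
      obtain G' where G': "partial_lift ?P Y g c G'" "G \<subseteq> G'"
        "\<And>m. lift_dom G' m = cyl_dom X (\<lambda>m. S' G m \<union> T m) \<epsilon> m"
        using prism_attach[OF kan X c e S'_act less.prems x lower G dom] unfolding T_def by blast
      have eq: "S' G' m = {x \<in> spx X m. x \<in> S' G m \<union> T m}" for m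
        unfolding S'_def[of G'] G'(3) using cst_ne cst_deltas[of "1 - \<epsilon>" 1 m] by (auto simp: cyl_dom_def)
      have "cyl_dom X (S' G') \<epsilon> m = lift_dom G' m" for m unfolding G'(3) by (auto simp: cyl_dom_def eq)
      then have "G' \<in> \<G>" using G' G0G by (auto simp: \<G>_def)
      then have "G' = G" using max G'(2) by blast
      moreover have "act X n n (did n) x \<in> T n" unfolding T_def using did_deltas by blast
      then have "x \<in> T n" by (simp add: sset_id[OF X less.prems])
      then have "x \<in> S' G' n" using less.prems by (simp add: eq)
      ultimately show False using x by simp
    qed
  qed
  have ex: "\<exists>y. (n, z, y) \<in> G" if "z \<in> spx ?P n" for n z
  proof -
    have "z \<in> lift_dom G n" using that all by (auto simp: dom cyl_dom_def)
    then show ?thesis by (simp add: lift_dom_def)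
  qed
  define l where "l = (\<lambda>n. \<lambda>z\<in>spx ?P n. SOME y. (n, z, y) \<in> G)"
  have lG: "(n, z, l n z) \<in> G" if z: "z \<in> spx ?P n" for n z
    using someI_ex[OF ex[OF z]] z by (simp add: l_def)
  show thesis
  proof (rule that[of l])
    show "l \<in> smaps ?P Y"
    proof (rule smapsI)
      fix n z assume "z \<in> spx ?P n"
      then show "l n z \<in> spx Y n" using partial_liftD(2)[OF G lG] by simp
    next
      fix n z assume "z \<notin> spx ?P n"
      then show "l n z = undefined" by (simp add: l_def)
    next
      fix m n \<theta> z assume \<theta>: "\<theta> \<in> deltas m n" and z: "z \<in> spx ?P n"
      show "l m (act ?P m n \<theta> z) = act Y m n \<theta> (l n z)"
        by (rule partial_liftD(4)[OF G lG[OF sset_act[OF P \<theta> z]] partial_liftD(5)[OF G lG[OF z] \<theta>]])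
    qed
    show "g n (l n z) = c n z" if "z \<in> spx ?P n" for n z by (rule partial_liftD(3)[OF G lG[OF that]])
    show "l n z = h n z" if "z \<in> cyl_dom X S \<epsilon> n" for n z
    proof -
      have "(n, z, h n z) \<in> G" using that G0G by (auto simp: G0_def)
      moreover from this have "(n, z, l n z) \<in> G" using partial_liftD(1)[OF G] lG by blast
      ultimately show ?thesis using partial_liftD(4)[OF G] by blast
    qed
  qed
qed

section \<open>Contracting a horn\<close>

text \<open>The homotopy \<open>\<Delta>[n] \<times> \<Delta>[1] \<rightarrow> \<Delta>[n]\<close> with \<open>\<epsilon> = 0\<close> if \<open>k < n\<close> and \<open>\<epsilon> = 1\<close> if \<open>k = n\<close> is the
  identity at \<open>1 - \<epsilon>\<close>, maps \<open>\<Delta>[n] \<times> {\<epsilon>}\<close> into the \<open>k\<close>-th horn, and preserves that horn.\<close>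

definition contr :: "nat \<Rightarrow> nat \<Rightarrow> nat \<Rightarrow> (nat \<Rightarrow> nat) \<Rightarrow> (nat \<Rightarrow> nat) \<Rightarrow> nat \<Rightarrow> nat" where
  "contr k \<epsilon> m \<theta> \<tau> = (\<lambda>p\<in>{..m}. if \<tau> p = \<epsilon> then (if \<epsilon> = 0 then min (\<theta> p) k else max (\<theta> p) k) else \<theta> p)"

lemma contr_deltas:
  assumes k: "k \<le> n" and e: "\<epsilon> \<le> 1" and \<theta>: "\<theta> \<in> deltas m n" and \<tau>: "\<tau> \<in> deltas m 1"
  shows "contr k \<epsilon> m \<theta> \<tau> \<in> deltas m n"
  unfolding contr_def
proof (rule restrict_deltas)
  fix i assume "i \<le> m"
  then show "(if \<tau> i = \<epsilon> then if \<epsilon> = 0 then min (\<theta> i) k else max (\<theta> i) k else \<theta> i) \<le> n"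
    using deltas_funcD[OF \<theta>] k by auto
next
  fix i j assume ij: "i \<le> j" "j \<le> m"
  have "\<theta> i \<le> \<theta> j" "\<tau> i \<le> \<tau> j" using deltas_monoD[OF \<theta> ij] deltas_monoD[OF \<tau> ij] by auto
  moreover have "\<tau> i \<le> 1" "\<tau> j \<le> 1" using deltas_funcD[OF \<tau>] ij by auto
  ultimately show "(if \<tau> i = \<epsilon> then if \<epsilon> = 0 then min (\<theta> i) k else max (\<theta> i) k else \<theta> i)
      \<le> (if \<tau> j = \<epsilon> then if \<epsilon> = 0 then min (\<theta> j) k else max (\<theta> j) k else \<theta> j)"
    using e by auto
qed

lemma contr_compose:
  assumes "\<phi> \<in> deltas l m"
  shows "contr k \<epsilon> l (compose {..l} \<theta> \<phi>) (compose {..l} \<tau> \<phi>) = compose {..l} (contr k \<epsilon> m \<theta> \<tau>) \<phi>"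
  using deltas_funcD[OF assms] by (auto simp: contr_def compose_def fun_eq_iff restrict_def)

lemma contr_id:
  assumes "\<epsilon> \<le> 1" "\<theta> \<in> deltas m n"
  shows "contr k \<epsilon> m \<theta> (cst m (1 - \<epsilon>)) = \<theta>"
proof -
  have "1 - \<epsilon> \<noteq> \<epsilon>" using assms(1) by presburger
  then show ?thesis
    using assms(2) by (intro extensionalityI[of _ "{..m}"]) (auto simp: contr_def deltas_def PiE_def)
qed

text \<open>Every vertex stays put or moves to \<open>k\<close>, so a missed value other than
  \<open>k\<close> is still missed.\<close>

lemma contr_horn:
  assumes "k \<le> n" "\<epsilon> \<le> 1" "\<theta> \<in> spx (horn n k) m" "\<tau> \<in> deltas m 1"
  shows "contr k \<epsilon> m \<theta> \<tau> \<in> spx (horn n k) m"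
proof -
  obtain j where j: "j \<le> n" "j \<noteq> k" "j \<notin> \<theta> ` {..m}" using assms(3) by (auto simp: spx_horn)
  have "contr k \<epsilon> m \<theta> \<tau> p \<in> {\<theta> p, k}" if "p \<le> m" for p
    using that by (auto simp: contr_def min_def max_def)
  then have "j \<notin> contr k \<epsilon> m \<theta> \<tau> ` {..m}" using j by fastforce
  then show ?thesis
    using contr_deltas[OF assms(1,2) horn_deltas[OF assms(3)] assms(4)] j by (auto simp: spx_horn)
qed

text \<open>The choice of \<epsilon> is made for this: if \<open>k < n\<close>, the minimum with
  \<open>k\<close> never takes the value \<open>n\<close>; if \<open>k = n\<close>, all vertices
  move to \<open>n\<close> and 0 is missed.\<close>

lemma contr_end_horn:
  assumes n: "1 \<le> n" and k: "k \<le> n" and \<epsilon>: "\<epsilon> = (if k < n then 0 else 1)" and \<theta>: "\<theta> \<in> deltas m n"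
  shows "contr k \<epsilon> m \<theta> (cst m \<epsilon>) \<in> spx (horn n k) m"
proof -
  define j where "j = (if k < n then n else 0)"
  have "contr k \<epsilon> m \<theta> (cst m \<epsilon>) p \<noteq> j" if "p \<le> m" for p
    using that n k by (auto simp: contr_def \<epsilon> j_def)
  then have "j \<notin> contr k \<epsilon> m \<theta> (cst m \<epsilon>) ` {..m}" by (metis atMost_iff imageE)
  moreover have e: "\<epsilon> \<le> 1" and "j \<le> n" "j \<noteq> k" using n k by (auto simp: \<epsilon> j_def)
  ultimately show ?thesis
    using contr_deltas[OF k e \<theta> cst_deltas[OF e]] unfolding spx_horn by blast
qed

text \<open>Lifting the faces of a horn one by one gives no compatible family. At the end \<epsilon>
  the contracted horn factors through the single simplex \<open>c0\<close>, which is lifted by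
  surjectivity, and the homotopy from there back to the horn is lifted by the fibration.
  Surjectivity is thus used once, in degree \<open>n\<close>.\<close>

lemma horn_lift:
  assumes kan: "kan_fibration Y A g" and nk: "1 \<le> n" "k \<le> n" and h: "h \<in> smaps (horn n k) A"
    and surj: "\<And>a. a \<in> spx A n \<Longrightarrow> \<exists>y\<in>spx Y n. g n y = a"
  obtains h' where "h' \<in> smaps (horn n k) Y" "\<And>m \<theta>. \<theta> \<in> spx (horn n k) m \<Longrightarrow> g m (h' m \<theta>) = h m \<theta>"
proof -
  note Y = kan_fibrationD(1)[OF kan] and g = kan_fibrationD(3)[OF kan]
  define \<epsilon> :: nat where \<epsilon>: "\<epsilon> = (if k < n then 0 else 1)"
  have e: "\<epsilon> \<le> 1" by (simp add: \<epsilon>)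
  let ?H = "horn n k" and ?I = "std_simplex 1"
  have H: "sset ?H" by (rule sset_horn)
  define c where "c = (\<lambda>m. \<lambda>(\<theta>, \<tau>)\<in>spx (sprod ?H ?I) m. h m (contr k \<epsilon> m \<theta> \<tau>))"
  have ch: "contr k \<epsilon> m \<theta> \<tau> \<in> spx ?H m" if "\<theta> \<in> spx ?H m" "\<tau> \<in> deltas m 1" for m \<theta> \<tau>
    using contr_horn[OF nk(2) e that] .
  have c: "c \<in> smaps (sprod ?H ?I) A"
  proof (rule smapsI)
    fix m z assume "z \<in> spx (sprod ?H ?I) m"
    then show "c m z \<in> spx A m" using smaps_in[OF h ch] by (auto simp: c_def)
  next
    fix l m \<phi> z assume \<phi>: "\<phi> \<in> deltas l m" and z: "z \<in> spx (sprod ?H ?I) m"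
    have "act (sprod ?H ?I) l m \<phi> z \<in> spx (sprod ?H ?I) l"
      by (rule sset_act[OF sset_sprod[OF H sset_std_simplex] \<phi> z])
    then show "c l (act (sprod ?H ?I) l m \<phi> z) = act A l m \<phi> (c m z)"
      using z smaps_horn_nat[OF h \<phi> ch] by (auto simp: c_def contr_compose[OF \<phi>])
  qed (auto simp: c_def)
  \<comment> \<open>The end \<epsilon> of the contraction at the identity of [n]. As
    \<open>contr\<close> commutes with operators, that end of the homotopy factors through this
    \<open>n\<close>-simplex of the horn.\<close>
  define c0 where "c0 = contr k \<epsilon> n (did n) (cst n \<epsilon>)"
  have c0: "c0 \<in> spx ?H n" unfolding c0_def by (rule contr_end_horn[OF nk \<epsilon> did_deltas])
  obtain y where y: "y \<in> spx Y n" "g n y = h n c0" using surj[OF smaps_in[OF h c0]] by blast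
  obtain l where l: "l \<in> smaps (sprod ?H ?I) Y" "\<And>m z. z \<in> spx (sprod ?H ?I) m \<Longrightarrow> g m (l m z) = c m z"
  proof (rule homotopy_extension[OF kan H c e, of "\<lambda>_. {}" "\<lambda>m (\<theta>, \<tau>). act Y m n \<theta> y"])
    fix m z assume "z \<in> cyl_dom ?H (\<lambda>_. {}) \<epsilon> m"
    then obtain \<theta> where z: "z = (\<theta>, cst m \<epsilon>)" and \<theta>: "\<theta> \<in> spx ?H m" by (auto simp: cyl_dom_def)
    note \<theta>' = horn_deltas[OF \<theta>]
    show "(case z of (\<theta>, \<tau>) \<Rightarrow> act Y m n \<theta> y) \<in> spx Y m" using sset_act[OF Y \<theta>' y(1)] by (simp add: z)
    have "contr k \<epsilon> m \<theta> (cst m \<epsilon>) = compose {..m} c0 \<theta>"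
      using contr_compose[OF \<theta>', of k \<epsilon> "did n" "cst n \<epsilon>"] \<theta>' by (simp add: c0_def)
    then show "g m (case z of (\<theta>, \<tau>) \<Rightarrow> act Y m n \<theta> y) = c m z"
      using smaps_nat[OF g \<theta>' y(1)] smaps_horn_nat[OF h \<theta>' c0] y(2) \<theta> cst_deltas[OF e] by (simp add: z c_def)
    show "(case act (sprod ?H ?I) l m \<phi> z of (\<theta>, \<tau>) \<Rightarrow> act Y l n \<theta> y) = act Y l m \<phi> (case z of (\<theta>, \<tau>) \<Rightarrow> act Y m n \<theta> y)"
      if "\<phi> \<in> deltas l m" for l \<phi>
      using sset_comp[OF Y that \<theta>' y(1)] by (simp add: z)
  qed simp_all
  define h' where "h' = (\<lambda>m. \<lambda>\<theta>\<in>spx ?H m. l m (\<theta>, cst m (1 - \<epsilon>)))"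
  have i: "(\<theta>, cst m (1 - \<epsilon>)) \<in> spx (sprod ?H ?I) m" if "\<theta> \<in> spx ?H m" for m \<theta>
    using that cst_deltas[of "1 - \<epsilon>" 1 m] by simp
  show thesis
  proof (rule that)
    show "h' \<in> smaps ?H Y"
    proof (rule smapsI)
      fix m \<theta> assume "\<theta> \<in> spx ?H m"
      then show "h' m \<theta> \<in> spx Y m" using smaps_in[OF l(1) i] by (simp add: h'_def)
    next
      fix l' m \<phi> \<theta> assume \<phi>: "\<phi> \<in> deltas l' m" and \<theta>: "\<theta> \<in> spx ?H m"
      show "h' l' (act ?H l' m \<phi> \<theta>) = act Y l' m \<phi> (h' m \<theta>)"
        using smaps_nat[OF l(1) \<phi> i[OF \<theta>]] \<theta> sset_act[OF H \<phi> \<theta>] \<phi> by (simp add: h'_def)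
    qed (simp add: h'_def)
    show "g m (h' m \<theta>) = h m \<theta>" if \<theta>: "\<theta> \<in> spx ?H m" for m \<theta>
      using l(2)[OF i[OF \<theta>]] i[OF \<theta>] \<theta> contr_id[OF e horn_deltas[OF \<theta>]] by (simp add: h'_def c_def)
  qed
qed


section \<open>Dependent products of Kan fibrations\<close>

text \<open>A section need only be read at identity operators: its value at
  \<open>(\<psi>, a)\<close> is the value at \<open>(did k, a)\<close> of the section restricted
  along \<psi>.\<close>

lemma snd_act_dprod:
  assumes "\<psi> \<in> deltas k n" "(did k, a) \<in> spx (fib A B f k (act B k n \<psi> (fst x))) k"
  shows "snd (act (dprod_tot A B f Y) k n \<psi> x) k (did k, a) = snd x k (\<psi>, a)"
  using assms by (cases x) (simp add: act_dprod)

lemma did_fib: "sset B \<Longrightarrow> b \<in> spx B n \<Longrightarrow> (did n, a) \<in> spx (fib A B f n b) n \<longleftrightarrow> a \<in> spx A n \<and> f n a = b"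
  by (simp add: spx_fib sset_id)

text \<open>A horn in \<open>\<Pi>\<^sub>f Y\<close> over \<open>b : \<Delta>[n] \<rightarrow> B\<close> is a map to \<open>Y\<close> over \<open>A\<close> from the restriction of the fibre of \<open>f\<close> over \<open>b\<close> to the
  horn. Lifting the contraction of the horn along \<open>f\<close> exhibits the inclusion of this restriction as a retract of
  a map against which \<open>Y \<rightarrow> A\<close> has the homotopy extension property.\<close>

theorem kan_fibration_dprod:
  assumes f: "kan_fibration A B f" and Y: "kan_fibration (tot Y) A (str Y)"
  shows "kan_fibration (dprod_tot A B f Y) B (sfst (dprod_tot A B f Y))"
proof (rule kan_fibrationI)
  note A = kan_fibrationD(1)[OF f] and B = kan_fibrationD(2)[OF f] and fm = kan_fibrationD(3)[OF f]
  let ?D = "dprod_tot A B f Y"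
  show "sset ?D" by (rule sset_dprod_tot[OF A B fm])
  show "sset B" by (rule B)
  show "sfst ?D \<in> smaps ?D B" using slice_over_dprod[OF A B fm, of Y] by (simp add: slice_over_def dprod_def)
  fix n k h b assume nk: "1 \<le> n" "k \<le> n" and h: "h \<in> smaps (horn n k) ?D" and b: "b \<in> spx B n"
    and hb: "\<And>m \<theta>. \<theta> \<in> spx (horn n k) m \<Longrightarrow> sfst ?D m (h m \<theta>) = act B m n \<theta> b"
  let ?I = "std_simplex 1"
  define X where "X = fib A B f n b"
  have X: "sset X" unfolding X_def by (rule sset_fib[OF A B fm b])
  have spxX: "(\<theta>, a) \<in> spx X m \<longleftrightarrow> \<theta> \<in> deltas m n \<and> a \<in> spx A m \<and> f m a = act B m n \<theta> b" for \<theta> a m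
    by (simp add: X_def spx_fib)
  have actX: "act X l m \<phi> (\<theta>, a) = (compose {..l} \<theta> \<phi>, act A l m \<phi> a)" for l m \<phi> \<theta> a by (simp add: X_def act_fib)
  define \<epsilon> :: nat where \<epsilon>: "\<epsilon> = (if k < n then 0 else 1)"
  have e: "\<epsilon> \<le> 1" "1 - \<epsilon> \<le> 1" by (simp_all add: \<epsilon>)
  let ?r = "contr k \<epsilon>"
  have r: "?r m \<theta> \<tau> \<in> deltas m n" if "\<theta> \<in> deltas m n" "\<tau> \<in> deltas m 1" for m \<theta> \<tau>
    by (rule contr_deltas[OF nk(2) e(1) that])
  have XI: "sset (sprod X ?I)" by (rule sset_sprod[OF X sset_std_simplex])
  \<comment> \<open>The contraction of \<Delta>[n], followed by \<open>b\<close> and pulled back to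
    the fibre. At the end \<open>1 - \<epsilon>\<close> it sends \<open>(\<theta>, a)\<close> to the
    image of \<open>a\<close> under \<open>f\<close>.\<close>
  define c where "c = (\<lambda>m. \<lambda>((\<theta>, a), \<tau>)\<in>spx (sprod X ?I) m. act B m n (?r m \<theta> \<tau>) b)"
  have c: "c \<in> smaps (sprod X ?I) B"
  proof (rule smapsI)
    fix m z assume "z \<in> spx (sprod X ?I) m"
    then show "c m z \<in> spx B m" using sset_act[OF B r b] by (auto simp: c_def spxX)
  next
    fix l m \<phi> z assume \<phi>: "\<phi> \<in> deltas l m" and z: "z \<in> spx (sprod X ?I) m"
    have "act (sprod X ?I) l m \<phi> z \<in> spx (sprod X ?I) l" by (rule sset_act[OF XI \<phi> z])
    then show "c l (act (sprod X ?I) l m \<phi> z) = act B l m \<phi> (c m z)"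
      using z sset_comp[OF B \<phi> r b] by (auto simp: c_def spxX actX contr_compose[OF \<phi>])
  qed (auto simp: c_def)
  have K_dom: "\<exists>\<theta> a. z = ((\<theta>, a), cst m (1 - \<epsilon>)) \<and> (\<theta>, a) \<in> spx X m" if "z \<in> cyl_dom X (\<lambda>_. {}) (1 - \<epsilon>) m" for z m
    using that by (auto simp: cyl_dom_def)
  \<comment> \<open>Since \<open>f\<close> is a fibration, the homotopy lifts to \<open>A\<close>
    starting from the second projection: \<open>K\<close> carries a point of the fibre along while
    its base point contracts.\<close>
  obtain K where K: "K \<in> smaps (sprod X ?I) A" "\<And>m z. z \<in> spx (sprod X ?I) m \<Longrightarrow> f m (K m z) = c m z"
    "\<And>m z. z \<in> cyl_dom X (\<lambda>_. {}) (1 - \<epsilon>) m \<Longrightarrow> K m z = snd (fst z)"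
  proof (rule homotopy_extension[OF f X c e(2), of "\<lambda>_. {}" "\<lambda>m z. snd (fst z)"])
    fix m z assume "z \<in> cyl_dom X (\<lambda>_. {}) (1 - \<epsilon>) m"
    then obtain \<theta> a where z: "z = ((\<theta>, a), cst m (1 - \<epsilon>))" and \<theta>: "(\<theta>, a) \<in> spx X m" using K_dom by blast
    show "snd (fst z) \<in> spx A m" using \<theta> by (simp add: z spxX)
    show "f m (snd (fst z)) = c m z"
      using \<theta> contr_id[OF e(1), of \<theta> m n k] cst_deltas[OF e(2)] by (simp add: z spxX c_def)
    show "snd (fst (act (sprod X ?I) l m \<phi> z)) = act A l m \<phi> (snd (fst z))" for l \<phi> by (simp add: z actX)
  qed simp_all
  have fK: "f m (K m ((\<theta>, a), \<tau>)) = act B m n (?r m \<theta> \<tau>) b"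
    and K_in: "K m ((\<theta>, a), \<tau>) \<in> spx A m"
    if "(\<theta>, a) \<in> spx X m" "\<tau> \<in> deltas m 1" for m \<theta> a \<tau>
    using K(2)[of "((\<theta>, a), \<tau>)" m] smaps_in[OF K(1), of "((\<theta>, a), \<tau>)" m] that by (auto simp: c_def)
  have K_id: "K m ((\<theta>, a), cst m (1 - \<epsilon>)) = a" if "(\<theta>, a) \<in> spx X m" for m \<theta> a
    using K(3)[of "((\<theta>, a), cst m (1 - \<epsilon>))" m] that cst_deltas[OF e(2)] by (simp add: cyl_dom_def)
  have hD: "h m \<theta> = (act B m n \<theta> b, snd (h m \<theta>))"
    "snd (h m \<theta>) \<in> smaps (fib A B f m (act B m n \<theta> b)) (tot Y)"
    "\<And>j \<psi> a. (\<psi>, a) \<in> spx (fib A B f m (act B m n \<theta> b)) j \<Longrightarrow> str Y j (snd (h m \<theta>) j (\<psi>, a)) = a"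
    if \<theta>: "\<theta> \<in> spx (horn n k) m" for m \<theta>
  proof -
    have "h m \<theta> \<in> spx ?D m" by (rule smaps_in[OF h \<theta>])
    moreover from this have "fst (h m \<theta>) = act B m n \<theta> b" using hb[OF \<theta>] by (simp add: sfst_def)
    ultimately have *: "(act B m n \<theta> b, snd (h m \<theta>)) \<in> spx ?D m" and **: "h m \<theta> = (act B m n \<theta> b, snd (h m \<theta>))"
      by (metis prod.collapse)+
    show "h m \<theta> = (act B m n \<theta> b, snd (h m \<theta>))" by (rule **)
    show "snd (h m \<theta>) \<in> smaps (fib A B f m (act B m n \<theta> b)) (tot Y)" using * by (simp add: spx_dprod slice_maps_fib)
    show "\<And>j \<psi> a. (\<psi>, a) \<in> spx (fib A B f m (act B m n \<theta> b)) j \<Longrightarrow> str Y j (snd (h m \<theta>) j (\<psi>, a)) = a"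
      using * by (simp add: spx_dprod slice_maps_fib)
  qed
  have h_shift: "snd (h j (compose {..j} \<theta> \<psi>)) j (did j, a) = snd (h m \<theta>) j (\<psi>, a)"
    if \<theta>: "\<theta> \<in> spx (horn n k) m" and \<psi>: "\<psi> \<in> deltas j m" and a: "a \<in> spx A j" "f j a = act B j n (compose {..j} \<theta> \<psi>) b"
    for m j \<theta> \<psi> a
  proof -
    have "h j (compose {..j} \<theta> \<psi>) = act ?D j m \<psi> (h m \<theta>)" by (rule smaps_horn_nat[OF h \<psi> \<theta>])
    moreover have "fst (h m \<theta>) = act B m n \<theta> b" using hD(1)[OF \<theta>] by (metis fst_conv)
    moreover have "(did j, a) \<in> spx (fib A B f j (act B j m \<psi> (act B m n \<theta> b))) j"
      using a sset_comp[OF B \<psi> horn_deltas[OF \<theta>] b] did_fib[OF B] sset_act[OF B \<psi> sset_act[OF B horn_deltas[OF \<theta>] b]]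
      by metis
    ultimately show ?thesis using snd_act_dprod[OF \<psi>, of a A B f "h m \<theta>" Y] by simp
  qed
  define S where "S m = {x \<in> spx X m. fst x \<in> spx (horn n k) m}" for m
  \<comment> \<open>\<open>S\<close> is the part of the fibre over the horn. On \<open>S\<close> and
    at the end \<epsilon> the contracted operator lies in the horn, so \<open>h\<close> can be
    evaluated at the point transported by \<open>K\<close>.\<close>
  define h1 where "h1 m z = (case z of ((\<theta>, a), \<tau>) \<Rightarrow> snd (h m (?r m \<theta> \<tau>)) m (did m, K m z))" for m z
  obtain L where L: "L \<in> smaps (sprod X ?I) (tot Y)"
    "\<And>m z. z \<in> spx (sprod X ?I) m \<Longrightarrow> str Y m (L m z) = K m z"
    "\<And>m z. z \<in> cyl_dom X S \<epsilon> m \<Longrightarrow> L m z = h1 m z"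
  proof (rule homotopy_extension[OF Y X K(1) e(1), of S h1])
    show "act X l m \<phi> z \<in> S l" if "\<phi> \<in> deltas l m" "z \<in> S m" for l m \<phi> z
      using that sset_act[OF X that(1), of z] sset_act[OF sset_horn that(1), of "fst z" n k]
      by (cases z) (simp add: S_def actX)
    fix m z assume "z \<in> cyl_dom X S \<epsilon> m"
    then obtain \<theta> a \<tau> where z: "z = ((\<theta>, a), \<tau>)" and \<theta>: "(\<theta>, a) \<in> spx X m" "\<tau> \<in> deltas m 1"
        and S: "\<theta> \<in> spx (horn n k) m \<or> \<tau> = cst m \<epsilon>"
      by (force simp: cyl_dom_def S_def)
    have rh: "?r m \<theta> \<tau> \<in> spx (horn n k) m"
      using S contr_horn[OF nk(2) e(1) _ \<theta>(2)] contr_end_horn[OF nk \<epsilon>] \<theta>(1) by (auto simp: spxX)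
    let ?b = "act B m n (?r m \<theta> \<tau>) b"
    have b': "?b \<in> spx B m" by (rule sset_act[OF B horn_deltas[OF rh] b])
    have in_fib: "(did m, K m z) \<in> spx (fib A B f m ?b) m"
      using fK[OF \<theta>] K_in[OF \<theta>] by (simp add: z did_fib[OF B b'])
    show "h1 m z \<in> spx (tot Y) m" using smaps_in[OF hD(2)[OF rh] in_fib] by (simp add: h1_def z)
    show "str Y m (h1 m z) = K m z" using hD(3)[OF rh in_fib] by (simp add: h1_def z)
    show "h1 l (act (sprod X ?I) l m \<phi> z) = act (tot Y) l m \<phi> (h1 m z)" if \<phi>: "\<phi> \<in> deltas l m" for l \<phi>
    proof -
      have z': "z \<in> spx (sprod X ?I) m" using \<theta> by (simp add: z)
      have K': "K l (act (sprod X ?I) l m \<phi> z) = act A l m \<phi> (K m z)" by (rule smaps_nat[OF K(1) \<phi> z'])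
      have "act A l m \<phi> (K m z) \<in> spx A l" using sset_act[OF A \<phi> smaps_in[OF K(1) z']] .
      moreover have "f l (act A l m \<phi> (K m z)) = act B l n (compose {..l} (?r m \<theta> \<tau>) \<phi>) b"
        using smaps_nat[OF fm \<phi> smaps_in[OF K(1) z']] fK[OF \<theta>] sset_comp[OF B \<phi> horn_deltas[OF rh] b] by (simp add: z)
      ultimately have "h1 l (act (sprod X ?I) l m \<phi> z) = snd (h m (?r m \<theta> \<tau>)) l (\<phi>, act A l m \<phi> (K m z))"
        using h_shift[OF rh \<phi>] K' by (simp add: h1_def z actX contr_compose[OF \<phi>])
      also have "\<dots> = act (tot Y) l m \<phi> (snd (h m (?r m \<theta> \<tau>)) m (did m, K m z))"
        using smaps_nat[OF hD(2)[OF rh] \<phi> in_fib] \<phi> by (simp add: act_fib)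
      finally show ?thesis by (simp add: h1_def z)
    qed
  qed blast
  have i: "(x, cst m (1 - \<epsilon>)) \<in> spx (sprod X ?I) m" if "x \<in> spx X m" for m x
    using that cst_deltas[OF e(2)] by simp
  \<comment> \<open>At the end \<open>1 - \<epsilon>\<close> both \<open>contr\<close> and
    \<open>K\<close> are trivial, so the extension is there a section over \<open>b\<close> that
    restricts to \<open>h\<close> on the horn.\<close>
  define s where "s = (\<lambda>m. \<lambda>x\<in>spx X m. L m (x, cst m (1 - \<epsilon>)))"
  have "s \<in> smaps X (tot Y)"
  proof (rule smapsI)
    fix m x assume "x \<in> spx X m"
    then show "s m x \<in> spx (tot Y) m" using smaps_in[OF L(1) i] by (simp add: s_def)
  next
    fix l m \<phi> x assume \<phi>: "\<phi> \<in> deltas l m" and x: "x \<in> spx X m"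
    show "s l (act X l m \<phi> x) = act (tot Y) l m \<phi> (s m x)"
      using smaps_nat[OF L(1) \<phi> i[OF x]] x sset_act[OF X \<phi> x] \<phi> by (simp add: s_def)
  qed (simp add: s_def)
  moreover have "str Y m (s m (\<theta>, a)) = a" if "(\<theta>, a) \<in> spx X m" for m \<theta> a
    using L(2)[OF i[OF that]] K_id[OF that] that by (simp add: s_def)
  ultimately have "(b, s) \<in> spx ?D n" using b by (simp add: spx_dprod slice_maps_fib X_def)
  moreover have "act ?D m n \<theta> (b, s) = h m \<theta>" if \<theta>: "\<theta> \<in> spx (horn n k) m" for m \<theta>
  proof -
    let ?F = "fib A B f m (act B m n \<theta> b)"
    have "s j (compose {..j} \<theta> \<psi>, a) = snd (h m \<theta>) j (\<psi>, a)" if F: "(\<psi>, a) \<in> spx ?F j" for j \<psi> a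
    proof -
      have \<psi>: "\<psi> \<in> deltas j m" and a: "a \<in> spx A j" using F by (auto simp: spx_fib)
      have x: "(compose {..j} \<theta> \<psi>, a) \<in> spx X j"
        using fib_shift[OF B horn_deltas[OF \<theta>] b F] by (simp add: X_def)
      have hj: "compose {..j} \<theta> \<psi> \<in> spx (horn n k) j" using sset_act[OF sset_horn \<psi> \<theta>] by simp
      have "((compose {..j} \<theta> \<psi>, a), cst j (1 - \<epsilon>)) \<in> cyl_dom X S \<epsilon> j"
        using x hj cst_deltas[OF e(2)] by (simp add: cyl_dom_def S_def)
      then have "s j (compose {..j} \<theta> \<psi>, a) = snd (h j (compose {..j} \<theta> \<psi>)) j (did j, a)"
        using x L(3) contr_id[OF e(1) horn_deltas[OF hj]] K_id[OF x] by (simp add: s_def h1_def)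
      also have "\<dots> = snd (h m \<theta>) j (\<psi>, a)" using h_shift[OF \<theta> \<psi> a] x by (simp add: spxX)
      finally show ?thesis .
    qed
    then have "(\<lambda>(\<psi>, a)\<in>spx ?F j. s j (compose {..j} \<theta> \<psi>, a)) = snd (h m \<theta>) j" for j
      using hD(2)[OF \<theta>] by (intro extensionalityI[of _ "spx ?F j"]) (auto simp: smaps_def PiE_def)
    then show ?thesis using hD(1)[OF \<theta>] by (simp add: act_dprod)
  qed
  ultimately show "\<exists>x\<in>spx ?D n. sfst ?D n x = b \<and> (\<forall>m. \<forall>\<theta>\<in>spx (horn n k) m. act ?D m n \<theta> x = h m \<theta>)"
    by (intro bexI[of _ "(b, s)"]) (auto simp: sfst_def)
qed

section \<open>Closure properties of Kan fibrations\<close>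

lemma scomp_apply [simp]: "x \<in> spx X n \<Longrightarrow> scomp X g f n x = g n (f n x)"
  by (simp add: scomp_def compose_def)

lemma sid_apply [simp]: "x \<in> spx X n \<Longrightarrow> sid X n x = x"
  by (simp add: sid_def)

lemma scomp_smaps: "f \<in> smaps X Y \<Longrightarrow> g \<in> smaps Y Z \<Longrightarrow> sset X \<Longrightarrow> scomp X g f \<in> smaps X Z"
proof (rule smapsI)
  fix m n \<theta> x assume fg: "f \<in> smaps X Y" "g \<in> smaps Y Z" "sset X" and \<theta>: "\<theta> \<in> deltas m n" and x: "x \<in> spx X n"
  show "scomp X g f m (act X m n \<theta> x) = act Z m n \<theta> (scomp X g f n x)"
    using sset_act[OF fg(3) \<theta> x] smaps_nat[OF fg(1) \<theta> x] smaps_nat[OF fg(2) \<theta> smaps_in[OF fg(1) x]] x by simp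
qed (simp_all add: smaps_in, simp add: scomp_def compose_def)

lemma sid_smaps: "sset X \<Longrightarrow> sid X \<in> smaps X X"
  by (rule smapsI) (auto simp: sset_act, simp add: sid_def)

lemma spx_pullback: "(x, y) \<in> spx (pullback X Y f g) n \<longleftrightarrow> x \<in> spx X n \<and> y \<in> spx Y n \<and> f n x = g n y"
  by (simp add: pullback_def)

lemma act_pullback [simp]: "act (pullback X Y f g) m n \<theta> (x, y) = (act X m n \<theta> x, act Y m n \<theta> y)"
  by (simp add: pullback_def)

lemma kan_fibration_comp:
  assumes f: "kan_fibration X Y f" and g: "kan_fibration Y Z g"
  shows "kan_fibration X Z (scomp X g f)"
proof (rule kan_fibrationI)
  show X: "sset X" and Z: "sset Z" using kan_fibrationD f g by blast+
  note fm = kan_fibrationD(3)[OF f] and gm = kan_fibrationD(3)[OF g]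
  show "scomp X g f \<in> smaps X Z" by (rule scomp_smaps[OF fm gm X])
  fix n k h z assume nk: "1 \<le> n" "k \<le> n" and h: "h \<in> smaps (horn n k) X" and z: "z \<in> spx Z n"
    and hz: "\<And>m \<theta>. \<theta> \<in> spx (horn n k) m \<Longrightarrow> scomp X g f m (h m \<theta>) = act Z m n \<theta> z"
  have fh: "scomp (horn n k) f h \<in> smaps (horn n k) Y" by (rule scomp_smaps[OF h fm sset_horn])
  have "g m (scomp (horn n k) f h m \<theta>) = act Z m n \<theta> z" if "\<theta> \<in> spx (horn n k) m" for m \<theta>
    using hz[OF that] smaps_in[OF h that] that by simp
  then obtain y where y: "y \<in> spx Y n" "g n y = z"
    "\<And>m \<theta>. \<theta> \<in> spx (horn n k) m \<Longrightarrow> act Y m n \<theta> y = scomp (horn n k) f h m \<theta>"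
    using kan_fibration_fill[OF g nk fh z] by blast
  then have "f m (h m \<theta>) = act Y m n \<theta> y" if "\<theta> \<in> spx (horn n k) m" for m \<theta> using that by simp
  then obtain x where "x \<in> spx X n" "f n x = y" "\<And>m \<theta>. \<theta> \<in> spx (horn n k) m \<Longrightarrow> act X m n \<theta> x = h m \<theta>"
    using kan_fibration_fill[OF f nk h y(1)] by blast
  then show "\<exists>x\<in>spx X n. scomp X g f n x = z \<and> (\<forall>m. \<forall>\<theta>\<in>spx (horn n k) m. act X m n \<theta> x = h m \<theta>)"
    using y by (intro bexI[of _ x]) auto
qed

lemma kan_fibration_sfst:
  assumes X: "sset X" and f: "f \<in> smaps X C" and g: "kan_fibration Y C g"
  shows "kan_fibration (pullback X Y f g) X (sfst (pullback X Y f g))"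
proof (rule kan_fibrationI)
  let ?P = "pullback X Y f g"
  note Y = kan_fibrationD(1)[OF g] and gm = kan_fibrationD(3)[OF g]
  show "sset ?P" by (rule sset_pullback[OF X Y f gm])
  show "sset X" by (rule X)
  show "sfst ?P \<in> smaps ?P X" by (rule sfst_pullback[OF X Y f gm])
  fix n k h x assume nk: "1 \<le> n" "k \<le> n" and h: "h \<in> smaps (horn n k) ?P" and x: "x \<in> spx X n"
    and hx: "\<And>m \<theta>. \<theta> \<in> spx (horn n k) m \<Longrightarrow> sfst ?P m (h m \<theta>) = act X m n \<theta> x"
  have hP: "h m \<theta> = (act X m n \<theta> x, snd (h m \<theta>))" "snd (h m \<theta>) \<in> spx Y m" "f m (act X m n \<theta> x) = g m (snd (h m \<theta>))"
    if "\<theta> \<in> spx (horn n k) m" for m \<theta>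
    using hx[OF that] smaps_in[OF h that] by (auto simp: sfst_def pullback_def)
  have h': "scomp (horn n k) (ssnd ?P) h \<in> smaps (horn n k) Y"
    by (rule scomp_smaps[OF h ssnd_pullback[OF X Y f gm] sset_horn])
  have eq: "scomp (horn n k) (ssnd ?P) h m \<theta> = snd (h m \<theta>)" if "\<theta> \<in> spx (horn n k) m" for m \<theta>
    using smaps_in[OF h that] that by (simp add: ssnd_def)
  have "g m (scomp (horn n k) (ssnd ?P) h m \<theta>) = act C m n \<theta> (f n x)" if "\<theta> \<in> spx (horn n k) m" for m \<theta>
    using hP(3)[OF that] smaps_nat[OF f horn_deltas[OF that] x] eq[OF that] by simp
  then obtain y where y: "y \<in> spx Y n" "g n y = f n x"
    "\<And>m \<theta>. \<theta> \<in> spx (horn n k) m \<Longrightarrow> act Y m n \<theta> y = scomp (horn n k) (ssnd ?P) h m \<theta>"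
    using kan_fibration_fill[OF g nk h' smaps_in[OF f x]] by blast
  then have "(x, y) \<in> spx ?P n" using x by (simp add: spx_pullback)
  moreover have "act ?P m n \<theta> (x, y) = h m \<theta>" if "\<theta> \<in> spx (horn n k) m" for m \<theta>
    using hP(1)[OF that] y(3)[OF that] eq[OF that] by simp
  ultimately show "\<exists>z\<in>spx ?P n. sfst ?P n z = x \<and> (\<forall>m. \<forall>\<theta>\<in>spx (horn n k) m. act ?P m n \<theta> z = h m \<theta>)"
    by (intro bexI[of _ "(x, y)"]) (auto simp: sfst_def)
qed

lemma kan_fibration_ssnd:
  assumes f: "kan_fibration X C f" and Y: "sset Y" and g: "g \<in> smaps Y C"
  shows "kan_fibration (pullback X Y f g) Y (ssnd (pullback X Y f g))"
proof (rule kan_fibrationI)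
  let ?P = "pullback X Y f g"
  note X = kan_fibrationD(1)[OF f] and fm = kan_fibrationD(3)[OF f]
  show "sset ?P" by (rule sset_pullback[OF X Y fm g])
  show "sset Y" by (rule Y)
  show "ssnd ?P \<in> smaps ?P Y" by (rule ssnd_pullback[OF X Y fm g])
  fix n k h y assume nk: "1 \<le> n" "k \<le> n" and h: "h \<in> smaps (horn n k) ?P" and y: "y \<in> spx Y n"
    and hy: "\<And>m \<theta>. \<theta> \<in> spx (horn n k) m \<Longrightarrow> ssnd ?P m (h m \<theta>) = act Y m n \<theta> y"
  have hP: "h m \<theta> = (fst (h m \<theta>), act Y m n \<theta> y)" "fst (h m \<theta>) \<in> spx X m" "f m (fst (h m \<theta>)) = g m (act Y m n \<theta> y)"
    if "\<theta> \<in> spx (horn n k) m" for m \<theta>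
    using hy[OF that] smaps_in[OF h that] by (auto simp: ssnd_def pullback_def)
  have h': "scomp (horn n k) (sfst ?P) h \<in> smaps (horn n k) X"
    by (rule scomp_smaps[OF h sfst_pullback[OF X Y fm g] sset_horn])
  have eq: "scomp (horn n k) (sfst ?P) h m \<theta> = fst (h m \<theta>)" if "\<theta> \<in> spx (horn n k) m" for m \<theta>
    using smaps_in[OF h that] that by (simp add: sfst_def)
  have "f m (scomp (horn n k) (sfst ?P) h m \<theta>) = act C m n \<theta> (g n y)" if "\<theta> \<in> spx (horn n k) m" for m \<theta>
    using hP(3)[OF that] smaps_nat[OF g horn_deltas[OF that] y] eq[OF that] by simp
  then obtain x where x: "x \<in> spx X n" "f n x = g n y"
    "\<And>m \<theta>. \<theta> \<in> spx (horn n k) m \<Longrightarrow> act X m n \<theta> x = scomp (horn n k) (sfst ?P) h m \<theta>"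
    using kan_fibration_fill[OF f nk h' smaps_in[OF g y]] by blast
  then have "(x, y) \<in> spx ?P n" using y by (simp add: spx_pullback)
  moreover have "act ?P m n \<theta> (x, y) = h m \<theta>" if "\<theta> \<in> spx (horn n k) m" for m \<theta>
    using hP(1)[OF that] x(3)[OF that] eq[OF that] by simp
  ultimately show "\<exists>z\<in>spx ?P n. ssnd ?P n z = y \<and> (\<forall>m. \<forall>\<theta>\<in>spx (horn n k) m. act ?P m n \<theta> z = h m \<theta>)"
    by (intro bexI[of _ "(x, y)"]) (auto simp: ssnd_def)
qed

lemma sfst_smaps: "sset X \<Longrightarrow> sset Y \<Longrightarrow> sfst (sprod X Y) \<in> smaps (sprod X Y) X"
  by (rule smapsI) (auto simp: sfst_def sset_act)

lemma ssnd_smaps: "sset X \<Longrightarrow> sset Y \<Longrightarrow> ssnd (sprod X Y) \<in> smaps (sprod X Y) Y"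
  by (rule smapsI) (auto simp: ssnd_def sset_act)

lemma smap_prod_apply [simp]: "x \<in> spx X n \<Longrightarrow> y \<in> spx Y n \<Longrightarrow> smap_prod X Y f g n (x, y) = (f n x, g n y)"
  by (simp add: smap_prod_def)

lemma smap_prod_smaps:
  assumes "sset X" "sset Y" "f \<in> smaps X X'" "g \<in> smaps Y Y'"
  shows "smap_prod X Y f g \<in> smaps (sprod X Y) (sprod X' Y')"
proof (rule smapsI)
  fix n z assume "z \<in> spx (sprod X Y) n"
  then show "smap_prod X Y f g n z \<in> spx (sprod X' Y') n" using smaps_in[OF assms(3)] smaps_in[OF assms(4)] by auto
next
  fix m n \<theta> z assume \<theta>: "\<theta> \<in> deltas m n" and z: "z \<in> spx (sprod X Y) n"
  obtain x y where xy: "z = (x, y)" "x \<in> spx X n" "y \<in> spx Y n" using z by auto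
  show "smap_prod X Y f g m (act (sprod X Y) m n \<theta> z) = act (sprod X' Y') m n \<theta> (smap_prod X Y f g n z)"
    using sset_act[OF assms(1) \<theta> xy(2)] sset_act[OF assms(2) \<theta> xy(3)] xy
      smaps_nat[OF assms(3) \<theta> xy(2)] smaps_nat[OF assms(4) \<theta> xy(3)] by simp
qed (auto simp: smap_prod_def)

lemma kan_fibration_smap_prod:
  assumes f: "kan_fibration X X' f" and g: "kan_fibration Y Y' g"
  shows "kan_fibration (sprod X Y) (sprod X' Y') (smap_prod X Y f g)"
proof (rule kan_fibrationI)
  note X = kan_fibrationD(1)[OF f] and Y = kan_fibrationD(1)[OF g]
  show "sset (sprod X Y)" "sset (sprod X' Y')" using f g by (auto intro: sset_sprod kan_fibrationD)
  show "smap_prod X Y f g \<in> smaps (sprod X Y) (sprod X' Y')"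
    by (rule smap_prod_smaps[OF X Y kan_fibrationD(3)[OF f] kan_fibrationD(3)[OF g]])
  fix n k h z assume nk: "1 \<le> n" "k \<le> n" and h: "h \<in> smaps (horn n k) (sprod X Y)" and z: "z \<in> spx (sprod X' Y') n"
    and hz: "\<And>m \<theta>. \<theta> \<in> spx (horn n k) m \<Longrightarrow> smap_prod X Y f g m (h m \<theta>) = act (sprod X' Y') m n \<theta> z"
  obtain x' y' where z': "z = (x', y')" "x' \<in> spx X' n" "y' \<in> spx Y' n" using z by auto
  define h1 where "h1 = scomp (horn n k) (sfst (sprod X Y)) h"
  define h2 where "h2 = scomp (horn n k) (ssnd (sprod X Y)) h"
  have h12: "h m \<theta> = (h1 m \<theta>, h2 m \<theta>)" "f m (h1 m \<theta>) = act X' m n \<theta> x'" "g m (h2 m \<theta>) = act Y' m n \<theta> y'"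
    if "\<theta> \<in> spx (horn n k) m" for m \<theta>
    using smaps_in[OF h that] hz[OF that] that z'(1) by (auto simp: h1_def h2_def sfst_def ssnd_def)
  have h1: "h1 \<in> smaps (horn n k) X" and h2: "h2 \<in> smaps (horn n k) Y"
    unfolding h1_def h2_def
    using scomp_smaps[OF h sfst_smaps[OF X Y] sset_horn] scomp_smaps[OF h ssnd_smaps[OF X Y] sset_horn] .
  obtain x where x: "x \<in> spx X n" "f n x = x'" "\<And>m \<theta>. \<theta> \<in> spx (horn n k) m \<Longrightarrow> act X m n \<theta> x = h1 m \<theta>"
    using kan_fibration_fill[OF f nk h1 z'(2) h12(2)] by blast
  obtain y where y: "y \<in> spx Y n" "g n y = y'" "\<And>m \<theta>. \<theta> \<in> spx (horn n k) m \<Longrightarrow> act Y m n \<theta> y = h2 m \<theta>"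
    using kan_fibration_fill[OF g nk h2 z'(3) h12(3)] by blast
  show "\<exists>w\<in>spx (sprod X Y) n. smap_prod X Y f g n w = z \<and>
      (\<forall>m. \<forall>\<theta>\<in>spx (horn n k) m. act (sprod X Y) m n \<theta> w = h m \<theta>)"
    using x y h12(1) z' by (intro bexI[of _ "(x, y)"]) auto
qed

lemma kan_fibration_sid:
  assumes X: "sset X"
  shows "kan_fibration X X (sid X)"
proof (rule kan_fibrationI[OF X X sid_smaps[OF X]])
  fix n k h y assume h: "h \<in> smaps (horn n k) X" and y: "y \<in> spx X n"
    and hy: "\<And>m \<theta>. \<theta> \<in> spx (horn n k) m \<Longrightarrow> sid X m (h m \<theta>) = act X m n \<theta> y"
  have "act X m n \<theta> y = h m \<theta>" if "\<theta> \<in> spx (horn n k) m" for m \<theta>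
    using hy[OF that] smaps_in[OF h that] by simp
  then show "\<exists>x\<in>spx X n. sid X n x = y \<and> (\<forall>m. \<forall>\<theta>\<in>spx (horn n k) m. act X m n \<theta> x = h m \<theta>)"
    using y by (intro bexI[of _ y]) auto
qed

lemma kan_fibration_retract:
  assumes f: "kan_fibration X C f" and X': "sset X'" and f': "f' \<in> smaps X' C"
    and i: "i \<in> smaps X' X" and r: "r \<in> smaps X X'"
    and ri: "\<And>n x. x \<in> spx X' n \<Longrightarrow> r n (i n x) = x"
    and fi: "\<And>n x. x \<in> spx X' n \<Longrightarrow> f n (i n x) = f' n x"
    and f'r: "\<And>n x. x \<in> spx X n \<Longrightarrow> f' n (r n x) = f n x"
  shows "kan_fibration X' C f'"
proof (rule kan_fibrationI[OF X' kan_fibrationD(2)[OF f] f'])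
  fix n k h c assume nk: "1 \<le> n" "k \<le> n" and h: "h \<in> smaps (horn n k) X'" and c: "c \<in> spx C n"
    and hc: "\<And>m \<theta>. \<theta> \<in> spx (horn n k) m \<Longrightarrow> f' m (h m \<theta>) = act C m n \<theta> c"
  have ih: "scomp (horn n k) i h \<in> smaps (horn n k) X" by (rule scomp_smaps[OF h i sset_horn])
  have "f m (scomp (horn n k) i h m \<theta>) = act C m n \<theta> c" if "\<theta> \<in> spx (horn n k) m" for m \<theta>
    using hc[OF that] fi[OF smaps_in[OF h that]] that by simp
  then obtain x where x: "x \<in> spx X n" "f n x = c"
    "\<And>m \<theta>. \<theta> \<in> spx (horn n k) m \<Longrightarrow> act X m n \<theta> x = scomp (horn n k) i h m \<theta>"
    using kan_fibration_fill[OF f nk ih c] by blast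
  have "act X' m n \<theta> (r n x) = h m \<theta>" if "\<theta> \<in> spx (horn n k) m" for m \<theta>
    using smaps_nat[OF r horn_deltas[OF that] x(1)] x(3)[OF that] ri[OF smaps_in[OF h that]] that by simp
  then show "\<exists>x\<in>spx X' n. f' n x = c \<and> (\<forall>m. \<forall>\<theta>\<in>spx (horn n k) m. act X' m n \<theta> x = h m \<theta>)"
    using x smaps_in[OF r x(1)] f'r by (intro bexI[of _ "r n x"]) auto
qed

section \<open>Kan complexes as Kan fibrations over the point\<close>

definition point :: "unit sset" where
  "point = \<lparr>spx = (\<lambda>n. UNIV), act = (\<lambda>m n \<theta> x. x)\<rparr>"

definition to_point :: "'a sset \<Rightarrow> ('a, unit) smap" where
  "to_point X = (\<lambda>n. \<lambda>x\<in>spx X n. ())"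

lemma sset_point: "sset point"
  by (simp add: sset_def point_def)

text \<open>No domain is mentioned, because the one element of \<open>unit\<close> is also the
  default value outside of a domain. Hence a slice over the point carries no more than its total
  space.\<close>

lemma unit_smap_eq: "(f :: ('a, unit) smap) = g"
  by (simp add: fun_eq_iff)

lemma to_point_smaps: "to_point X \<in> smaps X point"
  by (rule smapsI) (simp_all add: point_def)

lemma kan_complex_iff: "kan_complex X \<longleftrightarrow> kan_fibration X point (to_point X)"
proof
  assume X: "kan_complex X"
  then have Xs: "sset X" by (simp add: kan_complex_def)
  show "kan_fibration X point (to_point X)"
  proof (rule kan_fibrationI[OF Xs sset_point to_point_smaps])
    fix n k h assume "1 \<le> n" "k \<le> n" "h \<in> smaps (horn n k) X"
    then obtain l where l: "l \<in> smaps (std_simplex n) X" and lh: "\<forall>m. \<forall>\<theta>\<in>spx (horn n k) m. l m \<theta> = h m \<theta>"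
      using X unfolding kan_complex_def by blast
    have "act X m n \<theta> (l n (did n)) = h m \<theta>" if "\<theta> \<in> spx (horn n k) m" for m \<theta>
      using lh that smaps_std_simplex_eq[OF l horn_deltas[OF that]] by simp
    moreover have "l n (did n) \<in> spx X n" using smaps_in[OF l] by simp
    ultimately show "\<exists>x\<in>spx X n. to_point X n x = y \<and> (\<forall>m. \<forall>\<theta>\<in>spx (horn n k) m. act X m n \<theta> x = h m \<theta>)" for y
      by auto
  qed
next
  assume X: "kan_fibration X point (to_point X)"
  note Xs = kan_fibrationD(1)[OF X]
  show "kan_complex X"
    unfolding kan_complex_def
  proof (intro conjI allI impI ballI Xs)
    fix n k h assume nk: "1 \<le> n \<and> k \<le> n" and h: "h \<in> smaps (horn n k) X"
    have pt: "() \<in> spx point n" by (simp add: point_def)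
    obtain x where "x \<in> spx X n" "\<And>m \<theta>. \<theta> \<in> spx (horn n k) m \<Longrightarrow> act X m n \<theta> x = h m \<theta>"
      using kan_fibration_fill[OF X _ _ h pt] nk by auto
    then show "\<exists>l\<in>smaps (std_simplex n) X. \<forall>m. \<forall>\<theta>\<in>spx (horn n k) m. l m \<theta> = h m \<theta>"
      using yoneda_smaps[OF Xs] by (intro bexI[of _ "yoneda X n x"]) (auto simp: yoneda_def horn_deltas)
  qed
qed

lemma kan_complex_fill:
  assumes "kan_complex X" "1 \<le> n" "k \<le> n" "h \<in> smaps (horn n k) X"
  obtains x where "x \<in> spx X n" "\<And>m \<theta>. \<theta> \<in> spx (horn n k) m \<Longrightarrow> act X m n \<theta> x = h m \<theta>"
proof -
  have pt: "() \<in> spx point n" by (simp add: point_def)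
  from kan_fibration_fill[OF assms(1)[unfolded kan_complex_iff] assms(2-4) pt] that show thesis
    by auto
qed

lemma kan_complexI:
  assumes "sset X" and "\<And>n k h. \<lbrakk>1 \<le> n; k \<le> n; h \<in> smaps (horn n k) X\<rbrakk> \<Longrightarrow>
      \<exists>x\<in>spx X n. \<forall>m. \<forall>\<theta>\<in>spx (horn n k) m. act X m n \<theta> x = h m \<theta>"
  shows "kan_complex X"
  unfolding kan_complex_iff
  by (rule kan_fibrationI[OF assms(1) sset_point to_point_smaps]) (use assms(2) in auto)

text \<open>X \<times> E -> E is the pullback of X -> 1 along E -> 1. The two complexes are
  literally equal because the condition on pairs is trivial.\<close>

lemma kan_fibration_times_slice:
  assumes X: "kan_complex X" and E: "sset E"
  shows "kan_fibration (tot (times_slice E X)) E (str (times_slice E X))"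
proof -
  have "pullback X E (to_point X) (to_point E) = sprod X E"
    by (simp add: pullback_def) (simp add: sprod_def)
  then show ?thesis
    using kan_fibration_ssnd[OF X[unfolded kan_complex_iff] E to_point_smaps] by (simp add: times_slice_def)
qed

section \<open>Initial algebras in slice categories\<close>

lemma slice_overD: "slice_over C X \<Longrightarrow> sset (tot X)" "slice_over C X \<Longrightarrow> str X \<in> smaps (tot X) C"
  by (auto simp: slice_over_def)

lemma slice_maps_smaps: "h \<in> slice_maps X Y \<Longrightarrow> h \<in> smaps (tot X) (tot Y)"
  by (simp add: slice_maps_def)

lemma slice_maps_comp:
  assumes X: "slice_over C X" and h: "h \<in> slice_maps X Y" and g: "g \<in> slice_maps Y Z"
  shows "scomp (tot X) g h \<in> slice_maps X Z"
proof (rule slice_mapsI[OF scomp_smaps[OF slice_maps_smaps[OF h] slice_maps_smaps[OF g] slice_overD(1)[OF X]]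
      slice_overD(2)[OF X]])
  fix n x assume x: "x \<in> spx (tot X) n"
  show "str Z n (scomp (tot X) g h n x) = str X n x"
    using slice_mapsD[OF h x] slice_mapsD[OF g smaps_in[OF slice_maps_smaps[OF h] x]] x by simp
qed

lemma slice_maps_sid: "slice_over C X \<Longrightarrow> sid (tot X) \<in> slice_maps X X"
  by (rule slice_mapsI[OF sid_smaps]) (auto simp: slice_over_def)

section \<open>Subobjects as families of sets of simplices\<close>

definition subcomplex :: "'a sset \<Rightarrow> (nat \<Rightarrow> 'a set) \<Rightarrow> bool" where
  "subcomplex X S \<longleftrightarrow> (\<forall>n. S n \<subseteq> spx X n) \<and> (\<forall>m n. \<forall>\<theta>\<in>deltas m n. \<forall>x\<in>S n. act X m n \<theta> x \<in> S m)"

text \<open>Restricting the structure map keeps it extensional. So the subobject of all simplices is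
  \<open>X\<close> itself, and iterated restriction collapses to a single one, both as
  equations.\<close>

definition sub_slice :: "('a, 'c) slice \<Rightarrow> (nat \<Rightarrow> 'a set) \<Rightarrow> ('a, 'c) slice" where
  "sub_slice X S = \<lparr>tot = \<lparr>spx = S, act = act (tot X)\<rparr>, str = (\<lambda>n. restrict (str X n) (S n))\<rparr>"

lemma subcomplexD:
  assumes "subcomplex X S"
  shows "x \<in> S n \<Longrightarrow> x \<in> spx X n" "\<theta> \<in> deltas m n \<Longrightarrow> x \<in> S n \<Longrightarrow> act X m n \<theta> x \<in> S m"
  using assms by (auto simp: subcomplex_def)

lemma sub_slice_simps [simp]:
  "spx (tot (sub_slice X S)) = S" "act (tot (sub_slice X S)) = act (tot X)"
  "x \<in> S n \<Longrightarrow> str (sub_slice X S) n x = str X n x"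
  by (simp_all add: sub_slice_def)

lemma slice_over_sub_slice:
  assumes X: "slice_over C X" and S: "subcomplex (tot X) S"
  shows "slice_over C (sub_slice X S)"
  unfolding slice_over_def
proof
  note Xs = slice_overD(1)[OF X] and Xm = slice_overD(2)[OF X]
  show "sset (tot (sub_slice X S))"
    unfolding sset_def
    using subcomplexD[OF S] sset_id[OF Xs] sset_comp[OF Xs] by auto
  show "str (sub_slice X S) \<in> smaps (tot (sub_slice X S)) C"
  proof (rule smapsI)
    fix n x assume "x \<in> spx (tot (sub_slice X S)) n"
    then show "str (sub_slice X S) n x \<in> spx C n" using smaps_in[OF Xm] subcomplexD(1)[OF S] by simp
  next
    fix m n \<theta> x assume "\<theta> \<in> deltas m n" "x \<in> spx (tot (sub_slice X S)) n"
    then show "str (sub_slice X S) m (act (tot (sub_slice X S)) m n \<theta> x) = act C m n \<theta> (str (sub_slice X S) n x)"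
      using smaps_nat[OF Xm] subcomplexD[OF S] by simp
  qed (simp add: sub_slice_def)
qed

lemma sub_slice_self:
  assumes "slice_over C X"
  shows "sub_slice X (spx (tot X)) = X"
proof -
  have "restrict (str X n) (spx (tot X) n) = str X n" for n
    using slice_overD(2)[OF assms] by (auto simp: smaps_def PiE_def extensional_restrict)
  then show ?thesis by (simp add: sub_slice_def)
qed

lemma sub_slice_sub_slice:
  assumes "\<And>n. S n \<subseteq> T n"
  shows "sub_slice (sub_slice X T) S = sub_slice X S"
  using assms by (auto simp: sub_slice_def restrict_def fun_eq_iff)

lemma slice_maps_sub_sliceI:
  assumes h: "h \<in> slice_maps X Y" and S: "\<And>n x. x \<in> spx (tot X) n \<Longrightarrow> h n x \<in> S n"
    and X: "slice_over C X"
  shows "h \<in> slice_maps X (sub_slice Y S)"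
proof (rule slice_mapsI[OF _ slice_overD(2)[OF X]])
  note hm = slice_maps_smaps[OF h]
  show "h \<in> smaps (tot X) (tot (sub_slice Y S))"
  proof (rule smapsI)
    show "h n x = undefined" if "x \<notin> spx (tot X) n" for n x
      using hm that by (auto simp: smaps_def PiE_def extensional_def)
    show "h m (act (tot X) m n \<theta> x) = act (tot (sub_slice Y S)) m n \<theta> (h n x)"
      if "\<theta> \<in> deltas m n" "x \<in> spx (tot X) n" for m n \<theta> x
      using smaps_nat[OF hm that] by simp
  qed (simp add: S)
  show "str (sub_slice Y S) n (h n x) = str X n x" if "x \<in> spx (tot X) n" for n x
    using slice_mapsD[OF h that] S[OF that] by simp
qed

lemma slice_maps_sub_sliceD:
  assumes h: "h \<in> slice_maps X (sub_slice Y S)" and S: "subcomplex (tot Y) S" and X: "slice_over C X"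
  shows "h \<in> slice_maps X Y"
proof (rule slice_mapsI[OF _ slice_overD(2)[OF X]])
  note hm = slice_maps_smaps[OF h]
  have hS: "h n x \<in> S n" if "x \<in> spx (tot X) n" for n x using smaps_in[OF hm that] by simp
  show "h \<in> smaps (tot X) (tot Y)"
  proof (rule smapsI)
    show "h n x \<in> spx (tot Y) n" if "x \<in> spx (tot X) n" for n x using subcomplexD(1)[OF S hS[OF that]] .
    show "h n x = undefined" if "x \<notin> spx (tot X) n" for n x
      using hm that by (auto simp: smaps_def PiE_def extensional_def)
    show "h m (act (tot X) m n \<theta> x) = act (tot Y) m n \<theta> (h n x)"
      if "\<theta> \<in> deltas m n" "x \<in> spx (tot X) n" for m n \<theta> x
      using smaps_nat[OF hm that] by simp
  qed
  show "str Y n (h n x) = str X n x" if "x \<in> spx (tot X) n" for n x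
    using slice_mapsD[OF h that] hS[OF that] by simp
qed

lemma slice_maps_restrict:
  assumes h: "h \<in> slice_maps X Y" and S: "subcomplex (tot X) S" and X: "slice_over C X"
  shows "(\<lambda>n. restrict (h n) (S n)) \<in> slice_maps (sub_slice X S) Y"
proof (rule slice_mapsI[OF _ slice_overD(2)[OF slice_over_sub_slice[OF X S]]])
  note hm = slice_maps_smaps[OF h] and SD = subcomplexD[OF S]
  show "(\<lambda>n. restrict (h n) (S n)) \<in> smaps (tot (sub_slice X S)) (tot Y)"
    by (rule smapsI) (use SD smaps_in[OF hm] smaps_nat[OF hm] in auto)
  show "str Y n (restrict (h n) (S n) x) = str (sub_slice X S) n x" if "x \<in> spx (tot (sub_slice X S)) n" for n x
    using that slice_mapsD[OF h SD(1)] by simp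
qed

text \<open>The largest subcomplex of \<open>X\<close> contained in \<open>S\<close>. It extends
  operations on subcomplexes to the complete lattice of all families of sets.\<close>

definition hull :: "'a sset \<Rightarrow> (nat \<Rightarrow> 'a set) \<Rightarrow> nat \<Rightarrow> 'a set" where
  "hull X S n = {x \<in> spx X n. \<forall>m. \<forall>\<theta>\<in>deltas m n. act X m n \<theta> x \<in> S m}"

lemma subcomplex_hull:
  assumes X: "sset X"
  shows "subcomplex X (hull X S)"
  unfolding subcomplex_def
proof (intro conjI allI ballI)
  fix m n \<theta> x assume \<theta>: "\<theta> \<in> deltas m n" and x: "x \<in> hull X S n"
  have "act X l m \<phi> (act X m n \<theta> x) \<in> S l" if \<phi>: "\<phi> \<in> deltas l m" for l \<phi>
    using x compose_deltas[OF \<theta> \<phi>] sset_comp[OF X \<phi> \<theta>, of x] by (auto simp: hull_def dest!: bspec)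
  then show "act X m n \<theta> x \<in> hull X S m" using x sset_act[OF X \<theta>] by (simp add: hull_def)
qed (auto simp: hull_def)

lemma hull_subset: "sset X \<Longrightarrow> hull X S n \<subseteq> S n"
  unfolding hull_def by clarify (metis did_deltas sset_id)

lemma hull_subcomplex: "sset X \<Longrightarrow> subcomplex X S \<Longrightarrow> hull X S = S"
  using hull_subset[of X S] by (auto simp: subcomplex_def hull_def fun_eq_iff)

lemma hull_mono: "(\<And>n. S n \<subseteq> T n) \<Longrightarrow> hull X S n \<subseteq> hull X T n"
  by (auto simp: hull_def)

text \<open>The operator that misses exactly \<open>j\<close>; being idempotent it shows that a simplex of a horn is
  determined by \<open>n\<close>-simplices of the horn.\<close>

definition skip :: "nat \<Rightarrow> nat \<Rightarrow> nat \<Rightarrow> nat" where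
  "skip n j = (\<lambda>i\<in>{..n}. if i = j then (if j < n then Suc j else j - 1) else i)"

lemma skip_deltas: "skip n j \<in> deltas n n"
  unfolding skip_def by (rule restrict_deltas) auto

lemma skip_horn: "1 \<le> n \<Longrightarrow> j \<le> n \<Longrightarrow> j \<noteq> k \<Longrightarrow> skip n j \<in> spx (horn n k) n"
  using skip_deltas[of n j] by (auto simp: spx_horn skip_def intro!: exI[of _ j])

lemma skip_compose:
  assumes "\<theta> \<in> deltas m n" "j \<notin> \<theta> ` {..m}"
  shows "compose {..m} (skip n j) \<theta> = \<theta>"
proof (rule deltas_eqI[OF compose_deltas[OF skip_deltas assms(1)] assms(1)])
  fix i assume "i \<le> m"
  then show "compose {..m} (skip n j) \<theta> i = \<theta> i"
    using assms deltas_funcD[OF assms(1)] by (auto simp: skip_def)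
qed

text \<open>Initiality quantifies only over objects with simplices in the type \<open>'v\<close>. An
  object of another type whose simplices inject into \<open>'v\<close> is replaced by an isomorphic
  copy.\<close>

lemma transport_slice:
  fixes Y :: "('f, 'c) slice" and \<iota> :: "nat \<Rightarrow> 'f \<Rightarrow> 'v"
  assumes Y: "slice_over C Y" and inj: "\<And>n. inj_on (\<iota> n) (spx (tot Y) n)"
  obtains X :: "('v, 'c) slice" and \<phi> \<psi> where "slice_over C X" "\<phi> \<in> slice_maps Y X" "\<psi> \<in> slice_maps X Y"
    "\<And>n y. y \<in> spx (tot Y) n \<Longrightarrow> \<psi> n (\<phi> n y) = y" "\<And>n x. x \<in> spx (tot X) n \<Longrightarrow> \<phi> n (\<psi> n x) = x"
proof -
  note Ys = slice_overD(1)[OF Y] and Ym = slice_overD(2)[OF Y]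
  define v where "v n = inv_into (spx (tot Y) n) (\<iota> n)" for n
  have v: "v n (\<iota> n y) = y" if "y \<in> spx (tot Y) n" for n y using inj that by (simp add: v_def)
  define X where "X = \<lparr>tot = \<lparr>spx = (\<lambda>n. \<iota> n ` spx (tot Y) n), act = (\<lambda>m n \<theta> x. \<iota> m (act (tot Y) m n \<theta> (v n x)))\<rparr>,
    str = (\<lambda>n. \<lambda>x\<in>\<iota> n ` spx (tot Y) n. str Y n (v n x))\<rparr>"
  define \<phi> where "\<phi> = (\<lambda>n. restrict (\<iota> n) (spx (tot Y) n))"
  define \<psi> where "\<psi> = (\<lambda>n. restrict (v n) (\<iota> n ` spx (tot Y) n))"
  have X: "spx (tot X) n = \<iota> n ` spx (tot Y) n" "act (tot X) m n \<theta> x = \<iota> m (act (tot Y) m n \<theta> (v n x))"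
    "str X n x = (if x \<in> \<iota> n ` spx (tot Y) n then str Y n (v n x) else undefined)" for m n \<theta> x
    by (simp_all add: X_def restrict_def)
  have Xs: "sset (tot X)"
    unfolding sset_def by (auto simp: X v sset_act[OF Ys] sset_id[OF Ys] sset_comp[OF Ys])
  have Xm: "str X \<in> smaps (tot X) C"
  proof (rule smapsI)
    fix m n \<theta> x assume \<theta>: "\<theta> \<in> deltas m n" and "x \<in> spx (tot X) n"
    then obtain y where y: "y \<in> spx (tot Y) n" "x = \<iota> n y" by (auto simp: X)
    show "str X m (act (tot X) m n \<theta> x) = act C m n \<theta> (str X n x)"
      using y sset_act[OF Ys \<theta> y(1)] smaps_nat[OF Ym \<theta> y(1)] by (simp add: X v)
  qed (auto simp: X v smaps_in[OF Ym])
  show thesis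
  proof (rule that)
    show "slice_over C X" using Xs Xm by (simp add: slice_over_def)
    show "\<phi> \<in> slice_maps Y X"
    proof (rule slice_mapsI[OF _ Ym])
      show "\<phi> \<in> smaps (tot Y) (tot X)" by (rule smapsI) (auto simp: \<phi>_def X v sset_act[OF Ys])
    qed (auto simp: \<phi>_def X v)
    show "\<psi> \<in> slice_maps X Y"
    proof (rule slice_mapsI[OF _ Xm])
      show "\<psi> \<in> smaps (tot X) (tot Y)"
      proof (rule smapsI)
        fix m n \<theta> x assume \<theta>: "\<theta> \<in> deltas m n" and "x \<in> spx (tot X) n"
        then obtain y where y: "y \<in> spx (tot Y) n" "x = \<iota> n y" by (auto simp: X)
        show "\<psi> m (act (tot X) m n \<theta> x) = act (tot Y) m n \<theta> (\<psi> n x)"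
          using y sset_act[OF Ys \<theta> y(1)] by (simp add: \<psi>_def X v)
      qed (auto simp: \<psi>_def X v)
    qed (auto simp: \<psi>_def X v)
    show "\<And>n y. y \<in> spx (tot Y) n \<Longrightarrow> \<psi> n (\<phi> n y) = y" by (simp add: \<phi>_def \<psi>_def v)
    show "\<And>n x. x \<in> spx (tot X) n \<Longrightarrow> \<phi> n (\<psi> n x) = x" by (auto simp: \<phi>_def \<psi>_def X v)
  qed
qed

text \<open>\<open>F_sub\<close> and \<open>F_sub_le\<close> ask that subobjects go to subobjects
  literally and not just up to isomorphism; this permits a chain of sets of simplices inside the
  initial algebra. Source and target bases are separate parameters so that
  \<open>P\<^sub>\<pi>\<close> and \<open>\<Phi>\<close> can be assembled from their
  factors.\<close>

locale slice_functor =
  fixes C :: "'c sset" and D :: "'d sset" and F :: "('v, 'c) slice \<Rightarrow> ('f, 'd) slice"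
    and Fm :: "('v, 'c) slice \<Rightarrow> ('v, 'v) smap \<Rightarrow> ('f, 'f) smap"
  assumes D: "sset D"
    and F_over: "slice_over C X \<Longrightarrow> slice_over D (F X)"
    and Fm_maps: "slice_over C X \<Longrightarrow> slice_over C Y \<Longrightarrow> h \<in> slice_maps X Y \<Longrightarrow> Fm X h \<in> slice_maps (F X) (F Y)"
    and Fm_comp: "slice_over C X \<Longrightarrow> slice_over C Y \<Longrightarrow> slice_over C Z \<Longrightarrow> h \<in> slice_maps X Y \<Longrightarrow> g \<in> slice_maps Y Z \<Longrightarrow>
      Fm X (scomp (tot X) g h) = scomp (tot (F X)) (Fm Y g) (Fm X h)"
    and Fm_id: "slice_over C X \<Longrightarrow> Fm X (sid (tot X)) = sid (tot (F X))"
    and F_sub: "slice_over C X \<Longrightarrow> subcomplex (tot X) S \<Longrightarrow> F (sub_slice X S) = sub_slice (F X) (spx (tot (F (sub_slice X S))))"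
    and F_sub_le: "slice_over C X \<Longrightarrow> subcomplex (tot X) S \<Longrightarrow> spx (tot (F (sub_slice X S))) n \<subseteq> spx (tot (F X)) n"
    and F_kan: "slice_over C X \<Longrightarrow> kan_fibration (tot X) C (str X) \<Longrightarrow> kan_fibration (tot (F X)) D (str (F X))"
begin

lemma F_subcomplex:
  assumes X: "slice_over C X" and S: "subcomplex (tot X) S"
  shows "subcomplex (tot (F X)) (spx (tot (F (sub_slice X S))))"
proof -
  have "sset (tot (F (sub_slice X S)))" by (rule slice_overD(1)[OF F_over[OF slice_over_sub_slice[OF X S]]])
  moreover have "act (tot (F (sub_slice X S))) = act (tot (F X))" by (subst F_sub[OF X S]) simp
  ultimately show ?thesis using F_sub_le[OF X S] by (auto simp: subcomplex_def dest: sset_act)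
qed

end

locale initial_slice = slice_functor C C F Fm
  for C :: "'c sset" and F :: "('v, 'c) slice \<Rightarrow> ('f, 'c) slice" and Fm +
  fixes B \<beta>
  assumes initial: "initial_slice_algebra C F Fm B \<beta>"
begin

lemma B: "slice_over C B" and \<beta>: "\<beta> \<in> slice_maps (F B) B"
  using initial by (auto simp: initial_slice_algebra_def)

lemma endo_id:
  assumes h: "h \<in> slice_maps B B"
    and alg: "\<And>n x. x \<in> spx (tot (F B)) n \<Longrightarrow> h n (\<beta> n x) = \<beta> n (Fm B h n x)"
  shows "h = sid (tot B)"
proof -
  have "\<exists>!h. h \<in> slice_maps B B \<and> scomp (tot (F B)) h \<beta> = scomp (tot (F B)) \<beta> (Fm B h)"
    using initial B \<beta> unfolding initial_slice_algebra_def by blast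
  moreover have "scomp (tot (F B)) h \<beta> = scomp (tot (F B)) \<beta> (Fm B h)"
    using alg by (auto simp: scomp_def compose_def restrict_def fun_eq_iff)
  moreover have "scomp (tot (F B)) (sid (tot B)) \<beta> = scomp (tot (F B)) \<beta> (Fm B (sid (tot B)))"
    using Fm_id[OF B] smaps_in[OF slice_maps_smaps[OF \<beta>]]
    by (auto simp: scomp_def compose_def restrict_def fun_eq_iff)
  ultimately show ?thesis using h slice_maps_sid[OF B] by blast
qed

text \<open>The induction principle of the initial algebra. If \<open>S\<close> is closed under
  \<beta>, initiality gives a map from \<open>B\<close> to \<open>S\<close>; followed by the
  inclusion it is an endomorphism of algebras, hence the identity, and its values lie in
  \<open>S\<close>.\<close>

lemma no_proper_subalgebra:
  assumes S: "subcomplex (tot B) S"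
    and closed: "\<And>n x. x \<in> spx (tot (F (sub_slice B S))) n \<Longrightarrow> \<beta> n x \<in> S n"
  shows "S = spx (tot B)"
proof -
  let ?X = "sub_slice B S"
  have X: "slice_over C ?X" by (rule slice_over_sub_slice[OF B S])
  note T = F_subcomplex[OF B S]
  define \<beta>' where "\<beta>' = (\<lambda>n. restrict (\<beta> n) (spx (tot (F ?X)) n))"
  have "\<beta>' \<in> slice_maps (sub_slice (F B) (spx (tot (F ?X)))) B"
    unfolding \<beta>'_def by (rule slice_maps_restrict[OF \<beta> T F_over[OF B]])
  then have "\<beta>' \<in> slice_maps (F ?X) B" by (simp add: F_sub[OF B S, symmetric])
  then have "\<beta>' \<in> slice_maps (F ?X) ?X"
    by (rule slice_maps_sub_sliceI[OF _ _ F_over[OF X]]) (simp add: \<beta>'_def closed)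
  then obtain h where h: "h \<in> slice_maps B ?X" and eq: "scomp (tot (F B)) h \<beta> = scomp (tot (F B)) \<beta>' (Fm B h)"
    using initial X unfolding initial_slice_algebra_def by blast
  have hB: "h \<in> slice_maps B B" by (rule slice_maps_sub_sliceD[OF h S B])
  \<comment> \<open>\<open>Fm B h\<close> takes only the domain \<open>B\<close> and the function
    \<open>h\<close>, so it is the same map whether \<open>h\<close> is regarded as landing in
    \<open>S\<close> or in \<open>B\<close>.\<close>
  have "h n (\<beta> n x) = \<beta> n (Fm B h n x)" if x: "x \<in> spx (tot (F B)) n" for n x
    using fun_cong[OF fun_cong[OF eq, of n], of x] x smaps_in[OF slice_maps_smaps[OF Fm_maps[OF B X h]] x]
    by (simp add: \<beta>'_def)
  then have "h = sid (tot B)" by (rule endo_id[OF hB])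
  moreover have "h n x \<in> S n" if "x \<in> spx (tot B) n" for n x
    using smaps_in[OF slice_maps_smaps[OF h] that] by simp
  ultimately show ?thesis using subcomplexD(1)[OF S] by (force simp: fun_eq_iff)
qed

text \<open>Lambek's lemma, for an algebra \<open>F B\<close> that is only isomorphic to a slice object in the universe.\<close>

lemma lambek:
  assumes inj: "\<And>n. inj_on (\<iota> n :: 'f \<Rightarrow> 'v) (spx (tot (F B)) n)"
  obtains \<gamma> where "\<gamma> \<in> slice_maps B (F B)"
    "\<And>n x. x \<in> spx (tot (F B)) n \<Longrightarrow> \<gamma> n (\<beta> n x) = x" "\<And>n x. x \<in> spx (tot B) n \<Longrightarrow> \<beta> n (\<gamma> n x) = x"
proof -
  have FB: "slice_over C (F B)" by (rule F_over[OF B])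
  obtain X :: "('v, 'c) slice" and \<phi> \<psi> where X: "slice_over C X" and \<phi>: "\<phi> \<in> slice_maps (F B) X"
    and \<psi>: "\<psi> \<in> slice_maps X (F B)" and inv: "\<And>n y. y \<in> spx (tot (F B)) n \<Longrightarrow> \<psi> n (\<phi> n y) = y"
    by (rule transport_slice[OF FB, of \<iota>]) (use inj in auto)
  have FX: "slice_over C (F X)" by (rule F_over[OF X])
  \<comment> \<open>\<open>X\<close> is the copy of \<open>F B\<close> in the universe and
    \<open>k\<close> is \<beta> on that copy. The algebra structure put on \<open>X\<close>
    corresponds to the familiar one on \<open>F B\<close> given by \<open>F\<close> of \<beta>, and
    the initial map into \<open>X\<close> followed by \<psi> is the inverse of \<beta>.\<close>
  define k where "k = scomp (tot X) \<beta> \<psi>"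
  have k: "k \<in> slice_maps X B" unfolding k_def by (rule slice_maps_comp[OF X \<psi> \<beta>])
  have Fk: "Fm X k \<in> slice_maps (F X) (F B)" by (rule Fm_maps[OF X B k])
  have "scomp (tot (F X)) \<phi> (Fm X k) \<in> slice_maps (F X) X" by (rule slice_maps_comp[OF FX Fk \<phi>])
  then obtain h where h: "h \<in> slice_maps B X"
    and eq: "scomp (tot (F B)) h \<beta> = scomp (tot (F B)) (scomp (tot (F X)) \<phi> (Fm X k)) (Fm B h)"
    using initial X unfolding initial_slice_algebra_def by blast
  have kh: "scomp (tot B) k h \<in> slice_maps B B" by (rule slice_maps_comp[OF B h k])
  define \<gamma> where "\<gamma> = scomp (tot B) \<psi> h"
  have \<gamma>: "\<gamma> \<in> slice_maps B (F B)" unfolding \<gamma>_def by (rule slice_maps_comp[OF B h \<psi>])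
  note \<beta>_in = smaps_in[OF slice_maps_smaps[OF \<beta>]] and h_in = smaps_in[OF slice_maps_smaps[OF h]]
  have \<gamma>\<beta>: "\<gamma> n (\<beta> n x) = Fm B (scomp (tot B) k h) n x" if x: "x \<in> spx (tot (F B)) n" for n x
  proof -
    have Fh: "Fm B h n x \<in> spx (tot (F X)) n" by (rule smaps_in[OF slice_maps_smaps[OF Fm_maps[OF B X h]] x])
    have "h n (\<beta> n x) = \<phi> n (Fm X k n (Fm B h n x))"
      using fun_cong[OF fun_cong[OF eq, of n], of x] x Fh by simp
    then have "\<gamma> n (\<beta> n x) = Fm X k n (Fm B h n x)"
      using \<beta>_in[OF x] inv[OF smaps_in[OF slice_maps_smaps[OF Fk] Fh]] by (simp add: \<gamma>_def)
    then show ?thesis using x Fm_comp[OF B X B h k] by simp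
  qed
  have \<beta>\<gamma>: "\<beta> n (\<gamma> n x) = scomp (tot B) k h n x" if "x \<in> spx (tot B) n" for n x
    using that h_in[OF that] by (simp add: \<gamma>_def k_def)
  have "scomp (tot B) k h = sid (tot B)"
  proof (rule endo_id[OF kh])
    fix n x assume x: "x \<in> spx (tot (F B)) n"
    show "scomp (tot B) k h n (\<beta> n x) = \<beta> n (Fm B (scomp (tot B) k h) n x)"
      using \<beta>\<gamma>[OF \<beta>_in[OF x]] \<gamma>\<beta>[OF x] by simp
  qed
  then show thesis using that[OF \<gamma>] \<gamma>\<beta> \<beta>\<gamma> Fm_id[OF B] by simp
qed

text \<open>\<open>B\<close> is the union of a transfinite chain of subobjects, obtained by iterating \<open>F\<close> from the empty
  one. A horn in the union of a chain factors through a member of the chain.\<close>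

theorem initial_kan_fibration:
  assumes inj: "\<And>n. inj_on (\<iota> n :: 'f \<Rightarrow> 'v) (spx (tot (F B)) n)"
  shows "kan_fibration (tot B) C (str B)"
proof -
  note Bs = slice_overD(1)[OF B]
  obtain \<gamma> where \<gamma>: "\<gamma> \<in> slice_maps B (F B)" and \<gamma>\<beta>: "\<And>n x. x \<in> spx (tot (F B)) n \<Longrightarrow> \<gamma> n (\<beta> n x) = x"
    by (rule lambek[of \<iota>, OF inj]) (rule that)
  note \<beta>m = slice_maps_smaps[OF \<beta>]
  define FS where "FS S = spx (tot (F (sub_slice B S)))" for S
  have FS_le: "FS S n \<subseteq> FS T n" if S: "subcomplex (tot B) S" and T: "subcomplex (tot B) T" and le: "\<And>n. S n \<subseteq> T n" for S T n
  proof -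
    have "subcomplex (tot (sub_slice B T)) S" using S le by (auto simp: subcomplex_def)
    from F_sub_le[OF slice_over_sub_slice[OF B T] this] show ?thesis
      by (simp add: FS_def sub_slice_sub_slice[OF le])
  qed
  \<comment> \<open>One step of the iteration. The hull makes it defined and monotone on all
    families of sets, as the fixed point induction demands; on a subcomplex \<open>S\<close> it is
    the image of \<open>F S\<close> under \<beta>.\<close>
  define \<Psi> where "\<Psi> S n = \<beta> n ` FS (hull (tot B) S) n" for S n
  define P where "P S \<longleftrightarrow> subcomplex (tot B) S \<and> kan_fibration (tot (sub_slice B S)) C (str (sub_slice B S))" for S
  have mono: "monotone (\<le>) (\<le>) \<Psi>"
  proof (rule monotoneI)
    fix S T :: "nat \<Rightarrow> 'v set" assume "S \<le> T"
    then have "hull (tot B) S n \<subseteq> hull (tot B) T n" for n by (intro hull_mono) (auto simp: le_fun_def)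
    then show "\<Psi> S \<le> \<Psi> T"
      using FS_le[OF subcomplex_hull[OF Bs] subcomplex_hull[OF Bs], of S T]
      by (auto simp: \<Psi>_def le_fun_def intro!: image_mono)
  qed
  have \<Psi>_sub: "subcomplex (tot B) (\<Psi> S)" and \<Psi>_FS: "\<Psi> S n = \<beta> n ` FS S n" if S: "subcomplex (tot B) S" for S n
  proof -
    show eq: "\<Psi> S n = \<beta> n ` FS S n" for n by (simp add: \<Psi>_def hull_subcomplex[OF Bs S])
    have T: "subcomplex (tot (F B)) (FS S)" unfolding FS_def by (rule F_subcomplex[OF B S])
    show "subcomplex (tot B) (\<Psi> S)"
      using subcomplexD[OF T] smaps_in[OF \<beta>m] smaps_nat[OF \<beta>m, symmetric] by (auto simp: subcomplex_def eq)
  qed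
  \<comment> \<open>\<beta> and its inverse \<gamma> restrict to an isomorphism over the base
    between \<open>F S\<close> and \<open>\<Psi> S\<close>. So \<open>\<Psi> S\<close> inherits the
    fibration property from \<open>F S\<close> as a retract.\<close>
  have step: "P (\<Psi> S)" if "P S" for S
  proof -
    have S: "subcomplex (tot B) S" and kan: "kan_fibration (tot (sub_slice B S)) C (str (sub_slice B S))"
      using that by (auto simp: P_def)
    note XS = slice_over_sub_slice[OF B S] and XT = slice_over_sub_slice[OF B \<Psi>_sub[OF S]]
    have T: "subcomplex (tot (F B)) (FS S)" unfolding FS_def by (rule F_subcomplex[OF B S])
    have FX: "F (sub_slice B S) = sub_slice (F B) (FS S)" unfolding FS_def by (rule F_sub[OF B S])
    have FX_over: "slice_over C (sub_slice (F B) (FS S))" using F_over[OF XS] by (simp add: FX)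
    define r where "r n = restrict (\<beta> n) (FS S n)" for n
    define i where "i n = restrict (\<gamma> n) (\<Psi> S n)" for n
    have r: "r \<in> slice_maps (sub_slice (F B) (FS S)) (sub_slice B (\<Psi> S))"
      using slice_maps_restrict[OF \<beta> T F_over[OF B]] unfolding r_def
      by (rule slice_maps_sub_sliceI[OF _ _ FX_over]) (auto simp: \<Psi>_FS[OF S])
    have i: "i \<in> slice_maps (sub_slice B (\<Psi> S)) (sub_slice (F B) (FS S))"
      using slice_maps_restrict[OF \<gamma> \<Psi>_sub[OF S] B] unfolding i_def
      by (rule slice_maps_sub_sliceI[OF _ _ XT]) (auto simp: \<Psi>_FS[OF S] \<gamma>\<beta> subcomplexD(1)[OF T])
    have "kan_fibration (tot (sub_slice B (\<Psi> S))) C (str (sub_slice B (\<Psi> S)))"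
    proof (rule kan_fibration_retract)
      show "kan_fibration (tot (sub_slice (F B) (FS S))) C (str (sub_slice (F B) (FS S)))"
        using F_kan[OF XS kan] by (simp add: FX)
      show "sset (tot (sub_slice B (\<Psi> S)))" "str (sub_slice B (\<Psi> S)) \<in> smaps (tot (sub_slice B (\<Psi> S))) C"
        by (rule slice_overD[OF XT])+
      show "i \<in> smaps (tot (sub_slice B (\<Psi> S))) (tot (sub_slice (F B) (FS S)))" by (rule slice_maps_smaps[OF i])
      show "r \<in> smaps (tot (sub_slice (F B) (FS S))) (tot (sub_slice B (\<Psi> S)))" by (rule slice_maps_smaps[OF r])
      show "r n (i n x) = x" if "x \<in> spx (tot (sub_slice B (\<Psi> S))) n" for n x
        using that by (auto simp: r_def i_def \<Psi>_FS[OF S] \<gamma>\<beta> subcomplexD(1)[OF T])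
      show "str (sub_slice (F B) (FS S)) n (i n x) = str (sub_slice B (\<Psi> S)) n x"
        if "x \<in> spx (tot (sub_slice B (\<Psi> S))) n" for n x by (rule slice_mapsD[OF i that])
      show "str (sub_slice B (\<Psi> S)) n (r n x) = str (sub_slice (F B) (FS S)) n x"
        if "x \<in> spx (tot (sub_slice (F B) (FS S))) n" for n x by (rule slice_mapsD[OF r that])
    qed
    then show ?thesis using \<Psi>_sub[OF S] by (simp add: P_def)
  qed
  have bot: "P (Sup {})"
  proof -
    have S: "subcomplex (tot B) (\<lambda>n. {})" by (simp add: subcomplex_def)
    have "kan_fibration (tot (sub_slice B (\<lambda>n. {}))) C (str (sub_slice B (\<lambda>n. {})))"
    proof (rule kan_fibrationI[OF slice_overD(1)[OF slice_over_sub_slice[OF B S]] D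
          slice_overD(2)[OF slice_over_sub_slice[OF B S]]], goal_cases)
      case (1 n k h y)
      \<comment> \<open>As \<open>1 \<le> n\<close>, every horn has a simplex, so no horn maps to
        the empty complex.\<close>
      have "skip n (if k < n then n else 0) \<in> spx (horn n k) n"
        by (rule skip_horn) (use 1(1,2) in auto)
      then show ?case using smaps_in[OF 1(3)] by fastforce
    qed
    then show ?thesis using S by (simp add: P_def Sup_fun_def)
  qed
  have adm: "ccpo.admissible Sup (\<le>) P"
  proof (rule ccpo.admissibleI)
    fix A :: "(nat \<Rightarrow> 'v set) set"
    assume chain: "Complete_Partial_Order.chain (\<le>) A" and ne: "A \<noteq> {}" and A: "\<forall>S\<in>A. P S"
    define T where "T n = (\<Union>S\<in>A. S n)" for n
    have T: "subcomplex (tot B) T"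
      unfolding T_def subcomplex_def
    proof (intro conjI allI ballI)
      show "(\<Union>S\<in>A. S n) \<subseteq> spx (tot B) n" for n using A by (force simp: P_def subcomplex_def)
      fix m n \<theta> x assume \<theta>: "\<theta> \<in> deltas m n" and "x \<in> (\<Union>S\<in>A. S n)"
      then obtain S where S: "S \<in> A" "x \<in> S n" by blast
      have "subcomplex (tot B) S" using A S(1) by (simp add: P_def)
      from subcomplexD(2)[OF this \<theta> S(2)] S(1) show "act (tot B) m n \<theta> x \<in> (\<Union>S\<in>A. S m)" by blast
    qed
    note XT = slice_over_sub_slice[OF B T]
    have "kan_fibration (tot (sub_slice B T)) C (str (sub_slice B T))"
    proof (rule kan_fibrationI[OF slice_overD(1)[OF XT] D slice_overD(2)[OF XT]])
      fix n k h y assume nk: "1 \<le> n" "k \<le> n" and h: "h \<in> smaps (horn n k) (tot (sub_slice B T))"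
        and y: "y \<in> spx C n"
        and hy: "\<And>m \<theta>. \<theta> \<in> spx (horn n k) m \<Longrightarrow> str (sub_slice B T) m (h m \<theta>) = act C m n \<theta> y"
      \<comment> \<open>The simplices \<open>skip n j\<close> with \<open>j\<close> in
        \<open>J\<close> generate the horn. They are finitely many, all of degree \<open>n\<close>,
        so one member of the chain contains their images and hence the whole image of the
        horn.\<close>
      define J where "J = {..n} - {k}"
      have hJ: "h n (skip n j) \<in> T n" if "j \<in> J" for j
        using smaps_in[OF h skip_horn[OF nk(1)]] that by (simp add: J_def)
      have "subset.chain UNIV ((\<lambda>S. S n) ` A)"
        using chain unfolding subset_chain_def chain_def by (auto simp: le_fun_def)
      moreover have "finite ((\<lambda>j. h n (skip n j)) ` J)" by (simp add: J_def)
      moreover have "(\<lambda>j. h n (skip n j)) ` J \<subseteq> \<Union>((\<lambda>S. S n) ` A)" using hJ by (auto simp: T_def)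
      moreover have "(\<lambda>S. S n) ` A \<noteq> {}" using ne by simp
      ultimately obtain Q where "Q \<in> (\<lambda>S. S n) ` A" "(\<lambda>j. h n (skip n j)) ` J \<subseteq> Q"
        by (metis finite_subset_Union_chain)
      then obtain S where S: "S \<in> A" "(\<lambda>j. h n (skip n j)) ` J \<subseteq> S n" by blast
      have SS: "subcomplex (tot B) S" and kan: "kan_fibration (tot (sub_slice B S)) C (str (sub_slice B S))"
        using A S(1) by (auto simp: P_def)
      have ST: "S m \<subseteq> T m" for m using S(1) by (auto simp: T_def)
      have hS: "h m \<theta> \<in> S m" if \<theta>: "\<theta> \<in> spx (horn n k) m" for m \<theta>
      proof -
        obtain j where j: "j \<in> J" "j \<notin> \<theta> ` {..m}" using \<theta> by (auto simp: spx_horn J_def)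
        have "skip n j \<in> spx (horn n k) n" using j(1) by (intro skip_horn nk(1)) (auto simp: J_def)
        from smaps_horn_nat[OF h horn_deltas[OF \<theta>] this]
        have "h m \<theta> = act (tot B) m n \<theta> (h n (skip n j))"
          by (simp add: skip_compose[OF horn_deltas[OF \<theta>] j(2)])
        then show ?thesis using subcomplexD(2)[OF SS horn_deltas[OF \<theta>]] S(2) j(1) by auto
      qed
      have "h \<in> smaps (horn n k) (tot (sub_slice B S))"
      proof (rule smapsI)
        show "h m \<theta> = undefined" if "\<theta> \<notin> spx (horn n k) m" for m \<theta>
          using h that by (auto simp: smaps_def PiE_def extensional_def)
        show "h l (act (horn n k) l m \<phi> \<theta>) = act (tot (sub_slice B S)) l m \<phi> (h m \<theta>)"
          if "\<phi> \<in> deltas l m" "\<theta> \<in> spx (horn n k) m" for l m \<phi> \<theta>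
          using smaps_nat[OF h that] by simp
      qed (simp add: hS)
      moreover have "str (sub_slice B S) m (h m \<theta>) = act C m n \<theta> y" if "\<theta> \<in> spx (horn n k) m" for m \<theta>
        using hy[OF that] hS[OF that] subsetD[OF ST hS[OF that]] by simp
      ultimately obtain x where "x \<in> spx (tot (sub_slice B S)) n" "str (sub_slice B S) n x = y"
        "\<And>m \<theta>. \<theta> \<in> spx (horn n k) m \<Longrightarrow> act (tot (sub_slice B S)) m n \<theta> x = h m \<theta>"
        using kan_fibration_fill[OF kan nk _ y] by blast
      then show "\<exists>x\<in>spx (tot (sub_slice B T)) n. str (sub_slice B T) n x = y \<and>
          (\<forall>m. \<forall>\<theta>\<in>spx (horn n k) m. act (tot (sub_slice B T)) m n \<theta> x = h m \<theta>)"
        by (intro bexI[of _ x]) (auto simp: subsetD[OF ST])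
    qed
    moreover have "Sup A = T" by (auto simp: T_def fun_eq_iff)
    ultimately show "P (Sup A)" using T by (simp add: P_def)
  qed
  \<comment> \<open>Fixed point induction along the chain of iterates stands in for transfinite
    induction.\<close>
  have "P (ccpo_class.fixp \<Psi>)" by (rule fixp_induct[where P = P and f = \<Psi>]) (fact adm mono bot step)+
  moreover define S where "S = ccpo_class.fixp \<Psi>"
  ultimately have S: "subcomplex (tot B) S" and kan: "kan_fibration (tot (sub_slice B S)) C (str (sub_slice B S))"
    by (auto simp: P_def)
  have "\<Psi> S = S" using fixp_unfold[OF mono] by (simp add: S_def)
  then have "S = spx (tot B)"
    using \<Psi>_FS[OF S] by (intro no_proper_subalgebra[OF S]) (auto simp: FS_def)
  then show ?thesis using kan sub_slice_self[OF B] by simp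
qed

end

section \<open>The functors between slices\<close>

lemma sub_slice_eqI:
  assumes "act (tot Y) = act (tot X)"
    and "\<And>n x. x \<in> spx (tot Y) n \<Longrightarrow> str Y n x = str X n x"
    and "\<And>n x. x \<notin> spx (tot Y) n \<Longrightarrow> str Y n x = undefined"
  shows "(Y :: ('a, 'c) slice) = sub_slice X (spx (tot Y))"
  using assms by (cases Y; cases "tot Y") (auto simp: sub_slice_def restrict_def fun_eq_iff)

text \<open>\<open>F_sub\<close> holds for the composite since \<open>F\<close> of a subobject is
  literally a \<open>sub_slice\<close>, to which the same property of \<open>G\<close>
  applies.\<close>

lemma slice_functor_comp:
  assumes F: "slice_functor C D F Fm" and G: "slice_functor D E G Gm"
  shows "slice_functor C E (\<lambda>X. G (F X)) (\<lambda>X h. Gm (F X) (Fm X h))"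
proof -
  interpret F: slice_functor C D F Fm by (rule F)
  interpret G: slice_functor D E G Gm by (rule G)
  show ?thesis
  proof (unfold_locales, goal_cases)
    case 1 show ?case by (rule G.D)
  next
    case (2 X) then show ?case by (intro G.F_over F.F_over)
  next
    case (3 X Y h) then show ?case by (intro G.Fm_maps F.F_over F.Fm_maps)
  next
    case (4 X Y Z h g)
    then show ?case
      by (simp add: F.Fm_comp[OF 4] G.Fm_comp[OF F.F_over[OF 4(1)] F.F_over[OF 4(2)] F.F_over[OF 4(3)]
            F.Fm_maps[OF 4(1,2,4)] F.Fm_maps[OF 4(2,3,5)]])
  next
    case (5 X) then show ?case by (simp add: F.Fm_id G.Fm_id F.F_over)
  next
    case (6 X S)
    from G.F_sub[OF F.F_over[OF 6(1)] F.F_subcomplex[OF 6]] show ?case by (simp add: F.F_sub[OF 6, symmetric])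
  next
    case (7 X S n)
    from G.F_sub_le[OF F.F_over[OF 7(1)] F.F_subcomplex[OF 7]] show ?case by (simp add: F.F_sub[OF 7, symmetric])
  next
    case (8 X) then show ?case by (intro G.F_kan F.F_over F.F_kan)
  qed
qed

text \<open>The structure map of the sum is a composite with \<open>g\<close>, so \<open>g\<close>
  is asked to be a fibration: for the polynomial functor this is the Kan property of
  \<open>U\<close>, for \<open>\<Phi>\<close> that of the projection \<open>p\<close>.\<close>

lemma slice_functor_dsum:
  assumes g: "kan_fibration A C g"
  shows "slice_functor A C (dsum g) (\<lambda>X h. h)"
proof -
  note gm = kan_fibrationD(3)[OF g]
  have str: "str (dsum g X) = scomp (tot X) g (str X)" "tot (dsum g X) = tot X" for X :: "('x, 'a) slice"
    by (simp_all add: dsum_def)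
  have over: "slice_over C (dsum g X)" if "slice_over A X" for X :: "('x, 'a) slice"
    using slice_overD[OF that] scomp_smaps[OF _ gm] by (simp add: slice_over_def str)
  show ?thesis
  proof (unfold_locales, goal_cases)
    case 1 show ?case by (rule kan_fibrationD(2)[OF g])
  next
    case (2 X) then show ?case by (rule over)
  next
    case (3 X Y h)
    show ?case
    proof (rule slice_mapsI[OF _ slice_overD(2)[OF over[OF 3(1)]]])
      show "h \<in> smaps (tot (dsum g X)) (tot (dsum g Y))" using slice_maps_smaps[OF 3(3)] by (simp add: str)
      show "str (dsum g Y) n (h n x) = str (dsum g X) n x" if "x \<in> spx (tot (dsum g X)) n" for n x
        using that slice_mapsD[OF 3(3)] smaps_in[OF slice_maps_smaps[OF 3(3)]] by (simp add: str)
    qed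
  next
    case (6 X S)
    show ?case
    proof (rule sub_slice_eqI)
      show "str (dsum g (sub_slice X S)) n x = str (dsum g X) n x" if "x \<in> spx (tot (dsum g (sub_slice X S))) n" for n x
        using that subcomplexD(1)[OF 6(2)] by (simp add: str)
      show "str (dsum g (sub_slice X S)) n x = undefined" if "x \<notin> spx (tot (dsum g (sub_slice X S))) n" for n x
        using that by (simp add: str scomp_def compose_def)
    qed (simp add: str)
  next
    case (7 X S n) then show ?case by (simp add: str subcomplex_def)
  next
    case (8 X) then show ?case using kan_fibration_comp[OF 8(2) g] by (simp add: str)
  qed (simp_all add: str)
qed

lemma tot_pull: "tot (pull A f X) = pullback A (tot X) f (str X)"
  by (simp add: pull_def Let_def)

lemma slice_functor_pull:
  fixes A :: "'a sset" and C :: "'c sset"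
  assumes A: "sset A" and C: "sset C" and f: "f \<in> smaps A C"
  shows "slice_functor C A (pull A f) (pull_map A f)"
proof -
  have pm: "pull_map A f X h n (a, x) = (a, h n x)" if "(a, x) \<in> spx (tot (pull A f X)) n" for X :: "('x, 'c) slice" and h :: "('x, 'z) smap" and n a x
    using that by (simp add: pull_map_def)
  have pm_in: "(a, h n x) \<in> spx (tot (pull A f Y)) n"
    if "h \<in> slice_maps X Y" "(a, x) \<in> spx (tot (pull A f X)) n" for X :: "('x, 'c) slice" and Y :: "('y, 'c) slice" and h n a x
    using that slice_mapsD[OF that(1)] smaps_in[OF slice_maps_smaps[OF that(1)]] by (simp add: spx_pull)
  have maps: "pull_map A f X h \<in> slice_maps (pull A f X) (pull A f Y)"
    if X: "slice_over C X" and Y: "slice_over C Y" and h: "h \<in> slice_maps X Y" for X :: "('x, 'c) slice" and Y :: "('y, 'c) slice" and h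
  proof (rule slice_mapsI)
    note PX = slice_over_pull[OF A C f X]
    show "str (pull A f X) \<in> smaps (tot (pull A f X)) A" by (rule slice_overD(2)[OF PX])
    show "pull_map A f X h \<in> smaps (tot (pull A f X)) (tot (pull A f Y))"
    proof (rule smapsI)
      show "pull_map A f X h n z \<in> spx (tot (pull A f Y)) n" if "z \<in> spx (tot (pull A f X)) n" for n z
        using that pm_in[OF h] pm[of "fst z" "snd z" X n h] by (cases z) simp
      show "pull_map A f X h n z = undefined" if "z \<notin> spx (tot (pull A f X)) n" for n z
        using that by (simp add: pull_map_def)
      fix m n \<theta> z assume \<theta>: "\<theta> \<in> deltas m n" and z: "z \<in> spx (tot (pull A f X)) n"
      obtain a x where [simp]: "z = (a, x)" by (cases z)
      have x: "x \<in> spx (tot X) n" using z by (simp add: spx_pull)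
      have "(act A m n \<theta> a, act (tot X) m n \<theta> x) \<in> spx (tot (pull A f X)) m"
        using sset_act[OF slice_overD(1)[OF PX] \<theta> z] by (simp add: act_pull)
      then show "pull_map A f X h m (act (tot (pull A f X)) m n \<theta> z) = act (tot (pull A f Y)) m n \<theta> (pull_map A f X h n z)"
        using z smaps_nat[OF slice_maps_smaps[OF h] \<theta> x] by (simp add: act_pull pm)
    qed
    show "str (pull A f Y) n (pull_map A f X h n z) = str (pull A f X) n z" if "z \<in> spx (tot (pull A f X)) n" for n z
      using that pm_in[OF h] pm[of "fst z" "snd z" X n h] by (cases z) (simp add: str_pull)
  qed
  show ?thesis
  proof (unfold_locales, goal_cases)
    case 1 show ?case by (rule A)
  next
    case (2 X) then show ?case by (rule slice_over_pull[OF A C f])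
  next
    case (3 X Y h) then show ?case by (rule maps)
  next
    case (4 X Y Z h g)
    note PX = slice_over_pull[OF A C f 4(1)]
    show ?case
    proof (rule smaps_eqI)
      show "pull_map A f X (scomp (tot X) g h) \<in> smaps (tot (pull A f X)) (tot (pull A f Z))"
        by (rule slice_maps_smaps[OF maps[OF 4(1,3) slice_maps_comp[OF 4(1,4,5)]]])
      show "scomp (tot (pull A f X)) (pull_map A f Y g) (pull_map A f X h) \<in> smaps (tot (pull A f X)) (tot (pull A f Z))"
        by (rule scomp_smaps[OF slice_maps_smaps[OF maps[OF 4(1,2,4)]] slice_maps_smaps[OF maps[OF 4(2,3,5)]] slice_overD(1)[OF PX]])
      fix n z assume z: "z \<in> spx (tot (pull A f X)) n"
      obtain a x where [simp]: "z = (a, x)" by (cases z)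
      have "x \<in> spx (tot X) n" using z by (simp add: spx_pull)
      then show "pull_map A f X (scomp (tot X) g h) n z = scomp (tot (pull A f X)) (pull_map A f Y g) (pull_map A f X h) n z"
        using z pm_in[OF 4(4)] by (simp add: pm)
    qed
  next
    case (5 X)
    note PX = slice_over_pull[OF A C f 5]
    show ?case
    proof (rule smaps_eqI)
      show "pull_map A f X (sid (tot X)) \<in> smaps (tot (pull A f X)) (tot (pull A f X))"
        by (rule slice_maps_smaps[OF maps[OF 5 5 slice_maps_sid[OF 5]]])
      show "sid (tot (pull A f X)) \<in> smaps (tot (pull A f X)) (tot (pull A f X))" by (rule sid_smaps[OF slice_overD(1)[OF PX]])
      fix n z assume z: "z \<in> spx (tot (pull A f X)) n"
      obtain a x where [simp]: "z = (a, x)" by (cases z)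
      have "x \<in> spx (tot X) n" using z by (simp add: spx_pull)
      then show "pull_map A f X (sid (tot X)) n z = sid (tot (pull A f X)) n z" using z by (simp add: pm)
    qed
  next
    case (6 X S)
    show ?case
    proof (rule sub_slice_eqI)
      show "act (tot (pull A f (sub_slice X S))) = act (tot (pull A f X))"
        by (simp add: tot_pull pullback_def sprod_def)
      show "str (pull A f (sub_slice X S)) n z = str (pull A f X) n z" if "z \<in> spx (tot (pull A f (sub_slice X S))) n" for n z
      proof -
        have "z \<in> spx (tot (pull A f X)) n" using that subcomplexD(1)[OF 6(2)] by (cases z) (simp add: spx_pull)
        then show ?thesis using that by (simp add: str_pull)
      qed
      show "str (pull A f (sub_slice X S)) n z = undefined" if "z \<notin> spx (tot (pull A f (sub_slice X S))) n" for n z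
        using that by (simp add: pull_def Let_def sfst_def)
    qed
  next
    case (7 X S n)
    then show ?case using subcomplexD(1)[OF 7(2)] by (auto simp: spx_pull)
  next
    case (8 X)
    then show ?case using kan_fibration_sfst[OF A f 8(2)] by (simp add: pull_def Let_def)
  qed
qed

lemma slice_over_fib_slice:
  assumes "sset A" "sset B" "f \<in> smaps A B" "b \<in> spx B n"
  shows "slice_over A (fib_slice A B f n b)"
  using sset_fib[OF assms] ssnd_pullback[OF sset_std_simplex assms(1) yoneda_smaps[OF assms(2,4)] assms(3)]
  by (simp add: slice_over_def fib_slice_def fib_def)

text \<open>Maps are extensional functions without a recorded codomain, so a section with values in
  a subobject is literally a section of the whole object; this gives \<open>F_sub\<close> and
  \<open>F_sub_le\<close>.\<close>

lemma slice_functor_dprod: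
  assumes f: "kan_fibration A B f"
  shows "slice_functor A B (dprod A B f) (dprod_map A B f)"
proof -
  note A = kan_fibrationD(1)[OF f] and B = kan_fibrationD(2)[OF f] and fm = kan_fibrationD(3)[OF f]
  note over = slice_over_dprod[OF A B fm]
  have tot: "tot (dprod A B f Y) = dprod_tot A B f Y" for Y :: "('y, 'a) slice" by (simp add: dprod_def)
  have str: "str (dprod A B f Y) n x = fst x" if "x \<in> spx (dprod_tot A B f Y) n" for Y :: "('y, 'a) slice" and n x
    using that by (simp add: dprod_def sfst_def)
  have dm: "dprod_map A B f Y h n (b, s) = (b, scomp (fib A B f n b) h s)" if "(b, s) \<in> spx (dprod_tot A B f Y) n"
    for Y :: "('y, 'a) slice" and h :: "('y, 'z) smap" and n b s
    using that by (simp add: dprod_map_def)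
  have dm_in: "(b, scomp (fib A B f n b) h s) \<in> spx (dprod_tot A B f Z) n"
    if h: "h \<in> slice_maps Y Z" and x: "(b, s) \<in> spx (dprod_tot A B f Y) n"
    for Y :: "('y, 'a) slice" and Z :: "('z, 'a) slice" and h n b s
  proof -
    have b: "b \<in> spx B n" and s: "s \<in> smaps (fib A B f n b) (tot Y)"
      and sY: "\<And>m \<theta> a. (\<theta>, a) \<in> spx (fib A B f n b) m \<Longrightarrow> str Y m (s m (\<theta>, a)) = a"
      using x by (auto simp: spx_dprod slice_maps_fib)
    have "scomp (fib A B f n b) h s \<in> smaps (fib A B f n b) (tot Z)"
      by (rule scomp_smaps[OF s slice_maps_smaps[OF h] sset_fib[OF A B fm b]])
    then show ?thesis using b sY slice_mapsD[OF h smaps_in[OF s]] by (simp add: spx_dprod slice_maps_fib)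
  qed
  have maps: "dprod_map A B f Y h \<in> slice_maps (dprod A B f Y) (dprod A B f Z)"
    if h: "h \<in> slice_maps Y Z" for Y :: "('y, 'a) slice" and Z :: "('z, 'a) slice" and h
  proof (rule slice_mapsI)
    show "str (dprod A B f Y) \<in> smaps (tot (dprod A B f Y)) B" by (rule slice_overD(2)[OF over])
    show "dprod_map A B f Y h \<in> smaps (tot (dprod A B f Y)) (tot (dprod A B f Z))"
      unfolding tot
    proof (rule smapsI)
      show "dprod_map A B f Y h n z \<in> spx (dprod_tot A B f Z) n" if "z \<in> spx (dprod_tot A B f Y) n" for n z
        using that dm_in[OF h] dm[of "fst z" "snd z" Y n h] by (cases z) simp
      show "dprod_map A B f Y h n z = undefined" if "z \<notin> spx (dprod_tot A B f Y) n" for n z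
        using that by (simp add: dprod_map_def)
      fix m n \<phi> z assume \<phi>: "\<phi> \<in> deltas m n" and z: "z \<in> spx (dprod_tot A B f Y) n"
      obtain b s where [simp]: "z = (b, s)" by (cases z)
      have b: "b \<in> spx B n" using z by (simp add: spx_dprod)
      let ?b = "act B m n \<phi> b"
      let ?s = "\<lambda>k. \<lambda>(\<theta>, a)\<in>spx (fib A B f m ?b) k. s k (compose {..k} \<phi> \<theta>, a)"
      have az: "act (dprod_tot A B f Y) m n \<phi> z = (?b, ?s)" by (simp add: act_dprod)
      have "(?b, ?s) \<in> spx (dprod_tot A B f Y) m" using sset_act[OF sset_dprod_tot[OF A B fm] \<phi> z] az by simp
      then have "dprod_map A B f Y h m (act (dprod_tot A B f Y) m n \<phi> z) = (?b, scomp (fib A B f m ?b) h ?s)"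
        unfolding az by (rule dm)
      also have "\<dots> = act (dprod_tot A B f Z) m n \<phi> (b, scomp (fib A B f n b) h s)"
      proof -
        have "scomp (fib A B f m ?b) h ?s = (\<lambda>k. \<lambda>(\<theta>, a)\<in>spx (fib A B f m ?b) k. scomp (fib A B f n b) h s k (compose {..k} \<phi> \<theta>, a))"
        proof (intro ext)
          fix k z
          show "scomp (fib A B f m ?b) h ?s k z = (\<lambda>(\<theta>, a)\<in>spx (fib A B f m ?b) k. scomp (fib A B f n b) h s k (compose {..k} \<phi> \<theta>, a)) z"
          proof (cases "z \<in> spx (fib A B f m ?b) k")
            case True
            then show ?thesis using fib_shift[OF B \<phi> b, of "fst z" "snd z" A f k] by (cases z) simp
          next
            case False
            then show ?thesis by (simp add: scomp_def compose_def)
          qed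
        qed
        then show ?thesis by (simp add: act_dprod)
      qed
      also have "\<dots> = act (dprod_tot A B f Z) m n \<phi> (dprod_map A B f Y h n z)" using z dm[of b s Y n h] by simp
      finally show "dprod_map A B f Y h m (act (dprod_tot A B f Y) m n \<phi> z) = act (dprod_tot A B f Z) m n \<phi> (dprod_map A B f Y h n z)" .
    qed
    show "str (dprod A B f Z) n (dprod_map A B f Y h n z) = str (dprod A B f Y) n z" if "z \<in> spx (tot (dprod A B f Y)) n" for n z
      using that dm_in[OF h] dm[of "fst z" "snd z" Y n h] unfolding tot by (cases z) (simp add: str)
  qed
  have le: "z \<in> spx (dprod_tot A B f X) n"
    if "subcomplex (tot X) S" "z \<in> spx (dprod_tot A B f (sub_slice X S)) n" for X :: "('x, 'a) slice" and S z n
    using that slice_maps_sub_sliceD[OF _ that(1) slice_over_fib_slice[OF A B fm]] by (cases z) (simp add: spx_dprod)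
  show ?thesis
  proof (unfold_locales, goal_cases)
    case 1 show ?case by (rule B)
  next
    case (2 X) show ?case by (rule over)
  next
    case (3 X Y h) then show ?case by (intro maps)
  next
    case (4 X Y Z h g)
    show ?case
    proof (rule smaps_eqI)
      show "dprod_map A B f X (scomp (tot X) g h) \<in> smaps (tot (dprod A B f X)) (tot (dprod A B f Z))"
        by (rule slice_maps_smaps[OF maps[OF slice_maps_comp[OF 4(1,4,5)]]])
      show "scomp (tot (dprod A B f X)) (dprod_map A B f Y g) (dprod_map A B f X h) \<in> smaps (tot (dprod A B f X)) (tot (dprod A B f Z))"
        by (rule scomp_smaps[OF slice_maps_smaps[OF maps[OF 4(4)]] slice_maps_smaps[OF maps[OF 4(5)]] slice_overD(1)[OF over]])
      fix n z assume "z \<in> spx (tot (dprod A B f X)) n"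
      then have z: "z \<in> spx (dprod_tot A B f X) n" by (simp add: tot)
      obtain b s where [simp]: "z = (b, s)" by (cases z)
      have s: "s \<in> smaps (fib A B f n b) (tot X)" using z by (simp add: spx_dprod slice_maps_fib)
      have "scomp (fib A B f n b) (scomp (tot X) g h) s = scomp (fib A B f n b) g (scomp (fib A B f n b) h s)"
        using smaps_in[OF s] by (auto simp: scomp_def compose_def restrict_def fun_eq_iff)
      moreover have z': "(b, s) \<in> spx (dprod_tot A B f X) n" using z by simp
      ultimately show "dprod_map A B f X (scomp (tot X) g h) n z = scomp (tot (dprod A B f X)) (dprod_map A B f Y g) (dprod_map A B f X h) n z"
        by (simp add: tot dm[OF z'] dm[OF dm_in[OF 4(4) z']])
    qed
  next
    case (5 X)
    show ?case
    proof (rule smaps_eqI)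
      show "dprod_map A B f X (sid (tot X)) \<in> smaps (tot (dprod A B f X)) (tot (dprod A B f X))"
        by (rule slice_maps_smaps[OF maps[OF slice_maps_sid[OF 5]]])
      show "sid (tot (dprod A B f X)) \<in> smaps (tot (dprod A B f X)) (tot (dprod A B f X))" by (rule sid_smaps[OF slice_overD(1)[OF over]])
      fix n z assume "z \<in> spx (tot (dprod A B f X)) n"
      then have z: "z \<in> spx (dprod_tot A B f X) n" by (simp add: tot)
      obtain b s where [simp]: "z = (b, s)" by (cases z)
      have s: "s \<in> smaps (fib A B f n b) (tot X)" using z by (simp add: spx_dprod slice_maps_fib)
      have "scomp (fib A B f n b) (sid (tot X)) s m = s m" for m
        by (rule extensionalityI[of _ "spx (fib A B f n b) m"])
          (use s smaps_in[OF s] in \<open>auto simp: smaps_def PiE_def scomp_def compose_def\<close>)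
      then have "scomp (fib A B f n b) (sid (tot X)) s = s" by auto
      then show "dprod_map A B f X (sid (tot X)) n z = sid (tot (dprod A B f X)) n z"
        using z by (simp add: tot dm)
    qed
  next
    case (6 X S)
    note le = le[OF 6(2)]
    show ?case
    proof (rule sub_slice_eqI)
      show "act (tot (dprod A B f (sub_slice X S))) = act (tot (dprod A B f X))" by (simp add: tot dprod_tot_def)
      show "str (dprod A B f (sub_slice X S)) n z = str (dprod A B f X) n z" if "z \<in> spx (tot (dprod A B f (sub_slice X S))) n" for n z
        using that le[of z n] by (simp add: tot str)
      show "str (dprod A B f (sub_slice X S)) n z = undefined" if "z \<notin> spx (tot (dprod A B f (sub_slice X S))) n" for n z
        using that by (simp add: dprod_def sfst_def)
    qed
  next
    case (7 X S n)
    then show ?case using le[OF 7(2)] by (auto simp: tot)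
  next
    case (8 X)
    then show ?case using kan_fibration_dprod[OF f 8(2)] by (simp add: dprod_def)
  qed
qed

text \<open>The fibrewise product maps to the base by a pullback of the second structure map
  followed by the first, so fibrations are preserved.\<close>

lemma slice_functor_slice_prod:
  fixes D :: "'d sset"
  assumes F: "slice_functor C D F Fm" and G: "slice_functor C D G Gm"
  shows "slice_functor C D (\<lambda>X. slice_prod (F X) (G X)) (\<lambda>X h. slice_prod_map (F X) (G X) (Fm X h) (Gm X h))"
proof -
  interpret F: slice_functor C D F Fm by (rule F)
  interpret G: slice_functor C D G Gm by (rule G)
  have tot: "tot (slice_prod X Y) = pullback (tot X) (tot Y) (str X) (str Y)" for X :: "('x, 'd) slice" and Y :: "('y, 'd) slice"
    by (simp add: slice_prod_def Let_def)
  have str: "str (slice_prod X Y) n (x, y) = str X n x" if "(x, y) \<in> spx (tot (slice_prod X Y)) n"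
    for X :: "('x, 'd) slice" and Y :: "('y, 'd) slice" and n x y
    using that by (simp add: slice_prod_def Let_def sfst_def)
  have over: "slice_over D (slice_prod X Y)" if X: "slice_over D X" and Y: "slice_over D Y"
    for X :: "('x, 'd) slice" and Y :: "('y, 'd) slice"
  proof -
    note XY = slice_overD(1)[OF X] slice_overD(1)[OF Y] slice_overD(2)[OF X] slice_overD(2)[OF Y]
    show ?thesis
      using sset_pullback[OF XY] scomp_smaps[OF sfst_pullback[OF XY] XY(3) sset_pullback[OF XY]]
      by (simp add: slice_over_def slice_prod_def Let_def)
  qed
  have pm: "slice_prod_map X Y f g n (x, y) = (f n x, g n y)" if "(x, y) \<in> spx (tot (slice_prod X Y)) n"
    for X :: "('x, 'd) slice" and Y :: "('y, 'd) slice" and n x y and f :: "('x, 'x1) smap" and g :: "('y, 'y1) smap"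
    using that by (simp add: slice_prod_map_def)
  have pm_in: "(f n x, g n y) \<in> spx (tot (slice_prod X' Y')) n"
    if "f \<in> slice_maps X X'" "g \<in> slice_maps Y Y'" "(x, y) \<in> spx (tot (slice_prod X Y)) n"
    for X X' :: "('x, 'd) slice" and Y Y' :: "('y, 'd) slice" and f g n x y
    using that smaps_in[OF slice_maps_smaps[OF that(1)]] smaps_in[OF slice_maps_smaps[OF that(2)]]
      slice_mapsD[OF that(1)] slice_mapsD[OF that(2)] by (simp add: tot spx_pullback)
  have maps: "slice_prod_map X Y f g \<in> slice_maps (slice_prod X Y) (slice_prod X' Y')"
    if X: "slice_over D X" and Y: "slice_over D Y" and f: "f \<in> slice_maps X X'" and g: "g \<in> slice_maps Y Y'"
    for X X' :: "('x, 'd) slice" and Y Y' :: "('y, 'd) slice" and f g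
  proof (rule slice_mapsI[OF _ slice_overD(2)[OF over[OF X Y]]])
    note fm = slice_maps_smaps[OF f] and gm = slice_maps_smaps[OF g]
    show "slice_prod_map X Y f g \<in> smaps (tot (slice_prod X Y)) (tot (slice_prod X' Y'))"
    proof (rule smapsI)
      show "slice_prod_map X Y f g n z \<in> spx (tot (slice_prod X' Y')) n" if "z \<in> spx (tot (slice_prod X Y)) n" for n z
        using that pm_in[OF f g] by (cases z) (simp add: pm)
      show "slice_prod_map X Y f g n z = undefined" if "z \<notin> spx (tot (slice_prod X Y)) n" for n z
        using that by (simp add: slice_prod_map_def)
      fix m n \<theta> z assume \<theta>: "\<theta> \<in> deltas m n" and z: "z \<in> spx (tot (slice_prod X Y)) n"
      obtain x y where [simp]: "z = (x, y)" by (cases z)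
      have xy: "x \<in> spx (tot X) n" "y \<in> spx (tot Y) n" using z by (simp_all add: tot spx_pullback)
      have "(act (tot X) m n \<theta> x, act (tot Y) m n \<theta> y) \<in> spx (tot (slice_prod X Y)) m"
        using sset_act[OF slice_overD(1)[OF over[OF X Y]] \<theta> z] by (simp add: tot)
      then have "slice_prod_map X Y f g m (act (tot X) m n \<theta> x, act (tot Y) m n \<theta> y)
          = (f m (act (tot X) m n \<theta> x), g m (act (tot Y) m n \<theta> y))" by (rule pm)
      then show "slice_prod_map X Y f g m (act (tot (slice_prod X Y)) m n \<theta> z)
          = act (tot (slice_prod X' Y')) m n \<theta> (slice_prod_map X Y f g n z)"
        using z smaps_nat[OF fm \<theta> xy(1)] smaps_nat[OF gm \<theta> xy(2)] by (simp add: tot pm[unfolded tot])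
    qed
    show "str (slice_prod X' Y') n (slice_prod_map X Y f g n z) = str (slice_prod X Y) n z"
      if z: "z \<in> spx (tot (slice_prod X Y)) n" for n z
    proof -
      obtain x y where [simp]: "z = (x, y)" by (cases z)
      have x: "x \<in> spx (tot X) n" using z by (simp add: tot spx_pullback)
      have z': "(x, y) \<in> spx (tot (slice_prod X Y)) n" using z by simp
      show ?thesis using str[OF pm_in[OF f g z']] str[OF z'] slice_mapsD[OF f x] by (simp add: pm[OF z'])
    qed
  qed
  show ?thesis
  proof (unfold_locales, goal_cases)
    case 1 show ?case by (rule F.D)
  next
    case (2 X) then show ?case by (intro over F.F_over G.F_over)
  next
    case (3 X Y h) then show ?case by (intro maps F.F_over G.F_over F.Fm_maps G.Fm_maps)
  next
    case (4 X Y Z h g)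
    note FX = F.F_over[OF 4(1)] and GX = G.F_over[OF 4(1)] and FY = F.F_over[OF 4(2)] and GY = G.F_over[OF 4(2)]
      and Fh = F.Fm_maps[OF 4(1,2,4)] and Gh = G.Fm_maps[OF 4(1,2,4)]
      and Fg = F.Fm_maps[OF 4(2,3,5)] and Gg = G.Fm_maps[OF 4(2,3,5)]
    show ?case unfolding F.Fm_comp[OF 4] G.Fm_comp[OF 4]
    proof (rule smaps_eqI)
      show "slice_prod_map (F X) (G X) (scomp (tot (F X)) (Fm Y g) (Fm X h)) (scomp (tot (G X)) (Gm Y g) (Gm X h))
          \<in> smaps (tot (slice_prod (F X) (G X))) (tot (slice_prod (F Z) (G Z)))"
        by (rule slice_maps_smaps[OF maps[OF FX GX slice_maps_comp[OF FX Fh Fg] slice_maps_comp[OF GX Gh Gg]]])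
      show "scomp (tot (slice_prod (F X) (G X))) (slice_prod_map (F Y) (G Y) (Fm Y g) (Gm Y g)) (slice_prod_map (F X) (G X) (Fm X h) (Gm X h))
          \<in> smaps (tot (slice_prod (F X) (G X))) (tot (slice_prod (F Z) (G Z)))"
        by (rule scomp_smaps[OF slice_maps_smaps[OF maps[OF FX GX Fh Gh]] slice_maps_smaps[OF maps[OF FY GY Fg Gg]]
              slice_overD(1)[OF over[OF FX GX]]])
      fix n z assume z: "z \<in> spx (tot (slice_prod (F X) (G X))) n"
      obtain x y where [simp]: "z = (x, y)" by (cases z)
      have z': "(x, y) \<in> spx (tot (slice_prod (F X) (G X))) n" using z by simp
      have xy: "x \<in> spx (tot (F X)) n" "y \<in> spx (tot (G X)) n" using z by (simp_all add: tot spx_pullback)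
      show "slice_prod_map (F X) (G X) (scomp (tot (F X)) (Fm Y g) (Fm X h)) (scomp (tot (G X)) (Gm Y g) (Gm X h)) n z
          = scomp (tot (slice_prod (F X) (G X))) (slice_prod_map (F Y) (G Y) (Fm Y g) (Gm Y g)) (slice_prod_map (F X) (G X) (Fm X h) (Gm X h)) n z"
        using z' xy by (simp add: pm[OF z'] pm[OF pm_in[OF Fh Gh z']])
    qed
  next
    case (5 X)
    note FX = F.F_over[OF 5] and GX = G.F_over[OF 5]
    show ?case unfolding F.Fm_id[OF 5] G.Fm_id[OF 5]
    proof (rule smaps_eqI)
      show "slice_prod_map (F X) (G X) (sid (tot (F X))) (sid (tot (G X))) \<in> smaps (tot (slice_prod (F X) (G X))) (tot (slice_prod (F X) (G X)))"
        by (rule slice_maps_smaps[OF maps[OF FX GX slice_maps_sid[OF FX] slice_maps_sid[OF GX]]])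
      show "sid (tot (slice_prod (F X) (G X))) \<in> smaps (tot (slice_prod (F X) (G X))) (tot (slice_prod (F X) (G X)))"
        by (rule sid_smaps[OF slice_overD(1)[OF over[OF FX GX]]])
      fix n z assume z: "z \<in> spx (tot (slice_prod (F X) (G X))) n"
      obtain x y where [simp]: "z = (x, y)" by (cases z)
      have z': "(x, y) \<in> spx (tot (slice_prod (F X) (G X))) n" using z by simp
      have xy: "x \<in> spx (tot (F X)) n" "y \<in> spx (tot (G X)) n" using z by (simp_all add: tot spx_pullback)
      show "slice_prod_map (F X) (G X) (sid (tot (F X))) (sid (tot (G X))) n z = sid (tot (slice_prod (F X) (G X))) n z"
        using z' xy by (simp add: pm[OF z'])
    qed
  next
    case (6 X S)
    define S1 where "S1 = spx (tot (F (sub_slice X S)))"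
    define S2 where "S2 = spx (tot (G (sub_slice X S)))"
    have FS: "F (sub_slice X S) = sub_slice (F X) S1" unfolding S1_def by (rule F.F_sub[OF 6])
    have GS: "G (sub_slice X S) = sub_slice (G X) S2" unfolding S2_def by (rule G.F_sub[OF 6])
    have le: "S1 n \<subseteq> spx (tot (F X)) n" "S2 n \<subseteq> spx (tot (G X)) n" for n
      unfolding S1_def S2_def by (rule F.F_sub_le[OF 6] G.F_sub_le[OF 6])+
    show ?case unfolding FS GS
    proof (rule sub_slice_eqI)
      show "act (tot (slice_prod (sub_slice (F X) S1) (sub_slice (G X) S2))) = act (tot (slice_prod (F X) (G X)))"
        by (simp add: tot pullback_def sprod_def)
      show "str (slice_prod (sub_slice (F X) S1) (sub_slice (G X) S2)) n z = str (slice_prod (F X) (G X)) n z"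
        if "z \<in> spx (tot (slice_prod (sub_slice (F X) S1) (sub_slice (G X) S2))) n" for n z
      proof -
        obtain x y where [simp]: "z = (x, y)" by (cases z)
        have xy: "x \<in> S1 n" "y \<in> S2 n" "str (F X) n x = str (G X) n y" using that by (auto simp: tot spx_pullback)
        have "(x, y) \<in> spx (tot (slice_prod (F X) (G X))) n"
          using xy subsetD[OF le(1)] subsetD[OF le(2)] by (simp add: tot spx_pullback)
        then show ?thesis using that xy by (simp add: str)
      qed
      show "str (slice_prod (sub_slice (F X) S1) (sub_slice (G X) S2)) n z = undefined"
        if "z \<notin> spx (tot (slice_prod (sub_slice (F X) S1) (sub_slice (G X) S2))) n" for n z
        using that by (simp add: slice_prod_def Let_def scomp_def compose_def)
    qed
  next
    case (7 X S n)
    show ?case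
    proof
      fix z assume "z \<in> spx (tot (slice_prod (F (sub_slice X S)) (G (sub_slice X S)))) n"
      moreover obtain x y where [simp]: "z = (x, y)" by (cases z)
      ultimately have xy: "x \<in> spx (tot (F (sub_slice X S))) n" "y \<in> spx (tot (G (sub_slice X S))) n"
        "str (F (sub_slice X S)) n x = str (G (sub_slice X S)) n y" by (auto simp: tot spx_pullback)
      have "str (F (sub_slice X S)) n x = str (F X) n x" by (subst F.F_sub[OF 7]) (simp add: xy(1))
      moreover have "str (G (sub_slice X S)) n y = str (G X) n y" by (subst G.F_sub[OF 7]) (simp add: xy(2))
      ultimately have "str (F X) n x = str (G X) n y" using xy(3) by simp
      then show "z \<in> spx (tot (slice_prod (F X) (G X))) n"
        using F.F_sub_le[OF 7] G.F_sub_le[OF 7] xy by (auto simp: tot spx_pullback)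
    qed
  next
    case (8 X)
    note FX = F.F_over[OF 8(1)] and Fk = F.F_kan[OF 8] and Gk = G.F_kan[OF 8]
    show ?case
      using kan_fibration_comp[OF kan_fibration_sfst[OF slice_overD[OF FX] Gk] Fk] by (simp add: slice_prod_def Let_def)
  qed
qed

lemma slice_functor_times:
  assumes E: "sset E"
  shows "slice_functor point E (\<lambda>X. times_slice E (tot X)) (\<lambda>X h. smap_prod (tot X) E h (sid E))"
proof -
  have t: "tot (times_slice E X) = sprod X E" "str (times_slice E X) = ssnd (sprod X E)" for X :: "'x sset"
    by (simp_all add: times_slice_def)
  have over: "slice_over E (times_slice E X)" if "sset X" for X :: "'x sset"
    using sset_sprod[OF that E] ssnd_smaps[OF that E] by (simp add: slice_over_def t)
  show ?thesis
  proof (unfold_locales, goal_cases)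
    case 1 show ?case by (rule E)
  next
    case (2 X) then show ?case by (intro over slice_overD)
  next
    case (3 X Y h)
    note hm = slice_maps_smaps[OF 3(3)]
    show ?case
    proof (rule slice_mapsI[OF _ slice_overD(2)[OF over[OF slice_overD(1)[OF 3(1)]]]])
      show "smap_prod (tot X) E h (sid E) \<in> smaps (tot (times_slice E (tot X))) (tot (times_slice E (tot Y)))"
        unfolding t by (rule smap_prod_smaps[OF slice_overD(1)[OF 3(1)] E hm sid_smaps[OF E]])
      show "str (times_slice E (tot Y)) n (smap_prod (tot X) E h (sid E) n z) = str (times_slice E (tot X)) n z"
        if "z \<in> spx (tot (times_slice E (tot X))) n" for n z
        using that smaps_in[OF hm] by (cases z) (simp add: t ssnd_def)
    qed
  next
    case (4 X Y Z h g)
    have "h n x \<in> spx (tot Y) n" if "x \<in> spx (tot X) n" for n x by (rule smaps_in[OF slice_maps_smaps[OF 4(4)] that])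
    then show ?case by (auto simp: t smap_prod_def scomp_def compose_def restrict_def fun_eq_iff)
  next
    case (5 X) show ?case by (auto simp: t smap_prod_def sid_def restrict_def fun_eq_iff)
  next
    case (6 X S)
    show ?case
    proof (rule sub_slice_eqI)
      show "str (times_slice E (tot (sub_slice X S))) n z = str (times_slice E (tot X)) n z"
        if "z \<in> spx (tot (times_slice E (tot (sub_slice X S)))) n" for n z
        using that subcomplexD(1)[OF 6(2)] by (cases z) (simp add: t ssnd_def)
    qed (simp_all add: t ssnd_def, simp add: sprod_def)
  next
    case (7 X S n) then show ?case using subcomplexD(1)[OF 7(2)] by (auto simp: t)
  next
    case (8 X)
    have "str X = to_point (tot X)" by (rule unit_smap_eq)
    then have "kan_complex (tot X)" using 8(2) by (simp add: kan_complex_iff)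
    then show ?case by (rule kan_fibration_times_slice[OF _ E])
  qed
qed

section \<open>Sizes\<close>

lemma closed_universe_infinite:
  assumes "inaccessible \<kappa>" "closed_universe \<kappa> (UNIV :: 'v set)"
  shows "infinite (UNIV :: 'v set)"
proof -
  have "natLeq <o \<kappa>" "\<kappa> \<le>o |UNIV :: 'v set|" using assms by (auto simp: inaccessible_def closed_universe_def)
  then have "natLeq \<le>o |UNIV :: 'v set|" using ordLess_imp_ordLeq ordLeq_transitive by blast
  then show ?thesis using infinite_iff_natLeq_ordLeq by blast
qed

lemma stable_inaccessible:
  assumes "inaccessible \<kappa>"
  shows "stable \<kappa>"
proof -
  have c: "Card_order \<kappa>" "natLeq <o \<kappa>" "regularCard \<kappa>" using assms by (auto simp: inaccessible_def)
  have "natLeq \<le>o |Field \<kappa>|"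
    using ordLess_imp_ordLeq[OF c(2)] ordIso_symmetric[OF card_of_Field_ordIso[OF c(1)]] ordLeq_ordIso_trans by blast
  then have "infinite (Field \<kappa>)" using infinite_iff_natLeq_ordLeq by blast
  then show ?thesis using regularCard_stable[OF c(1) _ c(3)] by blast
qed

text \<open>The fibre over \<open>b\<close> has countably many degrees, with finitely many operators
  in each and a small fibre of \<open>f\<close> over each operator. Uncountability and regularity of
  \<kappa> keep the total below \<kappa>.\<close>

lemma card_fib_less:
  assumes \<kappa>: "inaccessible \<kappa>" and small: "small_fibres \<kappa> A B f" and B: "sset B" and b: "b \<in> spx B n"
  shows "|SIGMA m:(UNIV :: nat set). spx (fib A B f n b) m| <o \<kappa>"
proof (rule stable_elim[OF stable_inaccessible[OF \<kappa>]])
  have \<kappa>': "natLeq <o \<kappa>" using \<kappa> by (simp add: inaccessible_def)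
  show "|UNIV :: nat set| <o \<kappa>" by (rule ordIso_ordLess_trans[OF card_of_nat \<kappa>'])
  fix m :: nat
  have "|SIGMA \<theta>:deltas m n. {a \<in> spx A m. f m a = act B m n \<theta> b}| <o \<kappa>"
  proof (rule stable_elim[OF stable_inaccessible[OF \<kappa>]])
    have "|deltas m n| <o natLeq" using finite_deltas finite_iff_ordLess_natLeq by blast
    then show "|deltas m n| <o \<kappa>" using \<kappa>' ordLess_transitive by blast
    fix \<theta> assume "\<theta> \<in> deltas m n"
    then have "act B m n \<theta> b \<in> spx B m" by (rule sset_act[OF B _ b])
    then show "|{a \<in> spx A m. f m a = act B m n \<theta> b}| <o \<kappa>" using small by (simp add: small_fibres_def)
  qed
  moreover have "spx (fib A B f n b) m = (SIGMA \<theta>:deltas m n. {a \<in> spx A m. f m a = act B m n \<theta> b})"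
    by (auto simp: spx_fib)
  ultimately show "|spx (fib A B f n b) m| <o \<kappa>" by simp
qed

lemma card_Sigma_universe:
  assumes "infinite (UNIV :: 'v set)" "|I| \<le>o |UNIV :: 'v set|" "\<And>i. i \<in> I \<Longrightarrow> |A i| \<le>o |UNIV :: 'v set|"
  shows "|Sigma I A| \<le>o |UNIV :: 'v set|"
  using card_of_Sigma_ordLeq_infinite[OF assms(1,2)] assms(3) by blast

text \<open>A section over \<open>b\<close> is a function on fewer than \<kappa> arguments with
  values that inject into the universe, so the closure under small exponents bounds the number of
  sections; summing over \<open>b\<close> costs nothing as the universe is infinite.\<close>

lemma card_dprod_le:
  fixes A :: "'a sset" and Y :: "('y, 'a) slice"
  assumes \<kappa>: "inaccessible \<kappa>" and V: "closed_universe \<kappa> (UNIV :: 'v set)"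
    and small: "small_fibres \<kappa> A B f" and B: "sset B"
    and cB: "|spx B n| \<le>o |UNIV :: 'v set|" and cY: "\<And>m. |spx (tot Y) m| \<le>o |UNIV :: 'v set|"
  shows "|spx (dprod_tot A B f Y) n| \<le>o |UNIV :: 'v set|"
proof -
  have \<kappa>V: "\<kappa> \<le>o |UNIV :: 'v set|" using V by (simp add: closed_universe_def)
  have "\<exists>j. inj_on j (spx (tot Y) m) \<and> j ` spx (tot Y) m \<subseteq> (UNIV :: 'v set)" for m
    using cY[of m] unfolding card_of_ordLeq[symmetric] .
  then obtain j :: "nat \<Rightarrow> 'y \<Rightarrow> 'v" where j: "\<And>m. inj_on (j m) (spx (tot Y) m)" by metis
  have "|{s. s \<in> slice_maps (fib_slice A B f n b) Y}| \<le>o |UNIV :: 'v set|" if b: "b \<in> spx B n" for b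
  proof -
    let ?F = "fib A B f n b"
    define D where "D = (SIGMA m:(UNIV :: nat set). spx ?F m)"
    have D\<kappa>: "|D| <o \<kappa>" unfolding D_def by (rule card_fib_less[OF \<kappa> small B b])
    have "|D| \<le>o |UNIV :: 'v set|" using ordLess_imp_ordLeq[OF ordLess_ordLeq_trans[OF D\<kappa> \<kappa>V]] .
    then obtain d :: "nat \<times> (nat \<Rightarrow> nat) \<times> 'a \<Rightarrow> 'v" where d: "inj_on d D"
      unfolding card_of_ordLeq[symmetric] by blast
    \<comment> \<open>The closure property speaks of exponents that are sets of elements of the
      universe, so the index set \<open>D\<close> is copied into it.\<close>
    define D' where "D' = d ` D"
    have "|D'| <o \<kappa>" unfolding D'_def by (rule ordLeq_ordLess_trans[OF card_of_image D\<kappa>])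
    then have "|UNIV :: 'v set| ^c |D'| \<le>o |UNIV :: 'v set|" using V by (simp add: closed_universe_def)
    then have Func: "|Func D' (UNIV :: 'v set)| \<le>o |UNIV :: 'v set|" by (simp add: cexp_def Field_card_of)
    define \<Theta> where "\<Theta> s = (\<lambda>v. if v \<in> D' then (case inv_into D d v of (m, z) \<Rightarrow> j m (s m z)) else undefined)" for s
    have "inj_on \<Theta> {s. s \<in> slice_maps (fib_slice A B f n b) Y}"
    proof (rule inj_onI)
      fix s s' assume "s \<in> {s. s \<in> slice_maps (fib_slice A B f n b) Y}" "s' \<in> {s. s \<in> slice_maps (fib_slice A B f n b) Y}"
        and eq: "\<Theta> s = \<Theta> s'"
      then have s: "s \<in> smaps ?F (tot Y)" "s' \<in> smaps ?F (tot Y)" by (auto simp: slice_maps_fib)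
      show "s = s'"
      proof (rule smaps_eqI[OF s])
        fix m z assume z: "z \<in> spx ?F m"
        then have "(m, z) \<in> D" by (simp add: D_def)
        then have "inv_into D d (d (m, z)) = (m, z)" "d (m, z) \<in> D'" using d by (auto simp: D'_def)
        then have "j m (s m z) = j m (s' m z)" using fun_cong[OF eq, of "d (m, z)"] by (simp add: \<Theta>_def)
        then show "s m z = s' m z" by (rule inj_onD[OF j]) (rule smaps_in[OF s(1) z] smaps_in[OF s(2) z])+
      qed
    qed
    moreover have "\<Theta> ` {s. s \<in> slice_maps (fib_slice A B f n b) Y} \<subseteq> Func D' UNIV"
      by (auto simp: \<Theta>_def Func_def)
    ultimately have "|{s. s \<in> slice_maps (fib_slice A B f n b) Y}| \<le>o |Func D' (UNIV :: 'v set)|"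
      unfolding card_of_ordLeq[symmetric] by blast
    then show ?thesis using Func by (rule ordLeq_transitive)
  qed
  then have "|SIGMA b:spx B n. {s. s \<in> slice_maps (fib_slice A B f n b) Y}| \<le>o |UNIV :: 'v set|"
    by (rule card_Sigma_universe[OF closed_universe_infinite[OF \<kappa> V] cB])
  moreover have "spx (dprod_tot A B f Y) n = Sigma (spx B n) (\<lambda>b. {s. s \<in> slice_maps (fib_slice A B f n b) Y})"
    by (auto simp: spx_dprod)
  ultimately show ?thesis by simp
qed


section \<open>The W-type\<close>

definition over_point :: "'v sset \<Rightarrow> ('v, unit) slice" where
  "over_point X = \<lparr>tot = X, str = to_point X\<rparr>"

lemma slice_over_point: "slice_over point X \<longleftrightarrow> sset (tot X)"
  using to_point_smaps[of "tot X"] by (simp add: slice_over_def unit_smap_eq[of "str X" "to_point (tot X)"])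

lemma slice_maps_point: "slice_maps X Y = smaps (tot X) (tot Y)" for X :: "('a, unit) slice" and Y :: "('b, unit) slice"
  by (simp add: slice_maps_def unit_smap_eq)

text \<open>The sum along U -> 1 turns the polynomial functor into an endofunctor of the slice over
  the point, to which \<open>initial_slice\<close> applies.\<close>

definition poly_slice :: "'v sset \<Rightarrow> 'v sset \<Rightarrow> ('v, 'v) smap \<Rightarrow> ('v, unit) slice \<Rightarrow> (('v, 'v, 'v) poly, unit) slice" where
  "poly_slice E U \<pi> X = dsum (to_point U) (dprod E U \<pi> (times_slice E (tot X)))"

locale w_type =
  fixes \<kappa> :: "'k rel" and E U W :: "'v sset" and \<pi> :: "('v, 'v) smap" and \<alpha> :: "(('v, 'v, 'v) poly, 'v) smap"
  assumes inaccessible: "inaccessible \<kappa>" and universe: "closed_universe \<kappa> (UNIV :: 'v set)"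
    and kan_\<pi>: "kan_fibration E U \<pi>" and small_\<pi>: "small_fibres \<kappa> E U \<pi>" and kan_U: "kan_complex U"
    and W_type: "is_W_type E U \<pi> W \<alpha>"
begin

lemmas E = kan_fibrationD(1)[OF kan_\<pi>] and U = kan_fibrationD(2)[OF kan_\<pi>] and \<pi> = kan_fibrationD(3)[OF kan_\<pi>]

lemma tot_poly_slice: "tot (poly_slice E U \<pi> X) = poly E U \<pi> (tot X)"
  by (simp add: poly_slice_def dsum_def poly_def)

lemma poly_functor: "slice_functor point point (poly_slice E U \<pi>) (\<lambda>X. poly_map E U \<pi> (tot X))"
  using slice_functor_comp[OF slice_functor_comp[OF slice_functor_times[OF E] slice_functor_dprod[OF kan_\<pi>]]
      slice_functor_dsum[OF kan_U[unfolded kan_complex_iff]]]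
  unfolding poly_slice_def[abs_def] poly_map_def[abs_def] .

sublocale W: initial_slice point "poly_slice E U \<pi>" "\<lambda>X. poly_map E U \<pi> (tot X)" "over_point W" \<alpha>
proof (intro initial_slice.intro poly_functor initial_slice_axioms.intro)
  have W: "sset W" "\<alpha> \<in> smaps (poly E U \<pi> W) W"
    and ini: "\<And>(X :: 'v sset) \<beta>. sset X \<Longrightarrow> \<beta> \<in> smaps (poly E U \<pi> X) X \<Longrightarrow>
      \<exists>!h. h \<in> smaps W X \<and> scomp (poly E U \<pi> W) h \<alpha> = scomp (poly E U \<pi> W) \<beta> (poly_map E U \<pi> W h)"
    using W_type by (auto simp: is_W_type_def initial_algebra_def)
  show "initial_slice_algebra point (poly_slice E U \<pi>) (\<lambda>X. poly_map E U \<pi> (tot X)) (over_point W) \<alpha>"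
    unfolding initial_slice_algebra_def slice_over_point slice_maps_point tot_poly_slice
    using W ini by (simp add: over_point_def)
qed

lemma W: "sset W" and \<alpha>: "\<alpha> \<in> smaps (poly E U \<pi> W) W"
  using W_type by (auto simp: is_W_type_def initial_algebra_def)

lemma card_subset_universe: "|A :: 'v set| \<le>o |UNIV :: 'v set|"
  by (rule card_of_mono1) simp

lemma card_universe_prod: "|A \<times> B| \<le>o |UNIV :: 'v set|" if "|A| \<le>o |UNIV :: 'v set|" "|B| \<le>o |UNIV :: 'v set|"
  by (rule card_Sigma_universe[OF closed_universe_infinite[OF inaccessible universe] that(1)]) (rule that(2))

lemma poly_inj: obtains \<iota> :: "nat \<Rightarrow> ('v, 'v, 'v) poly \<Rightarrow> 'v" where "\<And>n. inj_on (\<iota> n) (spx (tot (poly_slice E U \<pi> (over_point W))) n)"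
proof -
  have "|spx (dprod_tot E U \<pi> (times_slice E W)) n| \<le>o |UNIV :: 'v set|" for n
    by (rule card_dprod_le[OF inaccessible universe small_\<pi> U card_subset_universe])
      (simp add: times_slice_def card_universe_prod card_subset_universe)
  then have "\<exists>i :: ('v, 'v, 'v) poly \<Rightarrow> 'v. inj_on i (spx (tot (poly_slice E U \<pi> (over_point W))) n)" for n
    unfolding card_of_ordLeq[symmetric] tot_poly_slice by (simp add: poly_def dprod_def over_point_def)
  then show thesis using that by metis
qed

lemma kan_W: "kan_complex W"
proof -
  obtain \<iota> :: "nat \<Rightarrow> ('v, 'v, 'v) poly \<Rightarrow> 'v" where "\<And>n. inj_on (\<iota> n) (spx (tot (poly_slice E U \<pi> (over_point W))) n)"
    using poly_inj by blast
  from W.initial_kan_fibration[OF this] show ?thesis by (simp add: kan_complex_iff over_point_def)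
qed

section \<open>Roots, branches and subtrees in the W-type\<close>

abbreviation "P \<equiv> poly E U \<pi> W"
abbreviation "uns \<equiv> unsup E U \<pi> W \<alpha>"
abbreviation "rt \<equiv> root E U \<pi> W \<alpha>"
abbreviation "V \<equiv> Wbar E U \<pi> W \<alpha>"
abbreviation "p \<equiv> ssnd V"
abbreviation "q \<equiv> subtree E U \<pi> W \<alpha>"

lemma P: "P = dprod_tot E U \<pi> (times_slice E W)"
  by (simp add: poly_def dprod_def)

text \<open>By Lambek's lemma \<alpha> is bijective in each degree with simplicial inverse, and
  \<open>inv_into\<close> can only pick that inverse.\<close>

lemma uns: "uns \<in> smaps W P" and uns_\<alpha>: "x \<in> spx P n \<Longrightarrow> uns n (\<alpha> n x) = x"
proof -
  obtain \<iota> :: "nat \<Rightarrow> ('v, 'v, 'v) poly \<Rightarrow> 'v" where \<iota>: "\<And>n. inj_on (\<iota> n) (spx (tot (poly_slice E U \<pi> (over_point W))) n)"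
    using poly_inj by blast
  obtain \<gamma> where \<gamma>: "\<gamma> \<in> smaps W P" and \<gamma>\<alpha>: "\<And>n x. x \<in> spx P n \<Longrightarrow> \<gamma> n (\<alpha> n x) = x"
    and \<alpha>\<gamma>: "\<And>n x. x \<in> spx W n \<Longrightarrow> \<alpha> n (\<gamma> n x) = x"
    using W.lambek[OF \<iota>] unfolding slice_maps_point tot_poly_slice by (auto simp: over_point_def)
  have "inv_into (spx P n) (\<alpha> n) w = \<gamma> n w" if "w \<in> spx W n" for n w
  proof (rule inv_into_f_eq)
    show "inj_on (\<alpha> n) (spx P n)" by (rule inj_on_inverseI) (rule \<gamma>\<alpha>)
    show "\<gamma> n w \<in> spx P n" by (rule smaps_in[OF \<gamma> that])
    show "\<alpha> n (\<gamma> n w) = w" by (rule \<alpha>\<gamma>[OF that])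
  qed
  moreover have "\<gamma> n w = undefined" if "w \<notin> spx W n" for n w
    using \<gamma> that by (auto simp: smaps_def PiE_def extensional_def)
  ultimately have "uns = \<gamma>" by (auto simp: unsup_def fun_eq_iff)
  then show "uns \<in> smaps W P" "x \<in> spx P n \<Longrightarrow> uns n (\<alpha> n x) = x" using \<gamma> \<gamma>\<alpha> by auto
qed

lemma uns_snd:
  assumes "w \<in> spx W n"
  shows "uns n w = (rt n w, snd (uns n w))" "rt n w \<in> spx U n"
    "snd (uns n w) \<in> smaps (fib E U \<pi> n (rt n w)) (sprod W E)"
proof -
  have "uns n w \<in> spx P n" by (rule smaps_in[OF uns assms])
  then show "uns n w = (rt n w, snd (uns n w))" "rt n w \<in> spx U n"
    "snd (uns n w) \<in> smaps (fib E U \<pi> n (rt n w)) (sprod W E)"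
    using assms by (auto simp: P spx_dprod slice_maps_fib root_def times_slice_def)
qed

lemma rt: "rt \<in> smaps W U"
proof (rule smapsI)
  fix m n \<theta> w assume \<theta>: "\<theta> \<in> deltas m n" and w: "w \<in> spx W n"
  have "uns m (act W m n \<theta> w) = act P m n \<theta> (uns n w)" by (rule smaps_nat[OF uns \<theta> w])
  also have "fst \<dots> = act U m n \<theta> (fst (uns n w))" unfolding P by (cases "uns n w") (simp add: act_dprod)
  finally show "rt m (act W m n \<theta> w) = act U m n \<theta> (rt n w)"
    using w sset_act[OF W \<theta> w] by (simp add: root_def)
qed (simp_all add: uns_snd(2), simp add: root_def)

lemma spx_V: "(e, w) \<in> spx V n \<longleftrightarrow> e \<in> spx E n \<and> w \<in> spx W n \<and> \<pi> n e = rt n w"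
  by (simp add: Wbar_def spx_pullback)

lemma act_V: "act V m n \<theta> (e, w) = (act E m n \<theta> e, act W m n \<theta> w)"
  by (simp add: Wbar_def)

lemma V: "sset V"
  unfolding Wbar_def by (rule sset_pullback[OF E W \<pi> rt])

lemma kan_p: "kan_fibration V W p"
  unfolding Wbar_def by (rule kan_fibration_ssnd[OF kan_\<pi> W rt])

lemma p_apply: "v \<in> spx V n \<Longrightarrow> p n v = snd v"
  by (simp add: ssnd_def)

lemma q_apply: "(e, w) \<in> spx V n \<Longrightarrow> q n (e, w) = fst (snd (uns n w) n (did n, e))"
  by (simp add: subtree_def)

lemma q: "q \<in> smaps V W"
proof (rule smapsI)
  have fibd: "(did n, e) \<in> spx (fib E U \<pi> n (rt n w)) n" if "(e, w) \<in> spx V n" for n e w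
    using that uns_snd(2) by (simp add: did_fib[OF U] spx_V)
  fix n v assume v: "v \<in> spx V n"
  obtain e w where [simp]: "v = (e, w)" by (cases v)
  have w: "w \<in> spx W n" using v by (simp add: spx_V)
  have "snd (uns n w) n (did n, e) \<in> spx (sprod W E) n"
    using v by (intro smaps_in[OF uns_snd(3)[OF w]] fibd) simp
  then show "q n v \<in> spx W n" using v by (simp add: q_apply mem_Times_iff)
  show "q m (act V m n \<theta> v) = act W m n \<theta> (q n v)" if \<theta>: "\<theta> \<in> deltas m n" for m \<theta>
  proof -
    have v': "(act E m n \<theta> e, act W m n \<theta> w) \<in> spx V m" using sset_act[OF V \<theta> v] by (simp add: act_V)
    have "uns m (act W m n \<theta> w) = act P m n \<theta> (uns n w)" by (rule smaps_nat[OF uns \<theta> w])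
    moreover have "act U m n \<theta> (fst (uns n w)) = rt m (act W m n \<theta> w)"
      using smaps_nat[OF rt \<theta> w] uns_snd(1)[OF w] by (metis fst_conv)
    ultimately have "snd (uns m (act W m n \<theta> w)) m (did m, act E m n \<theta> e) = snd (uns n w) m (\<theta>, act E m n \<theta> e)"
      using snd_act_dprod[OF \<theta>, of "act E m n \<theta> e" E U \<pi> "uns n w" "times_slice E W"] fibd[OF v'] by (simp add: P)
    also have "\<dots> = act (sprod W E) m n \<theta> (snd (uns n w) n (did n, e))"
      using smaps_nat[OF uns_snd(3)[OF w] \<theta> fibd[of e w n]] v \<theta> by (simp add: act_fib)
    finally show ?thesis using v v' by (simp add: q_apply act_V sprod_def case_prod_beta)
  qed
qed (auto simp: subtree_def)

text \<open>\<open>v\<close> is a subtree of some image of \<open>w\<close> under an operator and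
  not just of \<open>w\<close>. Induction over trees runs over predicates that form subcomplexes, so
  the predecessors of \<open>w\<close> must include those of its faces and degeneracies.\<close>

definition child :: "((nat \<times> 'v) \<times> nat \<times> 'v) set" where
  "child = {((m, v), n, w). w \<in> spx W n \<and> (\<exists>\<theta>\<in>deltas m n. \<exists>e.
     (e, act W m n \<theta> w) \<in> spx V m \<and> v = q m (e, act W m n \<theta> w))}"

text \<open>This is \<open>no_proper_subalgebra\<close> in relational form: the trees all of whose
  images satisfy \<open>Q\<close> form a subalgebra.\<close>

lemma wf_child: "wf child"
proof (rule wfUNIVI)
  fix Q x assume step: "\<forall>x. (\<forall>y. (y, x) \<in> child \<longrightarrow> Q y) \<longrightarrow> Q x"
  define S where "S n = {w \<in> spx W n. \<forall>m. \<forall>\<theta>\<in>deltas m n. Q (m, act W m n \<theta> w)}" for n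
  have Q: "Q (n, w)" if "w \<in> S n" for n w
    using that did_deltas[of n] sset_id[OF W] unfolding S_def by fastforce
  have S_act: "act W m n \<theta> w \<in> S m" if \<theta>: "\<theta> \<in> deltas m n" and w: "w \<in> S n" for m n \<theta> w
  proof -
    have "Q (l, act W l m \<phi> (act W m n \<theta> w))" if \<phi>: "\<phi> \<in> deltas l m" for l \<phi>
      using w compose_deltas[OF \<theta> \<phi>] sset_comp[OF W \<phi> \<theta>, of w] unfolding S_def by force
    then show ?thesis using w sset_act[OF W \<theta>] by (simp add: S_def)
  qed
  have sub: "subcomplex (tot (over_point W)) S"
    unfolding subcomplex_def over_point_def using S_act by (auto simp: S_def)
  let ?PS = "dprod_tot E U \<pi> (times_slice E (tot (sub_slice (over_point W) S)))"
  have PS_sub: "x \<in> spx P n" if "x \<in> spx ?PS n" for x n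
    using subsetD[OF W.F_sub_le[OF W.B sub], of x n] that unfolding tot_poly_slice
    by (simp add: poly_def dprod_def over_point_def)
  have PS_act: "act ?PS m n \<theta> x = act P m n \<theta> x" for m n \<theta> x unfolding P by (simp add: dprod_tot_def)
  have "S = spx (tot (over_point W))"
  proof (rule W.no_proper_subalgebra[OF sub])
    fix n x assume "x \<in> spx (tot (poly_slice E U \<pi> (sub_slice (over_point W) S))) n"
    then have x: "x \<in> spx ?PS n" by (simp add: tot_poly_slice poly_def dprod_def)
    note xP = PS_sub[OF x]
    define w where "w = \<alpha> n x"
    have w: "w \<in> spx W n" unfolding w_def by (rule smaps_in[OF \<alpha> xP])
    have "Q (m, act W m n \<theta> w)" if \<theta>: "\<theta> \<in> deltas m n" for m \<theta>
    proof (rule step[rule_format])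
      fix y assume "(y, m, act W m n \<theta> w) \<in> child"
      then obtain l \<phi> e where \<phi>: "\<phi> \<in> deltas l m" and e: "(e, act W l m \<phi> (act W m n \<theta> w)) \<in> spx V l"
        and y: "y = (l, q l (e, act W l m \<phi> (act W m n \<theta> w)))" by (auto simp: child_def)
      define \<psi> where "\<psi> = compose {..l} \<theta> \<phi>"
      have \<psi>: "\<psi> \<in> deltas l n" unfolding \<psi>_def by (rule compose_deltas[OF \<theta> \<phi>])
      have w': "act W l m \<phi> (act W m n \<theta> w) = act W l n \<psi> w" by (simp add: \<psi>_def sset_comp[OF W \<phi> \<theta> w])
      \<comment> \<open>\<open>x\<close> has its subtrees in \<open>S\<close>, and so has its
        restriction \<open>x'\<close>, which unfolds the image of \<open>w\<close> under \<psi>; the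
        child considered is one of these subtrees.\<close>
      define x' where "x' = act ?PS l n \<psi> x"
      have x': "x' \<in> spx ?PS l" unfolding x'_def by (rule sset_act[OF sset_dprod_tot[OF E U \<pi>] \<psi> x])
      have "uns l (act W l n \<psi> w) = x'"
        using smaps_nat[OF uns \<psi> w] uns_\<alpha>[OF xP] by (simp add: w_def x'_def PS_act)
      moreover have e': "(e, act W l n \<psi> w) \<in> spx V l" using e w' by simp
      ultimately have qx: "q l (e, act W l n \<psi> w) = fst (snd x' l (did l, e))" and r: "rt l (act W l n \<psi> w) = fst x'"
        using sset_act[OF W \<psi> w] by (simp_all add: q_apply root_def)
      have "fst x' \<in> spx U l" "snd x' \<in> smaps (fib E U \<pi> l (fst x')) (sprod (tot (sub_slice (over_point W) S)) E)"
        using x' by (auto simp: spx_dprod slice_maps_fib times_slice_def)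
      moreover from this(1) have "(did l, e) \<in> spx (fib E U \<pi> l (fst x')) l"
        using e' r by (simp add: did_fib[OF U] spx_V)
      ultimately have "snd x' l (did l, e) \<in> S l \<times> spx E l" using smaps_in by fastforce
      then show "Q y" using Q qx by (simp add: y w' mem_Times_iff)
    qed
    then show "\<alpha> n x \<in> S n" using w by (simp add: S_def w_def)
  qed
  then have "S n = spx W n" for n by (simp add: over_point_def)
  \<comment> \<open>Elements that are not simplices of \<open>W\<close> have no
    predecessors.\<close>
  moreover have "Q (n, w)" if "w \<notin> spx W n" for n w using step that by (auto simp: child_def)
  ultimately show "Q x" using Q by (cases x) blast
qed

end

section \<open>Simplices of dependent products given by formulas\<close>

lemma fib_deltas: "(\<theta>, a) \<in> spx (fib A B f n b) k \<Longrightarrow> \<theta> \<in> deltas k n"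
  by (simp add: spx_fib)

text \<open>Serves the recursive construction of simplices of \<Pi>: the section is a formula
  \<open>g\<close> in the operator and the point, and naturality is checked only on the
  fibre.\<close>

lemma dprod_elem:
  assumes A: "sset A" and B: "sset B" and f: "f \<in> smaps A B" and b: "b \<in> spx B n"
    and g: "\<And>k \<theta> a. (\<theta>, a) \<in> spx (fib A B f n b) k \<Longrightarrow> g k \<theta> a \<in> spx (tot Y) k \<and> str Y k (g k \<theta> a) = a"
    and nat: "\<And>l k \<phi> \<theta> a. \<phi> \<in> deltas l k \<Longrightarrow> (\<theta>, a) \<in> spx (fib A B f n b) k \<Longrightarrow>
      g l (compose {..l} \<theta> \<phi>) (act A l k \<phi> a) = act (tot Y) l k \<phi> (g k \<theta> a)"
  shows "(b, \<lambda>k. \<lambda>(\<theta>, a)\<in>spx (fib A B f n b) k. g k \<theta> a) \<in> spx (dprod_tot A B f Y) n"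
proof -
  let ?F = "fib A B f n b"
  have F: "sset ?F" by (rule sset_fib[OF A B f b])
  have "(\<lambda>k. \<lambda>(\<theta>, a)\<in>spx ?F k. g k \<theta> a) \<in> smaps ?F (tot Y)"
  proof (rule smapsI)
    fix k z assume "z \<in> spx ?F k"
    then show "(\<lambda>(\<theta>, a)\<in>spx ?F k. g k \<theta> a) z \<in> spx (tot Y) k" using g by (cases z) simp
  next
    fix l k \<phi> z assume \<phi>: "\<phi> \<in> deltas l k" and z: "z \<in> spx ?F k"
    obtain \<theta> a where [simp]: "z = (\<theta>, a)" by (cases z)
    show "(\<lambda>(\<theta>, a)\<in>spx ?F l. g l \<theta> a) (act ?F l k \<phi> z) = act (tot Y) l k \<phi> ((\<lambda>(\<theta>, a)\<in>spx ?F k. g k \<theta> a) z)"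
      using sset_act[OF F \<phi> z] z nat[OF \<phi>] by (simp add: act_fib)
  qed auto
  then show ?thesis using b g by (simp add: spx_dprod slice_maps_fib)
qed

lemma act_dprod_elem:
  assumes B: "sset B" and b: "b \<in> spx B n" and \<phi>: "\<phi> \<in> deltas m n"
  shows "act (dprod_tot A B f Y) m n \<phi> (b, \<lambda>k. \<lambda>(\<theta>, a)\<in>spx (fib A B f n b) k. g k \<theta> a) =
    (act B m n \<phi> b, \<lambda>k. \<lambda>(\<theta>, a)\<in>spx (fib A B f m (act B m n \<phi> b)) k. g k (compose {..k} \<phi> \<theta>) a)"
  using fib_shift[OF B \<phi> b, where A = A and f = f] by (auto simp: act_dprod intro!: restrict_ext)


section \<open>The bisimulation relation\<close>

locale bisimulation = w_type \<kappa> E U W \<pi> \<alpha>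
  for \<kappa> :: "'k rel" and E U W :: "'v sset" and \<pi> :: "('v, 'v) smap" and \<alpha> :: "(('v, 'v, 'v) poly, 'v) smap" +
  fixes B :: "('v, 'v \<times> 'v) slice" and \<beta> :: "(('v, 'v \<times> 'v, 'v) bisim, 'v) smap"
  assumes bisim: "is_bisimulation E U \<pi> W \<alpha> B \<beta>"
begin

abbreviation "WW \<equiv> sprod W W"
abbreviation "fl \<equiv> smap_prod V W p (sid W)"
abbreviation "fr \<equiv> smap_prod W V (sid W) p"
abbreviation "yl X \<equiv> dsum (smap_prod V V (sid V) p) (bisim_pull V q X)"
abbreviation "yr X \<equiv> dsum (smap_prod V V p (sid V)) (bisim_pull V q X)"
abbreviation "\<Phi> \<equiv> bisim W V p q"

lemmas WW = sset_sprod[OF W W] and VV = sset_sprod[OF V V] and VW = sset_sprod[OF V W] and WV = sset_sprod[OF W V]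

lemma kan_fl: "kan_fibration (sprod V W) WW fl"
  by (rule kan_fibration_smap_prod[OF kan_p kan_fibration_sid[OF W]])

lemma kan_fr: "kan_fibration (sprod W V) WW fr"
  by (rule kan_fibration_smap_prod[OF kan_fibration_sid[OF W] kan_p])

lemmas fl = kan_fibrationD(3)[OF kan_fl] and fr = kan_fibrationD(3)[OF kan_fr]

lemma bisim_functor: "slice_functor WW WW \<Phi> (bisim_map W V p q)"
proof -
  have pull: "slice_functor WW (sprod V V) (bisim_pull V q) (bisim_pull_map V q)"
    unfolding bisim_pull_def[abs_def] bisim_pull_map_def[abs_def]
    by (rule slice_functor_pull[OF VV WW smap_prod_smaps[OF V V q q]])
  have left: "slice_functor WW WW (bisim_left W V p q) (bisim_left_map W V p q)"
    using slice_functor_comp[OF slice_functor_comp[OF pull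
        slice_functor_dsum[OF kan_fibration_smap_prod[OF kan_fibration_sid[OF V] kan_p]]] slice_functor_dprod[OF kan_fl]]
    unfolding bisim_left_def[abs_def] bisim_left_map_def[abs_def] .
  have right: "slice_functor WW WW (bisim_right W V p q) (bisim_right_map W V p q)"
    using slice_functor_comp[OF slice_functor_comp[OF pull
        slice_functor_dsum[OF kan_fibration_smap_prod[OF kan_p kan_fibration_sid[OF V]]]] slice_functor_dprod[OF kan_fr]]
    unfolding bisim_right_def[abs_def] bisim_right_map_def[abs_def] .
  show ?thesis
    using slice_functor_slice_prod[OF left right] unfolding bisim_def[abs_def] bisim_map_def[abs_def] .
qed

sublocale B: initial_slice WW \<Phi> "bisim_map W V p q" B \<beta>
  by (intro initial_slice.intro bisim_functor initial_slice_axioms.intro)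
    (use bisim in \<open>simp add: is_bisimulation_def Let_def\<close>)

lemmas B_sset = slice_overD(1)[OF B.B] and B_str = slice_overD(2)[OF B.B]

section \<open>Elementwise description of the bisimulation functor\<close>

lemma spx_bisim: "(x, y) \<in> spx (tot (\<Phi> X)) n \<longleftrightarrow> x \<in> spx (dprod_tot (sprod V W) WW fl (yl X)) n \<and>
    y \<in> spx (dprod_tot (sprod W V) WW fr (yr X)) n \<and> fst x = fst y"
  by (auto simp: bisim_def slice_prod_def Let_def spx_pullback bisim_left_def bisim_right_def dprod_def sfst_def)

lemma act_bisim: "act (tot (\<Phi> X)) m n \<theta> (x, y) =
    (act (dprod_tot (sprod V W) WW fl (yl X)) m n \<theta> x, act (dprod_tot (sprod W V) WW fr (yr X)) m n \<theta> y)"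
  by (simp add: bisim_def slice_prod_def Let_def bisim_left_def bisim_right_def dprod_def)

lemma str_bisim: "(x, y) \<in> spx (tot (\<Phi> X)) n \<Longrightarrow> str (\<Phi> X) n (x, y) = fst x"
  by (auto simp: bisim_def slice_prod_def Let_def spx_pullback bisim_left_def bisim_right_def dprod_def sfst_def)

lemma spx_y: "((v, v'), x) \<in> spx (tot (yl X)) n \<longleftrightarrow> v \<in> spx V n \<and> v' \<in> spx V n \<and> x \<in> spx (tot X) n \<and> str X n x = (q n v, q n v')"
  "((v, v'), x) \<in> spx (tot (yr X)) n \<longleftrightarrow> v \<in> spx V n \<and> v' \<in> spx V n \<and> x \<in> spx (tot X) n \<and> str X n x = (q n v, q n v')"
  by (auto simp: dsum_def bisim_pull_def spx_pull)

lemma str_y: "((v, v'), x) \<in> spx (tot (yl X)) n \<Longrightarrow> str (yl X) n ((v, v'), x) = (v, snd v')"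
  "((v, v'), x) \<in> spx (tot (yr X)) n \<Longrightarrow> str (yr X) n ((v, v'), x) = (snd v, v')"
  using spx_y[of v v' x X n] by (auto simp: dsum_def bisim_pull_def str_pull p_apply)

lemma act_y: "act (tot (yl X)) m n \<theta> ((v, v'), x) = ((act V m n \<theta> v, act V m n \<theta> v'), act (tot X) m n \<theta> x)"
  "act (tot (yr X)) m n \<theta> ((v, v'), x) = ((act V m n \<theta> v, act V m n \<theta> v'), act (tot X) m n \<theta> x)"
  by (simp_all add: dsum_def bisim_pull_def act_pull)

lemma fl_apply: "v \<in> spx V n \<Longrightarrow> w \<in> spx W n \<Longrightarrow> fl n (v, w) = (snd v, w)"
  and fr_apply: "v \<in> spx V n \<Longrightarrow> w \<in> spx W n \<Longrightarrow> fr n (w, v) = (w, snd v)"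
  by (simp_all add: p_apply)

text \<open>\<open>p\<close> is the pullback of \<pi> along \<open>rt\<close>, so the fibres of the
  two product maps come from fibres of \<pi>.\<close>

lemma small_fl: "small_fibres \<kappa> (sprod V W) WW fl" and small_fr: "small_fibres \<kappa> (sprod W V) WW fr"
proof -
  have fibre: "|{e \<in> spx E n. \<pi> n e = rt n w}| <o \<kappa>" if "w \<in> spx W n" for n w
    using small_\<pi> smaps_in[OF rt that] by (simp add: small_fibres_def)
  have "|{x \<in> spx (sprod V W) n. fl n x = (w, w')}| <o \<kappa>" if "(w, w') \<in> spx WW n" for n w w'
  proof -
    have "{x \<in> spx (sprod V W) n. fl n x = (w, w')} \<subseteq> (\<lambda>e. ((e, w), w')) ` {e \<in> spx E n. \<pi> n e = rt n w}"
      by (auto simp: fl_apply spx_V simp del: smap_prod_apply)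
    then show ?thesis
      using ordLeq_ordLess_trans[OF card_of_mono1 ordLeq_ordLess_trans[OF card_of_image fibre]] that by auto
  qed
  then show "small_fibres \<kappa> (sprod V W) WW fl" by (auto simp: small_fibres_def)
  have "|{x \<in> spx (sprod W V) n. fr n x = (w, w')}| <o \<kappa>" if "(w, w') \<in> spx WW n" for n w w'
  proof -
    have "{x \<in> spx (sprod W V) n. fr n x = (w, w')} \<subseteq> (\<lambda>e. (w, (e, w'))) ` {e \<in> spx E n. \<pi> n e = rt n w'}"
      by (auto simp: fr_apply spx_V simp del: smap_prod_apply)
    then show ?thesis
      using ordLeq_ordLess_trans[OF card_of_mono1 ordLeq_ordLess_trans[OF card_of_image fibre]] that by auto
  qed
  then show "small_fibres \<kappa> (sprod W V) WW fr" by (auto simp: small_fibres_def)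
qed

lemma bisim_inj: obtains \<iota> :: "nat \<Rightarrow> ('v, 'v \<times> 'v, 'v) bisim \<Rightarrow> 'v" where "\<And>n. inj_on (\<iota> n) (spx (tot (\<Phi> B)) n)"
proof -
  have WW_le: "|spx WW n| \<le>o |UNIV :: 'v set|" for n
    by (simp add: card_universe_prod card_subset_universe)
  have "|((UNIV :: 'v set) \<times> (UNIV :: 'v set)) \<times> (UNIV :: 'v set) \<times> (UNIV :: 'v set)| \<le>o |UNIV :: 'v set|"
    by (intro card_universe_prod card_subset_universe)
  then have y: "|A| \<le>o |UNIV :: 'v set|" if "A \<subseteq> ((UNIV :: ('v \<times> 'v) set) \<times> (UNIV :: ('v \<times> 'v) set)) \<times> (UNIV :: 'v set)" for A
  proof -
    have "|(((UNIV :: 'v set) \<times> (UNIV :: 'v set)) \<times> (UNIV :: 'v set) \<times> (UNIV :: 'v set)) \<times> (UNIV :: 'v set)| \<le>o |UNIV :: 'v set|"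
      by (intro card_universe_prod card_subset_universe)
    then show ?thesis using ordLeq_transitive[OF card_of_mono1[OF that]] by simp
  qed
  have "|spx (tot (\<Phi> B)) n| \<le>o |UNIV :: 'v set|" for n
  proof (rule ordLeq_transitive[OF card_of_mono1 card_universe_prod])
    show "spx (tot (\<Phi> B)) n \<subseteq> spx (dprod_tot (sprod V W) WW fl (yl B)) n \<times> spx (dprod_tot (sprod W V) WW fr (yr B)) n"
      by (auto simp: spx_bisim)
    show "|spx (dprod_tot (sprod V W) WW fl (yl B)) n| \<le>o |UNIV :: 'v set|"
      by (rule card_dprod_le[OF inaccessible universe small_fl WW WW_le]) (rule y, simp)
    show "|spx (dprod_tot (sprod W V) WW fr (yr B)) n| \<le>o |UNIV :: 'v set|"
      by (rule card_dprod_le[OF inaccessible universe small_fr WW WW_le]) (rule y, simp)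
  qed
  then have "\<exists>i :: ('v, 'v \<times> 'v, 'v) bisim \<Rightarrow> 'v. inj_on i (spx (tot (\<Phi> B)) n)" for n
    unfolding card_of_ordLeq[symmetric] by blast
  then show thesis using that by metis
qed

theorem kan_B: "kan_fibration (tot B) WW (str B)"
proof -
  obtain \<iota> :: "nat \<Rightarrow> ('v, 'v \<times> 'v, 'v) bisim \<Rightarrow> 'v" where "\<And>n. inj_on (\<iota> n) (spx (tot (\<Phi> B)) n)"
    using bisim_inj by blast
  from B.initial_kan_fibration[OF this] show ?thesis .
qed

lemma unfold_ex: "\<exists>\<delta>. \<delta> \<in> slice_maps B (\<Phi> B) \<and> (\<forall>n. \<forall>x\<in>spx (tot (\<Phi> B)) n. \<delta> n (\<beta> n x) = x)"
proof -
  obtain \<iota> :: "nat \<Rightarrow> ('v, 'v \<times> 'v, 'v) bisim \<Rightarrow> 'v" where \<iota>: "\<And>n. inj_on (\<iota> n) (spx (tot (\<Phi> B)) n)"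
    using bisim_inj by blast
  show ?thesis by (rule B.lambek[OF \<iota>]) blast
qed

text \<open>The inverse of \<beta> from Lambek's lemma, fixed by choice: it unfolds a bisimulation
  into its two matching functions.\<close>

definition \<delta> :: "('v, ('v, 'v \<times> 'v, 'v) bisim) smap" where
  "\<delta> = (SOME \<delta>. \<delta> \<in> slice_maps B (\<Phi> B) \<and> (\<forall>n. \<forall>x\<in>spx (tot (\<Phi> B)) n. \<delta> n (\<beta> n x) = x))"

lemma \<delta>: "\<delta> \<in> slice_maps B (\<Phi> B)" and \<delta>_\<beta>: "x \<in> spx (tot (\<Phi> B)) n \<Longrightarrow> \<delta> n (\<beta> n x) = x"
  using someI_ex[OF unfold_ex] unfolding \<delta>_def[symmetric] by blast+

text \<open>For \<open>x \<in> \<Phi>(X)\<close> over \<open>(sup\<^sub>u(t), sup\<^sub>v(t'))\<close>, \<open>left_at\<close> sends \<open>e \<in> E\<^sub>u\<close> to the pair of \<open>e' \<in> E\<^sub>v\<close> and the element of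
  \<open>X\<close> over \<open>(t(e), t'(e'))\<close>, and \<open>right_at\<close> sends \<open>e' \<in> E\<^sub>v\<close> to such a pair with \<open>e \<in> E\<^sub>u\<close>.\<close>

definition left_at :: "nat \<Rightarrow> ('v, 'v \<times> 'v, 'v) bisim \<Rightarrow> 'v \<Rightarrow> 'v \<times> 'v" where
  "left_at n x e = (case x of (((w, w'), s), _) \<Rightarrow> (case s n (did n, ((e, w), w')) of ((v, v'), b) \<Rightarrow> (fst v', b)))"

definition right_at :: "nat \<Rightarrow> ('v, 'v \<times> 'v, 'v) bisim \<Rightarrow> 'v \<Rightarrow> 'v \<times> 'v" where
  "right_at n x e' = (case x of (_, ((w, w'), s)) \<Rightarrow> (case s n (did n, (w, (e', w'))) of ((v, v'), b) \<Rightarrow> (fst v, b)))"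

text \<open>Only the value of the section at the identity operator enters. The last clause says that
  \<open>left_at\<close> is simplicial in the pair of \<open>x\<close> and \<open>e\<close>; it
  holds because a restricted section at the identity has the value of the original one at the
  operator.\<close>

lemma left_at:
  assumes x: "(((w, w'), s), y) \<in> spx (tot (\<Phi> X)) n" and e: "(e, w) \<in> spx V n"
  obtains e' b where "s n (did n, ((e, w), w')) = (((e, w), (e', w')), b)" "left_at n (((w, w'), s), y) e = (e', b)"
    "(e', w') \<in> spx V n" "b \<in> spx (tot X) n" "str X n b = (q n (e, w), q n (e', w'))"
    "\<And>m \<theta>. \<theta> \<in> deltas m n \<Longrightarrow> left_at m (act (tot (\<Phi> X)) m n \<theta> (((w, w'), s), y)) (act E m n \<theta> e) = (act E m n \<theta> e', act (tot X) m n \<theta> b)"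
proof -
  let ?D = "dprod_tot (sprod V W) WW fl (yl X)" and ?F = "fib (sprod V W) WW fl n (w, w')"
  have xD: "((w, w'), s) \<in> spx ?D n" using x unfolding spx_bisim by blast
  then have ww: "(w, w') \<in> spx WW n" and s: "s \<in> smaps ?F (tot (yl X))"
    and s_str: "\<And>m \<theta> a. (\<theta>, a) \<in> spx ?F m \<Longrightarrow> str (yl X) m (s m (\<theta>, a)) = a"
    unfolding spx_dprod slice_maps_fib mem_Collect_eq case_prod_conv by blast+
  have a: "((e, w), w') \<in> spx (sprod V W) n" using ww e by simp
  have in_F: "(did n, ((e, w), w')) \<in> spx ?F n"
    using ww e by (simp add: did_fib[OF WW ww] fl_apply del: smap_prod_apply)
  obtain v v' b where vb: "s n (did n, ((e, w), w')) = ((v, v'), b)" by (metis prod.exhaust)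
  have y: "((v, v'), b) \<in> spx (tot (yl X)) n" using smaps_in[OF s in_F] vb by simp
  have v: "v = (e, w)" "snd v' = w'" using s_str[OF in_F] str_y(1)[OF y] vb by auto
  have act: "left_at m (act (tot (\<Phi> X)) m n \<theta> (((w, w'), s), y)) (act E m n \<theta> e) = (act E m n \<theta> (fst v'), act (tot X) m n \<theta> b)"
    if \<theta>: "\<theta> \<in> deltas m n" for m \<theta> y
  proof -
    let ?a = "((act E m n \<theta> e, act W m n \<theta> w), act W m n \<theta> w')"
    have "(did m, ?a) \<in> spx (fib (sprod V W) WW fl m (act WW m n \<theta> (w, w'))) m"
      using sset_act[OF VW \<theta> a] smaps_nat[OF fl \<theta> a] in_F unfolding did_fib[OF WW sset_act[OF WW \<theta> ww]] did_fib[OF WW ww]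
      by (simp add: act_V)
    then have "snd (act ?D m n \<theta> ((w, w'), s)) m (did m, ?a) = s m (\<theta>, ?a)"
      using snd_act_dprod[OF \<theta>, of ?a "sprod V W" WW fl "((w, w'), s)"] by simp
    also have "\<dots> = act (tot (yl X)) m n \<theta> ((v, v'), b)"
      using smaps_nat[OF s \<theta> in_F] \<theta> vb by (simp add: act_fib act_V)
    finally show ?thesis
      by (cases v') (simp add: left_at_def act_bisim act_dprod act_y act_V)
  qed
  show thesis
  proof (rule that[of "fst v'" b])
    show "s n (did n, ((e, w), w')) = (((e, w), (fst v', w')), b)" using vb v by (cases v') simp
    show "left_at n (((w, w'), s), y) e = (fst v', b)" by (simp add: left_at_def vb)
    show "(fst v', w') \<in> spx V n" "b \<in> spx (tot X) n" "str X n b = (q n (e, w), q n (fst v', w'))"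
      using y v unfolding spx_y by (cases v'; simp)+
  qed (rule act)
qed

lemma right_at:
  assumes x: "(y, ((w, w'), s)) \<in> spx (tot (\<Phi> X)) n" and e': "(e', w') \<in> spx V n"
  obtains e b where "s n (did n, (w, (e', w'))) = (((e, w), (e', w')), b)" "right_at n (y, ((w, w'), s)) e' = (e, b)"
    "(e, w) \<in> spx V n" "b \<in> spx (tot X) n" "str X n b = (q n (e, w), q n (e', w'))"
    "\<And>m \<theta>. \<theta> \<in> deltas m n \<Longrightarrow> right_at m (act (tot (\<Phi> X)) m n \<theta> (y, ((w, w'), s))) (act E m n \<theta> e') = (act E m n \<theta> e, act (tot X) m n \<theta> b)"
proof -
  let ?D = "dprod_tot (sprod W V) WW fr (yr X)" and ?F = "fib (sprod W V) WW fr n (w, w')"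
  have xD: "((w, w'), s) \<in> spx ?D n" using x unfolding spx_bisim by blast
  then have ww: "(w, w') \<in> spx WW n" and s: "s \<in> smaps ?F (tot (yr X))"
    and s_str: "\<And>m \<theta> a. (\<theta>, a) \<in> spx ?F m \<Longrightarrow> str (yr X) m (s m (\<theta>, a)) = a"
    unfolding spx_dprod slice_maps_fib mem_Collect_eq case_prod_conv by blast+
  have a: "(w, (e', w')) \<in> spx (sprod W V) n" using ww e' by simp
  have in_F: "(did n, (w, (e', w'))) \<in> spx ?F n"
    using ww e' by (simp add: did_fib[OF WW ww] fr_apply del: smap_prod_apply)
  obtain v v' b where vb: "s n (did n, (w, (e', w'))) = ((v, v'), b)" by (metis prod.exhaust)
  have y: "((v, v'), b) \<in> spx (tot (yr X)) n" using smaps_in[OF s in_F] vb by simp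
  have v: "snd v = w" "v' = (e', w')" using s_str[OF in_F] str_y(2)[OF y] vb by auto
  have act: "right_at m (act (tot (\<Phi> X)) m n \<theta> (y, ((w, w'), s))) (act E m n \<theta> e') = (act E m n \<theta> (fst v), act (tot X) m n \<theta> b)"
    if \<theta>: "\<theta> \<in> deltas m n" for m \<theta> y
  proof -
    let ?a = "(act W m n \<theta> w, (act E m n \<theta> e', act W m n \<theta> w'))"
    have "(did m, ?a) \<in> spx (fib (sprod W V) WW fr m (act WW m n \<theta> (w, w'))) m"
      using sset_act[OF WV \<theta> a] smaps_nat[OF fr \<theta> a] in_F unfolding did_fib[OF WW sset_act[OF WW \<theta> ww]] did_fib[OF WW ww]
      by (simp add: act_V)
    then have "snd (act ?D m n \<theta> ((w, w'), s)) m (did m, ?a) = s m (\<theta>, ?a)"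
      using snd_act_dprod[OF \<theta>, of ?a "sprod W V" WW fr "((w, w'), s)"] by simp
    also have "\<dots> = act (tot (yr X)) m n \<theta> ((v, v'), b)"
      using smaps_nat[OF s \<theta> in_F] \<theta> vb by (simp add: act_fib act_V)
    finally show ?thesis
      by (cases v) (simp add: right_at_def act_bisim act_dprod act_y act_V)
  qed
  show thesis
  proof (rule that[of "fst v" b])
    show "s n (did n, (w, (e', w'))) = (((fst v, w), (e', w')), b)" using vb v by (cases v) simp
    show "right_at n (y, ((w, w'), s)) e' = (fst v, b)" by (simp add: right_at_def vb)
    show "(fst v, w) \<in> spx V n" "b \<in> spx (tot X) n" "str X n b = (q n (fst v, w), q n (e', w'))"
      using y v unfolding spx_y by (cases v; simp)+
  qed (rule act)
qed

text \<open>The two halves of \<open>\<delta>\<close> as operations: given a bisimulation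
  \<open>b\<close> and a branch of its first tree (\<open>L\<close>) or second tree
  (\<open>R\<close>), they return a matching branch of the other tree and a bisimulation of the
  subtrees.\<close>

definition L :: "nat \<Rightarrow> 'v \<Rightarrow> 'v \<Rightarrow> 'v \<times> 'v" where "L n e b = left_at n (\<delta> n b) e"
definition R :: "nat \<Rightarrow> 'v \<Rightarrow> 'v \<Rightarrow> 'v \<times> 'v" where "R n e b = right_at n (\<delta> n b) e"

lemma \<delta>_cases:
  assumes b: "b \<in> spx (tot B) n"
  obtains s s' where "\<delta> n b = ((str B n b, s), (str B n b, s'))" "((str B n b, s), (str B n b, s')) \<in> spx (tot (\<Phi> B)) n"
proof -
  obtain x y where xy: "\<delta> n b = (x, y)" by (cases "\<delta> n b")
  have in_\<Phi>: "(x, y) \<in> spx (tot (\<Phi> B)) n" using smaps_in[OF slice_maps_smaps[OF \<delta>] b] xy by simp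
  then have "fst x = str B n b" using slice_mapsD[OF \<delta> b] str_bisim[OF in_\<Phi>] xy by simp
  moreover have "fst y = fst x" using in_\<Phi> by (simp add: spx_bisim)
  ultimately show thesis using that[of "snd x" "snd y"] xy in_\<Phi> by (metis prod.collapse)
qed

lemma L:
  assumes b: "b \<in> spx (tot B) n" "str B n b = (w, w')" and e: "(e, w) \<in> spx V n"
  obtains e' b' where "L n e b = (e', b')" "(e', w') \<in> spx V n" "b' \<in> spx (tot B) n" "str B n b' = (q n (e, w), q n (e', w'))"
    "\<And>m \<theta>. \<theta> \<in> deltas m n \<Longrightarrow> L m (act E m n \<theta> e) (act (tot B) m n \<theta> b) = (act E m n \<theta> e', act (tot B) m n \<theta> b')"
proof -
  obtain s s' where d: "\<delta> n b = (((w, w'), s), ((w, w'), s'))" and x: "(((w, w'), s), ((w, w'), s')) \<in> spx (tot (\<Phi> B)) n"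
    using \<delta>_cases[OF b(1)] unfolding b(2) by blast
  show thesis
    by (rule left_at[OF x e], rule that)
      (simp_all add: L_def d smaps_nat[OF slice_maps_smaps[OF \<delta>] _ b(1)])
qed

lemma R:
  assumes b: "b \<in> spx (tot B) n" "str B n b = (w, w')" and e': "(e', w') \<in> spx V n"
  obtains e b' where "R n e' b = (e, b')" "(e, w) \<in> spx V n" "b' \<in> spx (tot B) n" "str B n b' = (q n (e, w), q n (e', w'))"
    "\<And>m \<theta>. \<theta> \<in> deltas m n \<Longrightarrow> R m (act E m n \<theta> e') (act (tot B) m n \<theta> b) = (act E m n \<theta> e, act (tot B) m n \<theta> b')"
proof -
  obtain s s' where d: "\<delta> n b = (((w, w'), s), ((w, w'), s'))" and x: "(((w, w'), s), ((w, w'), s')) \<in> spx (tot (\<Phi> B)) n"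
    using \<delta>_cases[OF b(1)] unfolding b(2) by blast
  show thesis
    by (rule right_at[OF x e'], rule that)
      (simp_all add: R_def d smaps_nat[OF slice_maps_smaps[OF \<delta>] _ b(1)])
qed

end

section \<open>Quotients by Kan pseudo-equivalence relations\<close>

lemma leg: "r \<in> spx (tot R) n \<Longrightarrow> leg1 R n r = fst (str R n r)" "r \<in> spx (tot R) n \<Longrightarrow> leg2 R n r = snd (str R n r)"
  by (simp_all add: leg1_def leg2_def)

lemma
  assumes R: "sset (tot R)" and str: "str R \<in> smaps (tot R) (sprod Y Y)"
  shows leg1_smaps: "leg1 R \<in> smaps (tot R) Y" and leg2_smaps: "leg2 R \<in> smaps (tot R) Y"
proof -
  have "fst (str R n r) \<in> spx Y n" "snd (str R n r) \<in> spx Y n" if "r \<in> spx (tot R) n" for n r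
    using smaps_in[OF str that] by auto
  moreover have "str R m (act (tot R) m n \<theta> r) = (act Y m n \<theta> (fst (str R n r)), act Y m n \<theta> (snd (str R n r)))"
    if "\<theta> \<in> deltas m n" "r \<in> spx (tot R) n" for m n \<theta> r
    using smaps_nat[OF str that] by (cases "str R n r") simp
  ultimately show "leg1 R \<in> smaps (tot R) Y" "leg2 R \<in> smaps (tot R) Y"
    using sset_act[OF R] by (auto intro!: smapsI simp: leg) (auto simp: leg1_def leg2_def)
qed

locale kan_pseudo_equivalence =
  fixes Y :: "'y sset" and R :: "('r, 'y \<times> 'y) slice"
  assumes kan_Y: "kan_complex Y" and pseudo: "pseudo_equivalence Y R"
    and kan_R: "kan_fibration (tot R) (sprod Y Y) (str R)"
begin

text \<open>\<open>R\<close> -> Y \<times> Y need not be injective; its image is the relation by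
  which the quotient is formed.\<close>

definition im :: "nat \<Rightarrow> ('y \<times> 'y) set" where
  "im n = str R n ` spx (tot R) n"

lemma Y: "sset Y"
  using kan_Y by (simp add: kan_complex_def)

lemma R: "sset (tot R)" and R_str: "str R \<in> smaps (tot R) (sprod Y Y)"
  using kan_fibrationD[OF kan_R] by blast+

lemmas leg1 = leg1_smaps[OF R R_str] and leg2 = leg2_smaps[OF R R_str]

lemma im_sub: "(x, y) \<in> im n \<Longrightarrow> x \<in> spx Y n \<and> y \<in> spx Y n"
  using smaps_in[OF R_str] by (fastforce simp: im_def)

lemma im_refl: "y \<in> spx Y n \<Longrightarrow> (y, y) \<in> im n"
proof -
  assume y: "y \<in> spx Y n"
  obtain \<rho> where \<rho>: "\<rho> \<in> smaps Y (tot R)" "scomp Y (str R) \<rho> = (\<lambda>n. \<lambda>y\<in>spx Y n. (y, y))"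
    using pseudo by (auto simp: pseudo_equivalence_def Let_def)
  have "str R n (\<rho> n y) = (y, y)" using fun_cong[OF fun_cong[OF \<rho>(2), of n], of y] y by simp
  then show ?thesis using smaps_in[OF \<rho>(1) y] by (force simp: im_def)
qed

lemma im_sym: "(x, y) \<in> im n \<Longrightarrow> (y, x) \<in> im n"
proof -
  assume "(x, y) \<in> im n"
  then obtain r where r: "r \<in> spx (tot R) n" "str R n r = (x, y)" by (auto simp: im_def)
  obtain \<sigma> where \<sigma>: "\<sigma> \<in> smaps (tot R) (tot R)" "scomp (tot R) (leg1 R) \<sigma> = leg2 R" "scomp (tot R) (leg2 R) \<sigma> = leg1 R"
    using pseudo by (auto simp: pseudo_equivalence_def Let_def)
  note \<sigma>r = smaps_in[OF \<sigma>(1) r(1)]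
  have "fst (str R n (\<sigma> n r)) = y" "snd (str R n (\<sigma> n r)) = x"
    using fun_cong[OF fun_cong[OF \<sigma>(2), of n], of r] fun_cong[OF fun_cong[OF \<sigma>(3), of n], of r] r \<sigma>r by (simp_all add: leg)
  then show ?thesis using \<sigma>r by (force simp: im_def)
qed

lemma im_trans: "(x, y) \<in> im n \<Longrightarrow> (y, z) \<in> im n \<Longrightarrow> (x, z) \<in> im n"
proof -
  assume "(x, y) \<in> im n" "(y, z) \<in> im n"
  then obtain r r' where r: "r \<in> spx (tot R) n" "str R n r = (x, y)" "r' \<in> spx (tot R) n" "str R n r' = (y, z)"
    by (auto simp: im_def)
  let ?P = "pullback (tot R) (tot R) (leg2 R) (leg1 R)"
  obtain \<tau> where \<tau>: "\<tau> \<in> smaps ?P (tot R)" "scomp ?P (leg1 R) \<tau> = scomp ?P (leg1 R) (sfst ?P)"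
      "scomp ?P (leg2 R) \<tau> = scomp ?P (leg2 R) (ssnd ?P)"
    using pseudo by (auto simp: pseudo_equivalence_def Let_def)
  have P: "(r, r') \<in> spx ?P n" using r by (simp add: spx_pullback leg)
  note \<tau>r = smaps_in[OF \<tau>(1) P]
  have "fst (str R n (\<tau> n (r, r'))) = x" "snd (str R n (\<tau> n (r, r'))) = z"
    using fun_cong[OF fun_cong[OF \<tau>(2), of n], of "(r, r')"] fun_cong[OF fun_cong[OF \<tau>(3), of n], of "(r, r')"] r P \<tau>r
    by (simp_all add: leg sfst_def ssnd_def)
  then show ?thesis using \<tau>r by (force simp: im_def)
qed

abbreviation "Q \<equiv> quotient_sset Y R"
abbreviation "pr \<equiv> coeq_proj (tot R) Y (leg1 R) (leg2 R)"

text \<open>The image of a pseudo-equivalence relation is an equivalence relation in each degree, so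
  generating an equivalence relation adds nothing.\<close>

lemma coeq_rel_eq: "coeq_rel (tot R) Y (leg1 R) (leg2 R) n = im n"
proof -
  have G: "(\<lambda>r. (leg1 R n r, leg2 R n r)) ` spx (tot R) n = im n"
    unfolding im_def by (rule image_cong) (simp_all add: leg)
  have "(x, y) \<in> im n" if "(x, y) \<in> (im n \<union> (im n)\<inverse>)\<^sup>*" "x \<in> spx Y n" for x y
    using that by (induction rule: rtrancl_induct) (auto intro: im_refl im_sym im_trans)
  then have "(im n \<union> (im n)\<inverse>)\<^sup>* \<inter> spx Y n \<times> spx Y n = im n"
    using im_sub by auto
  then show ?thesis unfolding coeq_rel_def Let_def G .
qed

lemma pr: "pr \<in> smaps Y Q"
  unfolding quotient_sset_def by (rule coeq_proj_smaps[OF R Y leg1 leg2])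

lemma pr_eq_iff: "x \<in> spx Y n \<Longrightarrow> y \<in> spx Y n \<Longrightarrow> pr n x = pr n y \<longleftrightarrow> (x, y) \<in> im n"
  using eq_equiv_class_iff[OF equiv_coeq_rel[of Y n "tot R" "leg1 R" "leg2 R"]]
  by (simp add: coeq_proj_def coeq_rel_eq)

lemma pr_surj: "c \<in> spx Q n \<Longrightarrow> \<exists>y\<in>spx Y n. pr n y = c"
  unfolding quotient_sset_def using coeq_cases[OF R Y leg1 leg2] by metis

lemma Q: "sset Q"
  unfolding quotient_sset_def by (rule sset_coeq[OF R Y leg1 leg2])

text \<open>A filler over Y \<times> Y is a filler over the image. What is gained is a base onto
  which \<open>R\<close> is surjective, as \<open>horn_lift\<close> requires.\<close>

lemma kan_fibration_im: "kan_fibration (tot R) \<lparr>spx = im, act = act (sprod Y Y)\<rparr> (str R)"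
proof (rule kan_fibrationI[OF R])
  let ?I = "\<lparr>spx = im, act = act (sprod Y Y)\<rparr>"
  have "subcomplex (sprod Y Y) im"
    unfolding subcomplex_def
  proof (intro conjI allI ballI)
    show "im n \<subseteq> spx (sprod Y Y) n" for n using im_sub by auto
    show "act (sprod Y Y) m n \<theta> x \<in> im m" if "\<theta> \<in> deltas m n" "x \<in> im n" for m n \<theta> x
      using that smaps_nat[OF R_str that(1), symmetric] sset_act[OF R that(1)] by (auto simp: im_def)
  qed
  moreover have "slice_over (sprod Y Y) \<lparr>tot = sprod Y Y, str = sid (sprod Y Y)\<rparr>"
    by (simp add: slice_over_def sset_sprod sid_smaps Y)
  ultimately show "sset ?I"
    using slice_overD(1)[OF slice_over_sub_slice, of "sprod Y Y" _ im] by (fastforce simp: sub_slice_def)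
  show "str R \<in> smaps (tot R) ?I"
  proof (rule smapsI)
    show "str R n x = undefined" if "x \<notin> spx (tot R) n" for n x
      using R_str that by (auto simp: smaps_def PiE_def extensional_def)
    show "str R m (act (tot R) m n \<theta> x) = act ?I m n \<theta> (str R n x)" if "\<theta> \<in> deltas m n" "x \<in> spx (tot R) n" for m n \<theta> x
      using smaps_nat[OF R_str that] by simp
  qed (simp add: im_def)
  fix n k h y assume nk: "1 \<le> n" "k \<le> n" and h: "h \<in> smaps (horn n k) (tot R)" and y: "y \<in> spx ?I n"
    and hy: "\<And>m \<theta>. \<theta> \<in> spx (horn n k) m \<Longrightarrow> str R m (h m \<theta>) = act ?I m n \<theta> y"
  have "y \<in> spx (sprod Y Y) n" using y im_sub by (cases y) auto
  moreover have "str R m (h m \<theta>) = act (sprod Y Y) m n \<theta> y" if "\<theta> \<in> spx (horn n k) m" for m \<theta> using hy[OF that] by simp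
  ultimately obtain x where "x \<in> spx (tot R) n" "str R n x = y" "\<And>m \<theta>. \<theta> \<in> spx (horn n k) m \<Longrightarrow> act (tot R) m n \<theta> x = h m \<theta>"
    using kan_fibration_fill[OF kan_R nk h] by blast
  then show "\<exists>x\<in>spx (tot R) n. str R n x = y \<and> (\<forall>m. \<forall>\<theta>\<in>spx (horn n k) m. act (tot R) m n \<theta> x = h m \<theta>)"
    by blast
qed

text \<open>The Kan property of \<open>Y\<close> fills the horn regardless of \<open>c\<close>, and
  the fibration \<open>R\<close> then relates this filler to a chosen representative of
  \<open>c\<close>.\<close>

lemma kan_fibration_pr: "kan_fibration Y Q pr"
proof (rule kan_fibrationI[OF Y Q pr])
  fix n k h c assume nk: "1 \<le> n" "k \<le> n" and h: "h \<in> smaps (horn n k) Y" and c: "c \<in> spx Q n"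
    and hc: "\<And>m \<theta>. \<theta> \<in> spx (horn n k) m \<Longrightarrow> pr m (h m \<theta>) = act Q m n \<theta> c"
  obtain y where y: "y \<in> spx Y n" "pr n y = c" using pr_surj[OF c] by blast
  \<comment> \<open>Each simplex of the horn is equivalent to the corresponding face of
    \<open>y\<close>, which gives a horn in \<open>im\<close>. It is lifted to \<open>R\<close>,
    where the fibration over Y \<times> Y can extend it.\<close>
  define g where "g = (\<lambda>m. \<lambda>\<theta>\<in>spx (horn n k) m. (h m \<theta>, act Y m n \<theta> y))"
  have g_im: "(h m \<theta>, act Y m n \<theta> y) \<in> im m" if \<theta>: "\<theta> \<in> spx (horn n k) m" for m \<theta>
  proof -
    have "pr m (h m \<theta>) = pr m (act Y m n \<theta> y)" using hc[OF \<theta>] smaps_nat[OF pr horn_deltas[OF \<theta>] y(1)] y(2) by simp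
    then show ?thesis using pr_eq_iff[OF smaps_in[OF h \<theta>] sset_act[OF Y horn_deltas[OF \<theta>] y(1)]] by simp
  qed
  have "g \<in> smaps (horn n k) \<lparr>spx = im, act = act (sprod Y Y)\<rparr>"
  proof (rule smapsI)
    fix l m \<phi> \<theta> assume \<phi>: "\<phi> \<in> deltas l m" and \<theta>: "\<theta> \<in> spx (horn n k) m"
    have "act (horn n k) l m \<phi> \<theta> \<in> spx (horn n k) l" by (rule sset_act[OF sset_horn \<phi> \<theta>])
    then show "g l (act (horn n k) l m \<phi> \<theta>) = act \<lparr>spx = im, act = act (sprod Y Y)\<rparr> l m \<phi> (g m \<theta>)"
      using smaps_horn_nat[OF h \<phi> \<theta>] sset_comp[OF Y \<phi> horn_deltas[OF \<theta>] y(1)] \<theta> by (simp add: g_def)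
  qed (simp_all add: g_def g_im)
  then obtain r where r: "r \<in> smaps (horn n k) (tot R)" "\<And>m \<theta>. \<theta> \<in> spx (horn n k) m \<Longrightarrow> str R m (r m \<theta>) = g m \<theta>"
    by (rule horn_lift[OF kan_fibration_im nk]) (auto simp: im_def)
  obtain y' where y': "y' \<in> spx Y n" "\<And>m \<theta>. \<theta> \<in> spx (horn n k) m \<Longrightarrow> act Y m n \<theta> y' = h m \<theta>"
    using kan_complex_fill[OF kan_Y nk h] by blast
  \<comment> \<open>Nothing in the choice of \<open>y'\<close> refers to \<open>c\<close>. Extending
    the horn in \<open>R\<close> over \<open>(y', y)\<close> shows that \<open>y'\<close> is
    equivalent to \<open>y\<close>.\<close>
  have yy: "(y', y) \<in> spx (sprod Y Y) n" using y y' by simp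
  have "str R m (r m \<theta>) = act (sprod Y Y) m n \<theta> (y', y)" if "\<theta> \<in> spx (horn n k) m" for m \<theta>
    using r(2)[OF that] y'(2)[OF that] that by (simp add: g_def)
  then obtain b where "b \<in> spx (tot R) n" "str R n b = (y', y)"
    using kan_fibration_fill[OF kan_R nk r(1) yy] by blast
  then have "(y', y) \<in> im n" by (force simp: im_def)
  then have "pr n y' = c" using pr_eq_iff[OF y'(1) y(1)] y(2) by simp
  then show "\<exists>x\<in>spx Y n. pr n x = c \<and> (\<forall>m. \<forall>\<theta>\<in>spx (horn n k) m. act Y m n \<theta> x = h m \<theta>)"
    using y' by blast
qed

theorem kan_complex_quotient: "kan_complex Q"
proof (rule kan_complexI[OF Q])
  fix n k h assume nk: "1 \<le> n" "k \<le> n" and h: "h \<in> smaps (horn n k) Q"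
  obtain h' where h': "h' \<in> smaps (horn n k) Y" "\<And>m \<theta>. \<theta> \<in> spx (horn n k) m \<Longrightarrow> pr m (h' m \<theta>) = h m \<theta>"
    using horn_lift[OF kan_fibration_pr nk h pr_surj] by blast
  obtain y where y: "y \<in> spx Y n" "\<And>m \<theta>. \<theta> \<in> spx (horn n k) m \<Longrightarrow> act Y m n \<theta> y = h' m \<theta>"
    using kan_complex_fill[OF kan_Y nk h'(1)] by blast
  have "act Q m n \<theta> (pr n y) = h m \<theta>" if "\<theta> \<in> spx (horn n k) m" for m \<theta>
    using smaps_nat[OF pr horn_deltas[OF that] y(1)] y(2)[OF that] h'(2)[OF that] by simp
  then show "\<exists>x\<in>spx Q n. \<forall>m. \<forall>\<theta>\<in>spx (horn n k) m. act Q m n \<theta> x = h m \<theta>"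
    using smaps_in[OF pr y(1)] by blast
qed

end


section \<open>Maps into the bisimulation relation\<close>

context bisimulation
begin

text \<open>The analogue of \<open>child\<close> for bisimulations: the predecessors are the
  bisimulations of subtrees returned by either half of \<open>\<delta>\<close>, again at all images
  of \<open>b\<close> under operators.\<close>

definition child_B :: "((nat \<times> 'v) \<times> nat \<times> 'v) set" where
  "child_B = {((m, c), n, b). b \<in> spx (tot B) n \<and> (\<exists>\<theta>\<in>deltas m n. \<exists>e.
     (e, fst (str B m (act (tot B) m n \<theta> b))) \<in> spx V m \<and> c = snd (L m e (act (tot B) m n \<theta> b)) \<or>
     (e, snd (str B m (act (tot B) m n \<theta> b))) \<in> spx V m \<and> c = snd (R m e (act (tot B) m n \<theta> b)))}"

lemma wf_child_B: "wf child_B"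
proof (rule wfUNIVI)
  fix Q x assume step: "\<forall>x. (\<forall>y. (y, x) \<in> child_B \<longrightarrow> Q y) \<longrightarrow> Q x"
  define S where "S n = {b \<in> spx (tot B) n. \<forall>m. \<forall>\<theta>\<in>deltas m n. Q (m, act (tot B) m n \<theta> b)}" for n
  have Q: "Q (n, b)" if "b \<in> S n" for n b
    using that did_deltas[of n] sset_id[OF B_sset] unfolding S_def by fastforce
  have S_act: "act (tot B) m n \<theta> b \<in> S m" if \<theta>: "\<theta> \<in> deltas m n" and b: "b \<in> S n" for m n \<theta> b
  proof -
    have "Q (l, act (tot B) l m \<phi> (act (tot B) m n \<theta> b))" if \<phi>: "\<phi> \<in> deltas l m" for l \<phi>
      using b compose_deltas[OF \<theta> \<phi>] sset_comp[OF B_sset \<phi> \<theta>, of b] unfolding S_def by force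
    then show ?thesis using b sset_act[OF B_sset \<theta>] by (simp add: S_def)
  qed
  have sub: "subcomplex (tot B) S"
    unfolding subcomplex_def using S_act by (auto simp: S_def)
  let ?X = "sub_slice B S"
  have \<Phi>X: "sset (tot (\<Phi> ?X))" by (rule slice_overD(1)[OF B.F_over[OF slice_over_sub_slice[OF B.B sub]]])
  have act_X: "act (tot (\<Phi> ?X)) m n \<theta> x = act (tot (\<Phi> B)) m n \<theta> x" for m n \<theta> x
    by (subst B.F_sub[OF B.B sub]) simp
  have "S = spx (tot B)"
  proof (rule B.no_proper_subalgebra[OF sub])
    fix n x assume x: "x \<in> spx (tot (\<Phi> ?X)) n"
    have xB: "x \<in> spx (tot (\<Phi> B)) n" using B.F_sub_le[OF B.B sub] x by blast
    define b where "b = \<beta> n x"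
    have b: "b \<in> spx (tot B) n" unfolding b_def by (rule smaps_in[OF slice_maps_smaps[OF B.\<beta>] xB])
    have "Q (m, act (tot B) m n \<theta> b)" if \<theta>: "\<theta> \<in> deltas m n" for m \<theta>
    proof (rule step[rule_format])
      fix y assume "(y, m, act (tot B) m n \<theta> b) \<in> child_B"
      then obtain l \<phi> e where \<phi>: "\<phi> \<in> deltas l m"
        and y: "(e, fst (str B l (act (tot B) l m \<phi> (act (tot B) m n \<theta> b)))) \<in> spx V l \<and> y = (l, snd (L l e (act (tot B) l m \<phi> (act (tot B) m n \<theta> b)))) \<or>
          (e, snd (str B l (act (tot B) l m \<phi> (act (tot B) m n \<theta> b)))) \<in> spx V l \<and> y = (l, snd (R l e (act (tot B) l m \<phi> (act (tot B) m n \<theta> b))))"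
        by (auto simp: child_B_def)
      define \<psi> where "\<psi> = compose {..l} \<theta> \<phi>"
      have \<psi>: "\<psi> \<in> deltas l n" unfolding \<psi>_def by (rule compose_deltas[OF \<theta> \<phi>])
      define b' where "b' = act (tot B) l n \<psi> b"
      have b'_eq: "act (tot B) l m \<phi> (act (tot B) m n \<theta> b) = b'" by (simp add: b'_def \<psi>_def sset_comp[OF B_sset \<phi> \<theta> b])
      have b': "b' \<in> spx (tot B) l" unfolding b'_def by (rule sset_act[OF B_sset \<psi> b])
      have "\<delta> l b' = act (tot (\<Phi> B)) l n \<psi> x"
        using smaps_nat[OF slice_maps_smaps[OF \<delta>] \<psi> b] \<delta>_\<beta>[OF xB] by (simp add: b'_def b_def)
      then have \<delta>b': "\<delta> l b' \<in> spx (tot (\<Phi> ?X)) l" using sset_act[OF \<Phi>X \<psi> x] by (simp add: act_X)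
      obtain w w' where ww: "str B l b' = (w, w')" by (cases "str B l b'")
      obtain s s' where d: "\<delta> l b' = (((w, w'), s), ((w, w'), s'))" using \<delta>_cases[OF b'] unfolding ww by metis
      note dX = \<delta>b'[unfolded d]
      from y consider "(e, w) \<in> spx V l" "y = (l, snd (L l e b'))" | "(e, w') \<in> spx V l" "y = (l, snd (R l e b'))"
        unfolding b'_eq ww by auto
      then show "Q y"
      proof cases
        case 1
        obtain e' c where "left_at l (((w, w'), s), ((w, w'), s')) e = (e', c)" "c \<in> spx (tot ?X) l"
          by (rule left_at[OF dX 1(1)])
        then show ?thesis using Q 1(2) by (simp add: L_def d)
      next
        case 2
        obtain e' c where "right_at l (((w, w'), s), ((w, w'), s')) e = (e', c)" "c \<in> spx (tot ?X) l"
          by (rule right_at[OF dX 2(1)])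
        then show ?thesis using Q 2(2) by (simp add: R_def d)
      qed
    qed
    then show "\<beta> n x \<in> S n" using b by (simp add: S_def b_def)
  qed
  moreover have "Q (n, b)" if "b \<notin> spx (tot B) n" for n b using step that by (auto simp: child_B_def)
  ultimately show "Q x" using Q by (cases x) blast
qed

text \<open>A map to \<open>B\<close> is defined by well-founded recursion on a coalgebra for \<open>\<Phi>\<close>, given by its operations \<open>l\<close> and
  \<open>r\<close> with the properties of \<open>L\<close> and \<open>R\<close>.\<close>

lemma coalgebra_map:
  fixes Z :: "'z sset" and l r :: "nat \<Rightarrow> 'v \<Rightarrow> 'z \<Rightarrow> 'v \<times> 'z"
  assumes Z: "sset Z" and s: "s \<in> smaps Z W" and t: "t \<in> smaps Z W"
    and l: "\<And>n z e. z \<in> spx Z n \<Longrightarrow> (e, s n z) \<in> spx V n \<Longrightarrow> \<exists>e' z'. l n e z = (e', z') \<and> (e', t n z) \<in> spx V n \<and>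
      z' \<in> spx Z n \<and> s n z' = q n (e, s n z) \<and> t n z' = q n (e', t n z) \<and>
      (\<forall>m. \<forall>\<theta>\<in>deltas m n. l m (act E m n \<theta> e) (act Z m n \<theta> z) = (act E m n \<theta> e', act Z m n \<theta> z'))"
    and r: "\<And>n z e'. z \<in> spx Z n \<Longrightarrow> (e', t n z) \<in> spx V n \<Longrightarrow> \<exists>e z'. r n e' z = (e, z') \<and> (e, s n z) \<in> spx V n \<and>
      z' \<in> spx Z n \<and> s n z' = q n (e, s n z) \<and> t n z' = q n (e', t n z) \<and>
      (\<forall>m. \<forall>\<theta>\<in>deltas m n. r m (act E m n \<theta> e') (act Z m n \<theta> z) = (act E m n \<theta> e, act Z m n \<theta> z'))"
    and wf: "wf rel"
    and l_rel: "\<And>m n \<theta> z e. z \<in> spx Z n \<Longrightarrow> \<theta> \<in> deltas m n \<Longrightarrow> (e, s m (act Z m n \<theta> z)) \<in> spx V m \<Longrightarrow>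
      ((m, snd (l m e (act Z m n \<theta> z))), (n, z)) \<in> rel"
    and r_rel: "\<And>m n \<theta> z e. z \<in> spx Z n \<Longrightarrow> \<theta> \<in> deltas m n \<Longrightarrow> (e, t m (act Z m n \<theta> z)) \<in> spx V m \<Longrightarrow>
      ((m, snd (r m e (act Z m n \<theta> z))), (n, z)) \<in> rel"
  shows "\<exists>\<tau>\<in>smaps Z (tot B). \<forall>n. \<forall>z\<in>spx Z n. str B n (\<tau> n z) = (s n z, t n z)"
proof -
  let ?b = "\<lambda>n z. (s n z, t n z)"
  let ?Fl = "\<lambda>n z. fib (sprod V W) WW fl n (?b n z)" and ?Fr = "\<lambda>n z. fib (sprod W V) WW fr n (?b n z)"
  \<comment> \<open>The first half of an element of \<open>\<Phi> B\<close> over the pair of trees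
    of \<open>z\<close>: \<open>l\<close> matches a branch of the first tree with one of the second,
    and \<open>f\<close> supplies the bisimulation of the subtrees. \<open>gr\<close> is the second
    half, and \<open>el\<close> joins them.\<close>
  define gl where "gl f n z k \<theta> a = ((fst a, (fst (l k (fst (fst a)) (act Z k n \<theta> z)), snd a)), f (k, snd (l k (fst (fst a)) (act Z k n \<theta> z))))"
    for f :: "nat \<times> 'z \<Rightarrow> 'v" and n z k \<theta> and a :: "('v \<times> 'v) \<times> 'v"
  define gr where "gr f n z k \<theta> a = (((fst (r k (fst (snd a)) (act Z k n \<theta> z)), fst a), snd a), f (k, snd (r k (fst (snd a)) (act Z k n \<theta> z))))"
    for f :: "nat \<times> 'z \<Rightarrow> 'v" and n z k \<theta> and a :: "'v \<times> 'v \<times> 'v"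
  define el where "el f n z = ((?b n z, \<lambda>k. \<lambda>(\<theta>, a)\<in>spx (?Fl n z) k. gl f n z k \<theta> a), (?b n z, \<lambda>k. \<lambda>(\<theta>, a)\<in>spx (?Fr n z) k. gr f n z k \<theta> a))"
    for f n z
  have b_in: "?b n z \<in> spx WW n" if "z \<in> spx Z n" for n z using smaps_in[OF s that] smaps_in[OF t that] by simp
  have b_act: "act WW m n \<theta> (?b n z) = ?b m (act Z m n \<theta> z)" if "\<theta> \<in> deltas m n" "z \<in> spx Z n" for m n \<theta> z
    using smaps_nat[OF s that] smaps_nat[OF t that] by simp
  have FlD: "\<exists>e. a = ((e, s k (act Z k n \<theta> z)), t k (act Z k n \<theta> z)) \<and> (e, s k (act Z k n \<theta> z)) \<in> spx V k"
    and FlD': "\<theta> \<in> deltas k n"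
    if z: "z \<in> spx Z n" and a: "(\<theta>, a) \<in> spx (?Fl n z) k" for n z k \<theta> a
  proof -
    show \<theta>: "\<theta> \<in> deltas k n" by (rule fib_deltas[OF a])
    obtain v w where vw: "a = (v, w)" by (cases a)
    have "v \<in> spx V k" "w \<in> spx W k" "fl k (v, w) = ?b k (act Z k n \<theta> z)"
      using a b_act[OF \<theta> z] unfolding vw spx_fib by auto
    then show "\<exists>e. a = ((e, s k (act Z k n \<theta> z)), t k (act Z k n \<theta> z)) \<and> (e, s k (act Z k n \<theta> z)) \<in> spx V k"
      using fl_apply[of v k w] vw by (cases v) auto
  qed
  have FrD: "\<exists>e. a = (s k (act Z k n \<theta> z), (e, t k (act Z k n \<theta> z))) \<and> (e, t k (act Z k n \<theta> z)) \<in> spx V k"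
    and FrD': "\<theta> \<in> deltas k n"
    if z: "z \<in> spx Z n" and a: "(\<theta>, a) \<in> spx (?Fr n z) k" for n z k \<theta> a
  proof -
    show \<theta>: "\<theta> \<in> deltas k n" by (rule fib_deltas[OF a])
    obtain w v where vw: "a = (w, v)" by (cases a)
    have "v \<in> spx V k" "w \<in> spx W k" "fr k (w, v) = ?b k (act Z k n \<theta> z)"
      using a b_act[OF \<theta> z] unfolding vw spx_fib by auto
    then show "\<exists>e. a = (s k (act Z k n \<theta> z), (e, t k (act Z k n \<theta> z))) \<and> (e, t k (act Z k n \<theta> z)) \<in> spx V k"
      using fr_apply[of v k w] vw by (cases v) auto
  qed
  \<comment> \<open>The recursion runs over all degrees at once, because \<open>el\<close> at
    \<open>z\<close> refers to children of images of \<open>z\<close> in every degree.\<close>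
  define \<tau> where "\<tau> = wfrec rel (\<lambda>f (n, z). if z \<in> spx Z n then \<beta> n (el f n z) else undefined)"
  have \<tau>_eq: "\<tau> (n, z) = \<beta> n (el \<tau> n z)" if z: "z \<in> spx Z n" for n z
  proof -
    have "\<tau> (n, z) = \<beta> n (el (cut \<tau> rel (n, z)) n z)" unfolding \<tau>_def using z by (subst wfrec[OF wf]) simp
    \<comment> \<open>On the fibres every recursive call goes to a predecessor, so the cut may be
      dropped.\<close>
    moreover have "gl (cut \<tau> rel (n, z)) n z k \<theta> a = gl \<tau> n z k \<theta> a" if a: "(\<theta>, a) \<in> spx (?Fl n z) k" for k \<theta> a
    proof -
      obtain e where "a = ((e, s k (act Z k n \<theta> z)), t k (act Z k n \<theta> z))" "(e, s k (act Z k n \<theta> z)) \<in> spx V k"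
        using FlD[OF z a] by blast
      then show ?thesis using l_rel[OF z FlD'[OF z a]] by (simp add: gl_def cut_apply)
    qed
    moreover have "gr (cut \<tau> rel (n, z)) n z k \<theta> a = gr \<tau> n z k \<theta> a" if a: "(\<theta>, a) \<in> spx (?Fr n z) k" for k \<theta> a
    proof -
      obtain e where "a = (s k (act Z k n \<theta> z), (e, t k (act Z k n \<theta> z)))" "(e, t k (act Z k n \<theta> z)) \<in> spx V k"
        using FrD[OF z a] by blast
      then show ?thesis using r_rel[OF z FrD'[OF z a]] by (simp add: gr_def cut_apply)
    qed
    ultimately have "el (cut \<tau> rel (n, z)) n z = el \<tau> n z"
      unfolding el_def by (intro arg_cong2[where f = Pair] refl ext restrict_ext) (auto intro!: restrict_ext simp: restrict_def)
    then show ?thesis using \<open>\<tau> (n, z) = \<beta> n (el (cut \<tau> rel (n, z)) n z)\<close> by simp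
  qed
  \<comment> \<open>The three properties have to be proved together: \<open>el \<tau> n z\<close> is
    a simplex of \<open>\<Phi> B\<close> only if the recursive values lie in \<open>B\<close>, over
    the right pairs, and depend simplicially on the branch.\<close>
  define good where "good k z \<longleftrightarrow> \<tau> (k, z) \<in> spx (tot B) k \<and> str B k (\<tau> (k, z)) = ?b k z \<and>
      (\<forall>j. \<forall>\<phi>\<in>deltas j k. \<tau> (j, act Z j k \<phi> z) = act (tot B) j k \<phi> (\<tau> (k, z)))" for k z
  have el_in: "el \<tau> n z \<in> spx (tot (\<Phi> B)) n"
    if z: "z \<in> spx Z n"
      and gl_good: "\<And>k \<theta> e. \<theta> \<in> deltas k n \<Longrightarrow> (e, s k (act Z k n \<theta> z)) \<in> spx V k \<Longrightarrow> good k (snd (l k e (act Z k n \<theta> z)))"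
      and gr_good: "\<And>k \<theta> e. \<theta> \<in> deltas k n \<Longrightarrow> (e, t k (act Z k n \<theta> z)) \<in> spx V k \<Longrightarrow> good k (snd (r k e (act Z k n \<theta> z)))"
    for n z
    unfolding el_def spx_bisim
  proof (intro conjI)
    show "(?b n z, \<lambda>k. \<lambda>(\<theta>, a)\<in>spx (?Fl n z) k. gl \<tau> n z k \<theta> a) \<in> spx (dprod_tot (sprod V W) WW fl (yl B)) n"
    proof (rule dprod_elem[OF VW WW fl b_in[OF z]])
      fix k \<theta> a assume a: "(\<theta>, a) \<in> spx (?Fl n z) k"
      note \<theta> = FlD'[OF z a]
      let ?z = "act Z k n \<theta> z"
      have z': "?z \<in> spx Z k" by (rule sset_act[OF Z \<theta> z])
      obtain e where e: "a = ((e, s k ?z), t k ?z)" "(e, s k ?z) \<in> spx V k" using FlD[OF z a] by blast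
      obtain e' c where c: "l k e ?z = (e', c)" "(e', t k ?z) \<in> spx V k" "c \<in> spx Z k" "s k c = q k (e, s k ?z)" "t k c = q k (e', t k ?z)"
        and c_act: "\<And>m \<phi>. \<phi> \<in> deltas m k \<Longrightarrow> l m (act E m k \<phi> e) (act Z m k \<phi> ?z) = (act E m k \<phi> e', act Z m k \<phi> c)"
        using l[OF z' e(2)] by blast
      have good: "good k c" using gl_good[OF \<theta> e(2)] c(1) by simp
      have g: "gl \<tau> n z k \<theta> a = (((e, s k ?z), (e', t k ?z)), \<tau> (k, c))" by (simp add: gl_def e(1) c(1))
      have y: "gl \<tau> n z k \<theta> a \<in> spx (tot (yl B)) k" unfolding g spx_y using e(2) c good by (simp add: good_def)
      then show "gl \<tau> n z k \<theta> a \<in> spx (tot (yl B)) k \<and> str (yl B) k (gl \<tau> n z k \<theta> a) = a"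
        unfolding g using str_y(1)[OF y[unfolded g]] by (simp add: e(1))
      fix j \<phi> assume \<phi>: "\<phi> \<in> deltas j k"
      have ca: "act Z j n (compose {..j} \<theta> \<phi>) z = act Z j k \<phi> ?z" by (rule sset_comp[OF Z \<phi> \<theta> z])
      show "gl \<tau> n z j (compose {..j} \<theta> \<phi>) (act (sprod V W) j k \<phi> a) = act (tot (yl B)) j k \<phi> (gl \<tau> n z k \<theta> a)"
        unfolding g act_y using good \<phi> c_act[OF \<phi>] by (simp add: gl_def ca e(1) act_V good_def)
    qed
    show "(?b n z, \<lambda>k. \<lambda>(\<theta>, a)\<in>spx (?Fr n z) k. gr \<tau> n z k \<theta> a) \<in> spx (dprod_tot (sprod W V) WW fr (yr B)) n"
    proof (rule dprod_elem[OF WV WW fr b_in[OF z]])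
      fix k \<theta> a assume a: "(\<theta>, a) \<in> spx (?Fr n z) k"
      note \<theta> = FrD'[OF z a]
      let ?z = "act Z k n \<theta> z"
      have z': "?z \<in> spx Z k" by (rule sset_act[OF Z \<theta> z])
      obtain e' where e': "a = (s k ?z, (e', t k ?z))" "(e', t k ?z) \<in> spx V k" using FrD[OF z a] by blast
      obtain e c where c: "r k e' ?z = (e, c)" "(e, s k ?z) \<in> spx V k" "c \<in> spx Z k" "s k c = q k (e, s k ?z)" "t k c = q k (e', t k ?z)"
        and c_act: "\<And>m \<phi>. \<phi> \<in> deltas m k \<Longrightarrow> r m (act E m k \<phi> e') (act Z m k \<phi> ?z) = (act E m k \<phi> e, act Z m k \<phi> c)"
        using r[OF z' e'(2)] by blast
      have good: "good k c" using gr_good[OF \<theta> e'(2)] c(1) by simp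
      have g: "gr \<tau> n z k \<theta> a = (((e, s k ?z), (e', t k ?z)), \<tau> (k, c))" by (simp add: gr_def e'(1) c(1))
      have y: "gr \<tau> n z k \<theta> a \<in> spx (tot (yr B)) k" unfolding g spx_y using e'(2) c good by (simp add: good_def)
      then show "gr \<tau> n z k \<theta> a \<in> spx (tot (yr B)) k \<and> str (yr B) k (gr \<tau> n z k \<theta> a) = a"
        unfolding g using str_y(2)[OF y[unfolded g]] by (simp add: e'(1))
      fix j \<phi> assume \<phi>: "\<phi> \<in> deltas j k"
      have ca: "act Z j n (compose {..j} \<theta> \<phi>) z = act Z j k \<phi> ?z" by (rule sset_comp[OF Z \<phi> \<theta> z])
      show "gr \<tau> n z j (compose {..j} \<theta> \<phi>) (act (sprod W V) j k \<phi> a) = act (tot (yr B)) j k \<phi> (gr \<tau> n z k \<theta> a)"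
        unfolding g act_y using good \<phi> c_act[OF \<phi>] by (simp add: gr_def ca e'(1) act_V good_def)
    qed
  qed simp
  have el_act: "act (tot (\<Phi> B)) m n \<phi> (el f n z) = el f m (act Z m n \<phi> z)" if \<phi>: "\<phi> \<in> deltas m n" and z: "z \<in> spx Z n" for f m n \<phi> z
  proof -
    have gl_eq: "gl f n z k (compose {..k} \<phi> \<theta>) a = gl f m (act Z m n \<phi> z) k \<theta> a" if "\<theta> \<in> deltas k m" for k \<theta> a
      using sset_comp[OF Z that \<phi> z] by (simp add: gl_def)
    have gr_eq: "gr f n z k (compose {..k} \<phi> \<theta>) a = gr f m (act Z m n \<phi> z) k \<theta> a" if "\<theta> \<in> deltas k m" for k \<theta> a
      using sset_comp[OF Z that \<phi> z] by (simp add: gr_def)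
    let ?z = "act Z m n \<phi> z"
    have "(\<lambda>k. \<lambda>(\<theta>, a)\<in>spx (?Fl m ?z) k. gl f n z k (compose {..k} \<phi> \<theta>) a) = (\<lambda>k. \<lambda>(\<theta>, a)\<in>spx (?Fl m ?z) k. gl f m ?z k \<theta> a)"
      by (rule ext, rule restrict_ext) (auto simp: gl_eq[OF fib_deltas])
    moreover have "(\<lambda>k. \<lambda>(\<theta>, a)\<in>spx (?Fr m ?z) k. gr f n z k (compose {..k} \<phi> \<theta>) a) = (\<lambda>k. \<lambda>(\<theta>, a)\<in>spx (?Fr m ?z) k. gr f m ?z k \<theta> a)"
      by (rule ext, rule restrict_ext) (auto simp: gr_eq[OF fib_deltas])
    ultimately show ?thesis
      unfolding el_def act_bisim act_dprod_elem[OF WW b_in[OF z] \<phi>] b_act[OF \<phi> z] by simp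
  qed
  have good: "z \<in> spx Z n \<longrightarrow> good n z" for n z
  proof (induction "(n, z)" arbitrary: n z rule: wf_induct_rule[OF wf])
    case (1 n z)
    show ?case
    proof
      assume z: "z \<in> spx Z n"
      have IH: "good k z'" if "((k, z'), (n, z)) \<in> rel" "z' \<in> spx Z k" for k z' using 1 that by blast
      \<comment> \<open>Naturality at \<open>z\<close> involves \<open>el\<close> at all images of
        \<open>z\<close>. Their children are children of \<open>z\<close> as well, which is why
        \<open>l_rel\<close> and \<open>r_rel\<close> mention an operator.\<close>
      have el: "el \<tau> m (act Z m n \<phi> z) \<in> spx (tot (\<Phi> B)) m" if \<phi>: "\<phi> \<in> deltas m n" for m \<phi>
      proof (rule el_in)
        let ?z = "act Z m n \<phi> z"
        show z': "?z \<in> spx Z m" by (rule sset_act[OF Z \<phi> z])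
        fix k \<theta> e assume \<theta>: "\<theta> \<in> deltas k m"
        note c = sset_comp[OF Z \<theta> \<phi> z] and \<phi>\<theta> = compose_deltas[OF \<phi> \<theta>]
        note z'' = sset_act[OF Z \<theta> z']
        show "good k (snd (l k e (act Z k m \<theta> ?z)))" if "(e, s k (act Z k m \<theta> ?z)) \<in> spx V k"
        proof (rule IH)
          show "((k, snd (l k e (act Z k m \<theta> ?z))), n, z) \<in> rel" using l_rel[OF z \<phi>\<theta>] that unfolding c by blast
          show "snd (l k e (act Z k m \<theta> ?z)) \<in> spx Z k" using l[OF z'' that] by auto
        qed
        show "good k (snd (r k e (act Z k m \<theta> ?z)))" if "(e, t k (act Z k m \<theta> ?z)) \<in> spx V k"
        proof (rule IH)
          show "((k, snd (r k e (act Z k m \<theta> ?z))), n, z) \<in> rel" using r_rel[OF z \<phi>\<theta>] that unfolding c by blast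
          show "snd (r k e (act Z k m \<theta> ?z)) \<in> spx Z k" using r[OF z'' that] by auto
        qed
      qed
      have el_z: "el \<tau> n z \<in> spx (tot (\<Phi> B)) n" using el[OF did_deltas] sset_id[OF Z z] by simp
      have "str B n (\<tau> (n, z)) = ?b n z"
        unfolding \<tau>_eq[OF z] slice_mapsD[OF B.\<beta> el_z] using str_bisim[OF el_z[unfolded el_def]] by (simp add: el_def)
      moreover have "\<tau> (m, act Z m n \<phi> z) = act (tot B) m n \<phi> (\<tau> (n, z))" if \<phi>: "\<phi> \<in> deltas m n" for m \<phi>
        unfolding \<tau>_eq[OF z] \<tau>_eq[OF sset_act[OF Z \<phi> z]] el_act[OF \<phi> z, symmetric]
        by (rule smaps_nat[OF slice_maps_smaps[OF B.\<beta>] \<phi> el_z])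
      moreover have "\<tau> (n, z) \<in> spx (tot B) n"
        unfolding \<tau>_eq[OF z] by (rule smaps_in[OF slice_maps_smaps[OF B.\<beta>] el_z])
      ultimately show "good n z" by (simp add: good_def)
    qed
  qed
  show ?thesis
  proof (intro bexI[of _ "\<lambda>n. \<lambda>z\<in>spx Z n. \<tau> (n, z)"] allI ballI)
    show "(\<lambda>n. \<lambda>z\<in>spx Z n. \<tau> (n, z)) \<in> smaps Z (tot B)"
      by (rule smapsI) (use good sset_act[OF Z] in \<open>auto simp: good_def\<close>)
    show "str B n ((\<lambda>z\<in>spx Z n. \<tau> (n, z)) z) = (s n z, t n z)" if "z \<in> spx Z n" for n z
      using good[of z n] that by (simp add: good_def)
  qed
qed

end

section \<open>Reflexivity, symmetry and transitivity by corecursive matching of branches\<close>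

context bisimulation
begin

lemma L_leg:
  assumes b: "b \<in> spx (tot B) n" and e: "(e, leg1 B n b) \<in> spx V n"
  shows "\<exists>e' c. L n e b = (e', c) \<and> (e', leg2 B n b) \<in> spx V n \<and> c \<in> spx (tot B) n \<and>
    leg1 B n c = q n (e, leg1 B n b) \<and> leg2 B n c = q n (e', leg2 B n b) \<and>
    (\<forall>m. \<forall>\<theta>\<in>deltas m n. L m (act E m n \<theta> e) (act (tot B) m n \<theta> b) = (act E m n \<theta> e', act (tot B) m n \<theta> c))"
proof -
  have str: "str B n b = (leg1 B n b, leg2 B n b)" using b by (simp add: leg)
  show ?thesis by (rule L[OF b str e]) (auto simp: leg)
qed

lemma R_leg:
  assumes b: "b \<in> spx (tot B) n" and e': "(e', leg2 B n b) \<in> spx V n"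
  shows "\<exists>e c. R n e' b = (e, c) \<and> (e, leg1 B n b) \<in> spx V n \<and> c \<in> spx (tot B) n \<and>
    leg1 B n c = q n (e, leg1 B n b) \<and> leg2 B n c = q n (e', leg2 B n b) \<and>
    (\<forall>m. \<forall>\<theta>\<in>deltas m n. R m (act E m n \<theta> e') (act (tot B) m n \<theta> b) = (act E m n \<theta> e, act (tot B) m n \<theta> c))"
proof -
  have str: "str B n b = (leg1 B n b, leg2 B n b)" using b by (simp add: leg)
  show ?thesis by (rule R[OF b str e']) (auto simp: leg)
qed

lemma child_B_L:
  "b \<in> spx (tot B) n \<Longrightarrow> \<theta> \<in> deltas m n \<Longrightarrow> (e, leg1 B m (act (tot B) m n \<theta> b)) \<in> spx V m \<Longrightarrow>
    ((m, snd (L m e (act (tot B) m n \<theta> b))), n, b) \<in> child_B"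
  using sset_act[OF B_sset] by (auto simp: child_B_def leg)

lemma child_B_R:
  "b \<in> spx (tot B) n \<Longrightarrow> \<theta> \<in> deltas m n \<Longrightarrow> (e, leg2 B m (act (tot B) m n \<theta> b)) \<in> spx V m \<Longrightarrow>
    ((m, snd (R m e (act (tot B) m n \<theta> b))), n, b) \<in> child_B"
  using sset_act[OF B_sset] by (auto simp: child_B_def leg)

lemmas leg1_B = leg1_smaps[OF B_sset B_str] and leg2_B = leg2_smaps[OF B_sset B_str]

text \<open>\<open>W\<close> is a coalgebra over the diagonal: each branch is matched with itself,
  and the recursion descends to the subtree.\<close>

lemma B_refl: "\<exists>\<rho>\<in>smaps W (tot B). \<forall>n. \<forall>w\<in>spx W n. str B n (\<rho> n w) = (w, w)"
proof -
  have V_sid: "(e, w) \<in> spx V n" if "w \<in> spx W n" "(e, sid W n w) \<in> spx V n" for n w e using that by simp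
  have op: "\<exists>e' w'. (e, q n (e, w)) = (e', w') \<and> (e', sid W n w) \<in> spx V n \<and> w' \<in> spx W n \<and>
      sid W n w' = q n (e, sid W n w) \<and> sid W n w' = q n (e', sid W n w) \<and>
      (\<forall>m. \<forall>\<theta>\<in>deltas m n. (act E m n \<theta> e, q m (act E m n \<theta> e, act W m n \<theta> w)) = (act E m n \<theta> e', act W m n \<theta> w'))"
    if w: "w \<in> spx W n" and e: "(e, sid W n w) \<in> spx V n" for n w e
    using w V_sid[OF w e] smaps_in[OF q V_sid[OF w e]] smaps_nat[OF q _ V_sid[OF w e]] by (simp add: act_V)
  have op': "\<exists>e w'. (e', q n (e', w)) = (e, w') \<and> (e, sid W n w) \<in> spx V n \<and> w' \<in> spx W n \<and>
      sid W n w' = q n (e, sid W n w) \<and> sid W n w' = q n (e', sid W n w) \<and>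
      (\<forall>m. \<forall>\<theta>\<in>deltas m n. (act E m n \<theta> e', q m (act E m n \<theta> e', act W m n \<theta> w)) = (act E m n \<theta> e, act W m n \<theta> w'))"
    if w: "w \<in> spx W n" and e: "(e', sid W n w) \<in> spx V n" for n w e'
    using w V_sid[OF w e] smaps_in[OF q V_sid[OF w e]] smaps_nat[OF q _ V_sid[OF w e]] by (simp add: act_V)
  have rel: "((m, snd (e, q m (e, act W m n \<theta> w))), n, w) \<in> child"
    if "w \<in> spx W n" "\<theta> \<in> deltas m n" "(e, sid W m (act W m n \<theta> w)) \<in> spx V m" for m n \<theta> w e
    using that sset_act[OF W that(2,1)] by (auto simp: child_def)
  have "\<exists>\<rho>\<in>smaps W (tot B). \<forall>n. \<forall>w\<in>spx W n. str B n (\<rho> n w) = (sid W n w, sid W n w)"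
    by (rule coalgebra_map[of W "sid W" "sid W" "\<lambda>n e w. (e, q n (e, w))" "\<lambda>n e w. (e, q n (e, w))" child])
      (fact W sid_smaps[OF W] op op' wf_child rel)+
  then show ?thesis by simp
qed

text \<open>Exchanging the operations \<open>L\<close> and \<open>R\<close> makes \<open>B\<close>
  with swapped legs a coalgebra.\<close>

lemma B_sym: "\<exists>\<sigma>\<in>smaps (tot B) (tot B). \<forall>n. \<forall>b\<in>spx (tot B) n. str B n (\<sigma> n b) = (leg2 B n b, leg1 B n b)"
proof (rule coalgebra_map[of "tot B" "leg2 B" "leg1 B" R L child_B])
  show "\<exists>e' z'. R n e z = (e', z') \<and> (e', leg1 B n z) \<in> spx V n \<and> z' \<in> spx (tot B) n \<and>
      leg2 B n z' = q n (e, leg2 B n z) \<and> leg1 B n z' = q n (e', leg1 B n z) \<and>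
      (\<forall>m. \<forall>\<theta>\<in>deltas m n. R m (act E m n \<theta> e) (act (tot B) m n \<theta> z) = (act E m n \<theta> e', act (tot B) m n \<theta> z'))"
    if "z \<in> spx (tot B) n" "(e, leg2 B n z) \<in> spx V n" for n z e
    using R_leg[OF that] by blast
  show "\<exists>e z'. L n e' z = (e, z') \<and> (e, leg2 B n z) \<in> spx V n \<and> z' \<in> spx (tot B) n \<and>
      leg2 B n z' = q n (e, leg2 B n z) \<and> leg1 B n z' = q n (e', leg1 B n z) \<and>
      (\<forall>m. \<forall>\<theta>\<in>deltas m n. L m (act E m n \<theta> e') (act (tot B) m n \<theta> z) = (act E m n \<theta> e, act (tot B) m n \<theta> z'))"
    if "z \<in> spx (tot B) n" "(e', leg1 B n z) \<in> spx V n" for n z e'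
    using L_leg[OF that] by blast
qed (fact B_sset leg1_B leg2_B wf_child_B child_B_L child_B_R)+

abbreviation "BB \<equiv> pullback (tot B) (tot B) (leg2 B) (leg1 B)"

text \<open>Composable pairs form a coalgebra: a branch is passed through the middle tree, by
  \<open>L\<close> on the first and then on the second bisimulation, and by \<open>R\<close> in the
  opposite order.\<close>

lemma B_trans: "\<exists>\<tau>\<in>smaps BB (tot B). \<forall>n b c. (b, c) \<in> spx BB n \<longrightarrow> str B n (\<tau> n (b, c)) = (leg1 B n b, leg2 B n c)"
proof -
  have BB: "sset BB" by (rule sset_pullback[OF B_sset B_sset leg2_B leg1_B])
  define s where "s = scomp BB (leg1 B) (sfst BB)"
  define t where "t = scomp BB (leg2 B) (ssnd BB)"
  have s: "s \<in> smaps BB W" unfolding s_def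
    by (rule scomp_smaps[OF sfst_pullback[OF B_sset B_sset leg2_B leg1_B] leg1_B BB])
  have t: "t \<in> smaps BB W" unfolding t_def
    by (rule scomp_smaps[OF ssnd_pullback[OF B_sset B_sset leg2_B leg1_B] leg2_B BB])
  have st: "s n (b, c) = leg1 B n b" "t n (b, c) = leg2 B n c" if "(b, c) \<in> spx BB n" for n b c
    using that by (simp_all add: s_def t_def sfst_def ssnd_def)
  define l where "l n e z = (case L n e (fst z) of (e', b) \<Rightarrow> case L n e' (snd z) of (e'', c) \<Rightarrow> (e'', (b, c)))" for n e z
  define r where "r n e z = (case R n e (snd z) of (e', c) \<Rightarrow> case R n e' (fst z) of (e'', b) \<Rightarrow> (e'', (b, c)))" for n e z
  \<comment> \<open>Both operations replace the first component by one of its children, so descent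
    in that component suffices.\<close>
  define rel where "rel = inv_image child_B (\<lambda>(n, z :: 'v \<times> 'v). (n, fst z) :: nat \<times> 'v)"
  have wf_rel: "wf rel" unfolding rel_def by (rule wf_inv_image[OF wf_child_B])
  have l: "\<exists>e' z'. l n e z = (e', z') \<and> (e', t n z) \<in> spx V n \<and> z' \<in> spx BB n \<and> s n z' = q n (e, s n z) \<and> t n z' = q n (e', t n z) \<and>
      (\<forall>m. \<forall>\<theta>\<in>deltas m n. l m (act E m n \<theta> e) (act BB m n \<theta> z) = (act E m n \<theta> e', act BB m n \<theta> z')) \<and> fst z' = snd (L n e (fst z))"
    if z: "z \<in> spx BB n" and e: "(e, s n z) \<in> spx V n" for n z e
  proof -
    obtain b c where bc[simp]: "z = (b, c)" by (cases z)
    have bc': "(b, c) \<in> spx BB n" "b \<in> spx (tot B) n" "c \<in> spx (tot B) n" "leg2 B n b = leg1 B n c" using z by (auto simp: spx_pullback)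
    have e1: "(e, leg1 B n b) \<in> spx V n" using e st[OF bc'(1)] by simp
    obtain e' b' where b': "L n e b = (e', b')" "(e', leg2 B n b) \<in> spx V n" "b' \<in> spx (tot B) n"
      "leg1 B n b' = q n (e, leg1 B n b)" "leg2 B n b' = q n (e', leg2 B n b)"
      "\<forall>m. \<forall>\<theta>\<in>deltas m n. L m (act E m n \<theta> e) (act (tot B) m n \<theta> b) = (act E m n \<theta> e', act (tot B) m n \<theta> b')"
      using L_leg[OF bc'(2) e1] by (elim exE conjE)
    have e2: "(e', leg1 B n c) \<in> spx V n" using b'(2) bc'(4) by simp
    obtain e'' c' where c': "L n e' c = (e'', c')" "(e'', leg2 B n c) \<in> spx V n" "c' \<in> spx (tot B) n"
      "leg1 B n c' = q n (e', leg1 B n c)" "leg2 B n c' = q n (e'', leg2 B n c)"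
      "\<forall>m. \<forall>\<theta>\<in>deltas m n. L m (act E m n \<theta> e') (act (tot B) m n \<theta> c) = (act E m n \<theta> e'', act (tot B) m n \<theta> c')"
      using L_leg[OF bc'(3) e2] by (elim exE conjE)
    have "(b', c') \<in> spx BB n" using b' c' bc'(4) by (simp add: spx_pullback)
    then show ?thesis using b' c' st[OF bc'(1)] st[of b' c' n] by (simp add: l_def)
  qed
  \<comment> \<open>The last clause is for the descent along \<open>rel\<close>: the new first
    component is reached from the branch \<open>d\<close> of the middle tree that \<open>R\<close>
    finds for the second bisimulation.\<close>
  have r: "\<exists>e z'. r n e' z = (e, z') \<and> (e, s n z) \<in> spx V n \<and> z' \<in> spx BB n \<and> s n z' = q n (e, s n z) \<and> t n z' = q n (e', t n z) \<and>
      (\<forall>m. \<forall>\<theta>\<in>deltas m n. r m (act E m n \<theta> e') (act BB m n \<theta> z) = (act E m n \<theta> e, act BB m n \<theta> z')) \<and>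
      (\<exists>d. (d, leg2 B n (fst z)) \<in> spx V n \<and> fst z' = snd (R n d (fst z)))"
    if z: "z \<in> spx BB n" and e: "(e', t n z) \<in> spx V n" for n z e'
  proof -
    obtain b c where bc[simp]: "z = (b, c)" by (cases z)
    have bc': "(b, c) \<in> spx BB n" "b \<in> spx (tot B) n" "c \<in> spx (tot B) n" "leg2 B n b = leg1 B n c" using z by (auto simp: spx_pullback)
    have e1: "(e', leg2 B n c) \<in> spx V n" using e st[OF bc'(1)] by simp
    obtain d c' where c': "R n e' c = (d, c')" "(d, leg1 B n c) \<in> spx V n" "c' \<in> spx (tot B) n"
      "leg1 B n c' = q n (d, leg1 B n c)" "leg2 B n c' = q n (e', leg2 B n c)"
      "\<forall>m. \<forall>\<theta>\<in>deltas m n. R m (act E m n \<theta> e') (act (tot B) m n \<theta> c) = (act E m n \<theta> d, act (tot B) m n \<theta> c')"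
      using R_leg[OF bc'(3) e1] by (elim exE conjE)
    have e2: "(d, leg2 B n b) \<in> spx V n" using c'(2) bc'(4) by simp
    obtain e b' where b': "R n d b = (e, b')" "(e, leg1 B n b) \<in> spx V n" "b' \<in> spx (tot B) n"
      "leg1 B n b' = q n (e, leg1 B n b)" "leg2 B n b' = q n (d, leg2 B n b)"
      "\<forall>m. \<forall>\<theta>\<in>deltas m n. R m (act E m n \<theta> d) (act (tot B) m n \<theta> b) = (act E m n \<theta> e, act (tot B) m n \<theta> b')"
      using R_leg[OF bc'(2) e2] by (elim exE conjE)
    have "(b', c') \<in> spx BB n" using b' c' bc'(4) by (simp add: spx_pullback)
    then show ?thesis using b' c' e2 st[OF bc'(1)] st[of b' c' n] by (auto simp: r_def intro!: exI[of _ d])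
  qed
  have fst_act: "fst (act BB m n \<theta> z) = act (tot B) m n \<theta> (fst z)" for m n \<theta> z by (cases z) simp
  have fst_in: "fst z \<in> spx (tot B) n" "s n z = leg1 B n (fst z)" if "z \<in> spx BB n" for n z
    using that st by (cases z; auto simp: spx_pullback)+
  have "\<exists>\<tau>\<in>smaps BB (tot B). \<forall>n. \<forall>z\<in>spx BB n. str B n (\<tau> n z) = (s n z, t n z)"
  proof (rule coalgebra_map[of BB s t l r rel])
    show "\<exists>e' z'. l n e z = (e', z') \<and> (e', t n z) \<in> spx V n \<and> z' \<in> spx BB n \<and> s n z' = q n (e, s n z) \<and> t n z' = q n (e', t n z) \<and>
      (\<forall>m. \<forall>\<theta>\<in>deltas m n. l m (act E m n \<theta> e) (act BB m n \<theta> z) = (act E m n \<theta> e', act BB m n \<theta> z'))"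
      if "z \<in> spx BB n" "(e, s n z) \<in> spx V n" for n z e using l[OF that] by (elim exE conjE) (intro exI conjI)
    show "\<exists>e z'. r n e' z = (e, z') \<and> (e, s n z) \<in> spx V n \<and> z' \<in> spx BB n \<and> s n z' = q n (e, s n z) \<and> t n z' = q n (e', t n z) \<and>
      (\<forall>m. \<forall>\<theta>\<in>deltas m n. r m (act E m n \<theta> e') (act BB m n \<theta> z) = (act E m n \<theta> e, act BB m n \<theta> z'))"
      if "z \<in> spx BB n" "(e', t n z) \<in> spx V n" for n z e' using r[OF that] by (elim exE conjE) (intro exI conjI)
    show "((m, snd (l m e (act BB m n \<theta> z))), n, z) \<in> rel"
      if z: "z \<in> spx BB n" and \<theta>: "\<theta> \<in> deltas m n" and e: "(e, s m (act BB m n \<theta> z)) \<in> spx V m" for m n \<theta> z e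
    proof -
      have z': "act BB m n \<theta> z \<in> spx BB m" by (rule sset_act[OF BB \<theta> z])
      have "fst (snd (l m e (act BB m n \<theta> z))) = snd (L m e (act (tot B) m n \<theta> (fst z)))" using l[OF z' e] by (auto simp: fst_act)
      then show ?thesis using child_B_L[OF fst_in(1)[OF z] \<theta>] e fst_in(2)[OF z'] by (simp add: rel_def fst_act)
    qed
    show "((m, snd (r m e (act BB m n \<theta> z))), n, z) \<in> rel"
      if z: "z \<in> spx BB n" and \<theta>: "\<theta> \<in> deltas m n" and e: "(e, t m (act BB m n \<theta> z)) \<in> spx V m" for m n \<theta> z e
    proof -
      have z': "act BB m n \<theta> z \<in> spx BB m" by (rule sset_act[OF BB \<theta> z])
      obtain d where "(d, leg2 B m (act (tot B) m n \<theta> (fst z))) \<in> spx V m"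
        "fst (snd (r m e (act BB m n \<theta> z))) = snd (R m d (act (tot B) m n \<theta> (fst z)))" using r[OF z' e] by (auto simp: fst_act)
      then show ?thesis using child_B_R[OF fst_in(1)[OF z] \<theta>] by (simp add: rel_def)
    qed
  qed (fact BB s t wf_rel)+
  then obtain \<tau> where \<tau>: "\<tau> \<in> smaps BB (tot B)" "\<forall>n. \<forall>z\<in>spx BB n. str B n (\<tau> n z) = (s n z, t n z)"
    by (rule bexE)
  then show ?thesis by (intro bexI[of _ \<tau>]) (simp_all add: st)
qed

theorem pseudo_equivalence_B: "pseudo_equivalence W B"
proof -
  obtain \<rho> where \<rho>: "\<rho> \<in> smaps W (tot B)" "\<And>n w. w \<in> spx W n \<Longrightarrow> str B n (\<rho> n w) = (w, w)"
    using B_refl by blast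
  obtain \<sigma> where \<sigma>: "\<sigma> \<in> smaps (tot B) (tot B)" "\<And>n b. b \<in> spx (tot B) n \<Longrightarrow> str B n (\<sigma> n b) = (leg2 B n b, leg1 B n b)"
    using B_sym by blast
  obtain \<tau> where \<tau>: "\<tau> \<in> smaps BB (tot B)" "\<forall>n b c. (b, c) \<in> spx BB n \<longrightarrow> str B n (\<tau> n (b, c)) = (leg1 B n b, leg2 B n c)"
    by (rule bexE[OF B_trans])
  have "scomp W (str B) \<rho> = (\<lambda>n. \<lambda>y\<in>spx W n. (y, y))"
    using \<rho>(2) by (auto simp: scomp_def compose_def restrict_def fun_eq_iff)
  moreover have "scomp (tot B) (leg1 B) \<sigma> = leg2 B" "scomp (tot B) (leg2 B) \<sigma> = leg1 B"
    using smaps_in[OF \<sigma>(1)] \<sigma>(2) by (auto simp: scomp_def compose_def restrict_def fun_eq_iff leg1_def leg2_def)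
  moreover have "scomp BB (leg1 B) \<tau> = scomp BB (leg1 B) (sfst BB)" "scomp BB (leg2 B) \<tau> = scomp BB (leg2 B) (ssnd BB)"
    using smaps_in[OF \<tau>(1)] \<tau>(2) by (auto simp: scomp_def compose_def restrict_def fun_eq_iff leg sfst_def ssnd_def)
  ultimately show ?thesis
    using \<rho>(1) \<sigma>(1) \<tau>(1) B.B unfolding pseudo_equivalence_def Let_def by blast
qed

end

theorem mainTheorem5:
  fixes \<kappa> :: "'k rel"
    and E U W :: "'v sset"
    and \<pi> :: "('v, 'v) smap"
    and \<alpha> :: "(('v, 'v, 'v) poly, 'v) smap"
    and B :: "('v, 'v \<times> 'v) slice"
    and \<beta> :: "(('v, 'v \<times> 'v, 'v) bisim, 'v) smap"
  assumes "inaccessible \<kappa>"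
    and "closed_universe \<kappa> (UNIV :: 'v set)"
    and "generic_small_kan_fibration \<kappa> E U \<pi>"
    and "kan_complex U"
    and "is_W_type E U \<pi> W \<alpha>"
    and "is_bisimulation E U \<pi> W \<alpha> B \<beta>"
  shows "pseudo_equivalence W B \<and>
         kan_fibration (tot B) (sprod W W) (str B) \<and>
         kan_complex (quotient_sset W B)"
proof -
  interpret bisimulation \<kappa> E U W \<pi> \<alpha> B \<beta>
    by unfold_locales (use assms in \<open>auto simp: generic_small_kan_fibration_def\<close>)
  interpret kan_pseudo_equivalence W B
    by unfold_locales (fact kan_W pseudo_equivalence_B kan_B)+
  show ?thesis using pseudo_equivalence_B kan_B kan_complex_quotient by blast
qed

end
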